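(* It is provable in $\mathbf{ZF}$ that $\mathbf{CMC}$ implies the following: (i) for every topological space $\mathbf{X}$, the families $\mathcal{CO}_{\delta}(\mathbf{X})$, $\mathcal{Z}(\mathbf{X})$ and $\mathcal{G}_{\delta}(\mathbf{X})$ are stable under countable intersections; (ii) for every topological space $\mathbf{X}$, the space $(\mathbf{X})_{\delta}$ is a $P$-space. Furthermore, (i) implies (ii) (in $\mathbf{ZF}$).
   Context: The base theory is $\mathbf{ZF}$ (no Axiom of Choice). A set is countable if it is equipotent to a subset of $\omega$, and denumerable if it is infinite and countable. $\mathbf{CMC}$: every denumerable family of non-empty sets has a multiple choice function, i.e. a function assigning to each member (index) a non-empty finite subset of it. A family $\mathcal{A}$ of subsets of a set is stable under countable intersections if $\bigcap\mathcal{U}\in\mathcal{A}$ for every non-empty countable $\mathcal{U}\subseteq\mathcal{A}$. For a topological space $\mathbf{X}$: $\mathcal{CO}_\delta(\mathbf{X})$ is the family of all intersections of non-empty countable families of clopen sets of $\mathbf{X}$; $\mathcal{Z}(\mathbf{X})$ is the family of all zero-sets $f^{-1}[\{0\}]$ with $f:\mathbf{X}\to\mathbb{R}$ continuous; $\mathcal{G}_\delta(\mathbf{X})$ is the family of all $G_\delta$-sets of $\mathbf{X}$. $(\mathbf{X})_\delta$ is the underlying set $X$ of $\mathbf{X}$ with the topology having $\mathcal{G}_\delta(\mathbf{X})$ as a base. A topological space is a $P$-space if all its $G_\delta$-sets are open. *)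

theory Defs
  imports Main
begin

text \<open>
  The theorem is about provability in ZF without choice, whereas HOL itself has a choice
  operator. ZF is therefore embedded deeply: the formulas of the first-order language of set
  theory form a datatype, provability is a natural deduction calculus for classical first-order
  logic with equality, and CMC and the topological claims are object-level sentences.
\<close>

section \<open>First-order logic of set theory\<close>

text \<open>Variables are de Bruijn indices; the language has no function symbols, so that
  substitution is just renaming.\<close>

datatype fm = Fls | Mem nat nat | Eql nat nat | Imp fm fm | All fm

primrec rename :: "(nat \<Rightarrow> nat) \<Rightarrow> fm \<Rightarrow> fm" where
  "rename r Fls = Fls"
| "rename r (Mem i j) = Mem (r i) (r j)"
| "rename r (Eql i j) = Eql (r i) (r j)"
| "rename r (Imp p q) = Imp (rename r p) (rename r q)"
| "rename r (All p) = All (rename (case_nat 0 (\<lambda>i. Suc (r i))) p)"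

text \<open>\<open>inst t p\<close> replaces variable 0 of \<open>p\<close> by the variable \<open>t\<close>
  and lowers the other free variables by one.\<close>

definition inst :: "nat \<Rightarrow> fm \<Rightarrow> fm" where
  "inst t p = rename (case_nat t (\<lambda>i. i)) p"

inductive proves :: "fm set \<Rightarrow> fm \<Rightarrow> bool"  (infix "\<turnstile>" 20) where
  Assm: "p \<in> H \<Longrightarrow> H \<turnstile> p"
| ImpI: "insert p H \<turnstile> q \<Longrightarrow> H \<turnstile> Imp p q"
| ImpE: "H \<turnstile> Imp p q \<Longrightarrow> H \<turnstile> p \<Longrightarrow> H \<turnstile> q"
| Contr: "insert (Imp p Fls) H \<turnstile> Fls \<Longrightarrow> H \<turnstile> p"
| AllI: "rename Suc ` H \<turnstile> p \<Longrightarrow> H \<turnstile> All p"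
| AllE: "H \<turnstile> All p \<Longrightarrow> H \<turnstile> inst t p"
| Refl: "H \<turnstile> Eql t t"
| Subst: "H \<turnstile> Eql s t \<Longrightarrow> H \<turnstile> inst s p \<Longrightarrow> H \<turnstile> inst t p"

text \<open>\<open>free_below n p\<close>: all free variables of \<open>p\<close> are less than \<open>n\<close>.\<close>

primrec free_below :: "nat \<Rightarrow> fm \<Rightarrow> bool" where
  "free_below n Fls \<longleftrightarrow> True"
| "free_below n (Mem i j) \<longleftrightarrow> i < n \<and> j < n"
| "free_below n (Eql i j) \<longleftrightarrow> i < n \<and> j < n"
| "free_below n (Imp p q) \<longleftrightarrow> free_below n p \<and> free_below n q"
| "free_below n (All p) \<longleftrightarrow> free_below (Suc n) p"

definition universal_closures :: "fm \<Rightarrow> fm set" where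
  "universal_closures p = {(All ^^ n) p |n. free_below n p}"


section \<open>Formulas with named bound variables\<close>

text \<open>
  To write formulas legibly, we use functions from the number \<open>d\<close> of enclosing quantifiers
  to \<open>fm\<close>, in which a bound variable is represented by its level, the number of
  quantifiers enclosing its own binder. In a context with \<open>d\<close> enclosing quantifiers, level
  \<open>x\<close> is de Bruijn index \<open>d - Suc x\<close>.  A function \<open>var \<Rightarrow> form\<close> thus plays the role of a
  formula with a distinguished variable, and bound variables are HOL-bound.
\<close>

type_synonym var = nat
type_synonym form = "nat \<Rightarrow> fm"

definition fls :: form where "fls = (\<lambda>d. Fls)"

definition mem :: "var \<Rightarrow> var \<Rightarrow> form"  (infix "\<^bold>\<in>" 50) where
  "x \<^bold>\<in> y = (\<lambda>d. Mem (d - Suc x) (d - Suc y))"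

definition eql :: "var \<Rightarrow> var \<Rightarrow> form"  (infix "\<^bold>=" 50) where
  "x \<^bold>= y = (\<lambda>d. Eql (d - Suc x) (d - Suc y))"

definition imp :: "form \<Rightarrow> form \<Rightarrow> form"  (infixr "\<^bold>\<longrightarrow>" 25) where
  "(A \<^bold>\<longrightarrow> B) = (\<lambda>d. Imp (A d) (B d))"

definition all :: "(var \<Rightarrow> form) \<Rightarrow> form"  (binder "\<^bold>\<forall>" 10) where
  "all F = (\<lambda>d. All (F d (Suc d)))"

definition neg :: "form \<Rightarrow> form"  ("\<^bold>\<not> _" [40] 40) where
  "(\<^bold>\<not> A) = (A \<^bold>\<longrightarrow> fls)"

definition disj :: "form \<Rightarrow> form \<Rightarrow> form"  (infixr "\<^bold>\<or>" 30) where
  "(A \<^bold>\<or> B) = (\<^bold>\<not> A \<^bold>\<longrightarrow> B)"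

definition conj :: "form \<Rightarrow> form \<Rightarrow> form"  (infixr "\<^bold>\<and>" 35) where
  "(A \<^bold>\<and> B) = (\<^bold>\<not> (A \<^bold>\<longrightarrow> \<^bold>\<not> B))"

definition iff :: "form \<Rightarrow> form \<Rightarrow> form"  (infixr "\<^bold>\<longleftrightarrow>" 25) where
  "(A \<^bold>\<longleftrightarrow> B) = ((A \<^bold>\<longrightarrow> B) \<^bold>\<and> (B \<^bold>\<longrightarrow> A))"

definition ex :: "(var \<Rightarrow> form) \<Rightarrow> form"  (binder "\<^bold>\<exists>" 10) where
  "ex F = (\<^bold>\<not> (\<^bold>\<forall>x. \<^bold>\<not> F x))"

definition ex1 :: "(var \<Rightarrow> form) \<Rightarrow> form"  (binder "\<^bold>\<exists>\<^bold>!" 10) where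
  "ex1 F = (\<^bold>\<exists>x. F x \<^bold>\<and> (\<^bold>\<forall>y. F y \<^bold>\<longrightarrow> y \<^bold>= x))"

definition ball :: "var \<Rightarrow> (var \<Rightarrow> form) \<Rightarrow> form" where
  "ball a F = (\<^bold>\<forall>x. x \<^bold>\<in> a \<^bold>\<longrightarrow> F x)"

definition bex :: "var \<Rightarrow> (var \<Rightarrow> form) \<Rightarrow> form" where
  "bex a F = (\<^bold>\<exists>x. x \<^bold>\<in> a \<^bold>\<and> F x)"

syntax
  "_ball" :: "pttrn \<Rightarrow> var \<Rightarrow> form \<Rightarrow> form"  ("(3\<^bold>\<forall>_\<^bold>\<in>_./ _)" [0, 51, 10] 10)
  "_bex" :: "pttrn \<Rightarrow> var \<Rightarrow> form \<Rightarrow> form"  ("(3\<^bold>\<exists>_\<^bold>\<in>_./ _)" [0, 51, 10] 10)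
translations
  "\<^bold>\<forall>x\<^bold>\<in>a. F" \<rightleftharpoons> "CONST ball a (\<lambda>x. F)"
  "\<^bold>\<exists>x\<^bold>\<in>a. F" \<rightleftharpoons> "CONST bex a (\<lambda>x. F)"

definition sentence :: "form \<Rightarrow> fm" where
  "sentence A = A 0"

text \<open>An arbitrary formula \<open>p\<close> inside a \<open>form\<close>: \<open>with1 p x\<close> puts \<open>x\<close> for variable 0 of
  \<open>p\<close>, and \<open>with2 p x y\<close> puts \<open>x\<close>, \<open>y\<close> for variables 0 and 1. The remaining
  variables of \<open>p\<close> are parameters, free in the whole formula; hence the offset \<open>d\<close>.\<close>

definition with1 :: "fm \<Rightarrow> var \<Rightarrow> form" where
  "with1 p x = (\<lambda>d. rename (case_nat (d - Suc x) (\<lambda>i. d + i)) p)"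

definition with2 :: "fm \<Rightarrow> var \<Rightarrow> var \<Rightarrow> form" where
  "with2 p x y = (\<lambda>d. rename (case_nat (d - Suc x) (case_nat (d - Suc y) (\<lambda>i. d + i))) p)"


section \<open>The axioms of ZF\<close>

definition subset :: "var \<Rightarrow> var \<Rightarrow> form"  (infix "\<^bold>\<subseteq>" 50) where
  "a \<^bold>\<subseteq> b = (\<^bold>\<forall>x\<^bold>\<in>a. x \<^bold>\<in> b)"

definition empty :: "var \<Rightarrow> form" where
  "empty a = (\<^bold>\<forall>x. \<^bold>\<not> x \<^bold>\<in> a)"

definition nonempty :: "var \<Rightarrow> form" where
  "nonempty a = (\<^bold>\<exists>x. x \<^bold>\<in> a)"

text \<open>\<open>succ s x\<close>: \<open>s = x \<union> {x}\<close>.\<close>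

definition succ :: "var \<Rightarrow> var \<Rightarrow> form" where
  "succ s x = (\<^bold>\<forall>z. z \<^bold>\<in> s \<^bold>\<longleftrightarrow> (z \<^bold>\<in> x \<^bold>\<or> z \<^bold>= x))"

definition is_inductive :: "var \<Rightarrow> form" where
  "is_inductive w = ((\<^bold>\<exists>e\<^bold>\<in>w. empty e) \<^bold>\<and> (\<^bold>\<forall>x\<^bold>\<in>w. \<^bold>\<exists>s\<^bold>\<in>w. succ s x))"

definition Extensionality :: form where
  "Extensionality = (\<^bold>\<forall>a. \<^bold>\<forall>b. (\<^bold>\<forall>x. x \<^bold>\<in> a \<^bold>\<longleftrightarrow> x \<^bold>\<in> b) \<^bold>\<longrightarrow> a \<^bold>= b)"

definition Foundation :: form where
  "Foundation = (\<^bold>\<forall>a. nonempty a \<^bold>\<longrightarrow> (\<^bold>\<exists>x\<^bold>\<in>a. \<^bold>\<forall>y\<^bold>\<in>x. \<^bold>\<not> y \<^bold>\<in> a))"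

definition Pairing :: form where
  "Pairing = (\<^bold>\<forall>a. \<^bold>\<forall>b. \<^bold>\<exists>c. \<^bold>\<forall>x. x \<^bold>\<in> c \<^bold>\<longleftrightarrow> (x \<^bold>= a \<^bold>\<or> x \<^bold>= b))"

definition Unions :: form where
  "Unions = (\<^bold>\<forall>a. \<^bold>\<exists>b. \<^bold>\<forall>x. x \<^bold>\<in> b \<^bold>\<longleftrightarrow> (\<^bold>\<exists>y\<^bold>\<in>a. x \<^bold>\<in> y))"

definition Powerset :: form where
  "Powerset = (\<^bold>\<forall>a. \<^bold>\<exists>b. \<^bold>\<forall>x. x \<^bold>\<in> b \<^bold>\<longleftrightarrow> x \<^bold>\<subseteq> a)"

definition Infinity :: form where
  "Infinity = (\<^bold>\<exists>w. is_inductive w)"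

definition Separation :: "fm \<Rightarrow> form" where
  "Separation p = (\<^bold>\<forall>a. \<^bold>\<exists>b. \<^bold>\<forall>x. x \<^bold>\<in> b \<^bold>\<longleftrightarrow> (x \<^bold>\<in> a \<^bold>\<and> with1 p x))"

definition Replacement :: "fm \<Rightarrow> form" where
  "Replacement p = (\<^bold>\<forall>a.
     (\<^bold>\<forall>x\<^bold>\<in>a. \<^bold>\<forall>y. \<^bold>\<forall>z. with2 p x y \<^bold>\<and> with2 p x z \<^bold>\<longrightarrow> y \<^bold>= z) \<^bold>\<longrightarrow>
     (\<^bold>\<exists>b. \<^bold>\<forall>y. y \<^bold>\<in> b \<^bold>\<longleftrightarrow> (\<^bold>\<exists>x\<^bold>\<in>a. with2 p x y)))"

definition ZF :: "fm set" where
  "ZF = sentence ` {Extensionality, Foundation, Pairing, Unions, Powerset, Infinity}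
      \<union> (\<Union>p. universal_closures (sentence (Separation p)))
      \<union> (\<Union>p. universal_closures (sentence (Replacement p)))"


section \<open>Functions, countability and CMC\<close>

text \<open>\<open>opair p x y\<close>: \<open>p\<close> is the Kuratowski pair \<open>{{x}, {x, y}}\<close>.\<close>

definition opair :: "var \<Rightarrow> var \<Rightarrow> var \<Rightarrow> form" where
  "opair p x y = (\<^bold>\<forall>u. u \<^bold>\<in> p \<^bold>\<longleftrightarrow>
     ((\<^bold>\<forall>z. z \<^bold>\<in> u \<^bold>\<longleftrightarrow> z \<^bold>= x) \<^bold>\<or> (\<^bold>\<forall>z. z \<^bold>\<in> u \<^bold>\<longleftrightarrow> (z \<^bold>= x \<^bold>\<or> z \<^bold>= y))))"

text \<open>\<open>rel r x y\<close>: \<open>(x, y) \<in> r\<close>, that is \<open>r(x) = y\<close> for functions;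
  \<open>rel2 f x y z\<close>: \<open>((x, y), z) \<in> f\<close>, that is \<open>f(x, y) = z\<close>.\<close>

definition rel :: "var \<Rightarrow> var \<Rightarrow> var \<Rightarrow> form" where
  "rel r x y = (\<^bold>\<exists>p\<^bold>\<in>r. opair p x y)"

definition rel2 :: "var \<Rightarrow> var \<Rightarrow> var \<Rightarrow> var \<Rightarrow> form" where
  "rel2 f x y z = (\<^bold>\<exists>p. opair p x y \<^bold>\<and> rel f p z)"

definition function_on :: "var \<Rightarrow> var \<Rightarrow> form" where
  "function_on f a = ((\<^bold>\<forall>p\<^bold>\<in>f. \<^bold>\<exists>x\<^bold>\<in>a. \<^bold>\<exists>y. opair p x y) \<^bold>\<and> (\<^bold>\<forall>x\<^bold>\<in>a. \<^bold>\<exists>\<^bold>!y. rel f x y))"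

definition maps :: "var \<Rightarrow> var \<Rightarrow> var \<Rightarrow> form" where
  "maps f a b = (function_on f a \<^bold>\<and> (\<^bold>\<forall>x. \<^bold>\<forall>y. rel f x y \<^bold>\<longrightarrow> y \<^bold>\<in> b))"

definition bijection :: "var \<Rightarrow> var \<Rightarrow> var \<Rightarrow> form" where
  "bijection f a b = (maps f a b \<^bold>\<and> (\<^bold>\<forall>y\<^bold>\<in>b. \<^bold>\<exists>\<^bold>!x. rel f x y))"

definition equipotent :: "var \<Rightarrow> var \<Rightarrow> form" where
  "equipotent a b = (\<^bold>\<exists>f. bijection f a b)"

definition omega :: "var \<Rightarrow> form" where
  "omega w = (is_inductive w \<^bold>\<and> (\<^bold>\<forall>v. is_inductive v \<^bold>\<longrightarrow> w \<^bold>\<subseteq> v))"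

definition finite_set :: "var \<Rightarrow> form" where
  "finite_set a = (\<^bold>\<exists>w. omega w \<^bold>\<and> (\<^bold>\<exists>n\<^bold>\<in>w. equipotent a n))"

definition countable_set :: "var \<Rightarrow> form" where
  "countable_set a = (\<^bold>\<exists>w. omega w \<^bold>\<and> (\<^bold>\<exists>b. b \<^bold>\<subseteq> w \<^bold>\<and> equipotent a b))"

definition denumerable :: "var \<Rightarrow> form" where
  "denumerable a = (\<^bold>\<not> finite_set a \<^bold>\<and> countable_set a)"

definition multiple_choice_function :: "var \<Rightarrow> var \<Rightarrow> form" where
  "multiple_choice_function f a = (function_on f a \<^bold>\<and>
     (\<^bold>\<forall>x\<^bold>\<in>a. \<^bold>\<forall>y. rel f x y \<^bold>\<longrightarrow> nonempty y \<^bold>\<and> finite_set y \<^bold>\<and> y \<^bold>\<subseteq> x))"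

definition CMC :: form where
  "CMC = (\<^bold>\<forall>a. denumerable a \<^bold>\<and> (\<^bold>\<forall>x\<^bold>\<in>a. nonempty x) \<^bold>\<longrightarrow>
     (\<^bold>\<exists>f. multiple_choice_function f a))"


section \<open>Topological spaces\<close>

definition is_Union :: "var \<Rightarrow> var \<Rightarrow> form" where
  "is_Union s U = (\<^bold>\<forall>x. x \<^bold>\<in> s \<^bold>\<longleftrightarrow> (\<^bold>\<exists>u\<^bold>\<in>U. x \<^bold>\<in> u))"

text \<open>Used for non-empty \<open>U\<close> only.\<close>

definition is_Inter :: "var \<Rightarrow> var \<Rightarrow> form" where
  "is_Inter s U = (\<^bold>\<forall>x. x \<^bold>\<in> s \<^bold>\<longleftrightarrow> (\<^bold>\<forall>u\<^bold>\<in>U. x \<^bold>\<in> u))"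

text \<open>\<open>topology X T\<close>: \<open>T\<close> is a topology (the family of open sets) on the set \<open>X\<close>.\<close>

definition topology :: "var \<Rightarrow> var \<Rightarrow> form" where
  "topology X T = (
     (\<^bold>\<forall>u\<^bold>\<in>T. u \<^bold>\<subseteq> X) \<^bold>\<and> (\<^bold>\<exists>e\<^bold>\<in>T. empty e) \<^bold>\<and> X \<^bold>\<in> T \<^bold>\<and>
     (\<^bold>\<forall>u\<^bold>\<in>T. \<^bold>\<forall>v\<^bold>\<in>T. \<^bold>\<exists>s\<^bold>\<in>T. \<^bold>\<forall>x. x \<^bold>\<in> s \<^bold>\<longleftrightarrow> (x \<^bold>\<in> u \<^bold>\<and> x \<^bold>\<in> v)) \<^bold>\<and>
     (\<^bold>\<forall>U. U \<^bold>\<subseteq> T \<^bold>\<longrightarrow> (\<^bold>\<exists>s\<^bold>\<in>T. is_Union s U)))"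

definition clopen :: "var \<Rightarrow> var \<Rightarrow> var \<Rightarrow> form" where
  "clopen X T u = (u \<^bold>\<in> T \<^bold>\<and> (\<^bold>\<exists>v\<^bold>\<in>T. \<^bold>\<forall>x. x \<^bold>\<in> v \<^bold>\<longleftrightarrow> (x \<^bold>\<in> X \<^bold>\<and> \<^bold>\<not> x \<^bold>\<in> u)))"

text \<open>Families of sets given by a defining property are represented by that property.\<close>

definition countable_Inter_of :: "(var \<Rightarrow> form) \<Rightarrow> var \<Rightarrow> form" where
  "countable_Inter_of F s =
     (\<^bold>\<exists>U. nonempty U \<^bold>\<and> countable_set U \<^bold>\<and> (\<^bold>\<forall>u\<^bold>\<in>U. F u) \<^bold>\<and> is_Inter s U)"

definition stable_under_countable_Inter :: "(var \<Rightarrow> form) \<Rightarrow> form" where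
  "stable_under_countable_Inter F =
     (\<^bold>\<forall>U. nonempty U \<^bold>\<and> countable_set U \<^bold>\<and> (\<^bold>\<forall>u\<^bold>\<in>U. F u) \<^bold>\<longrightarrow> (\<^bold>\<exists>s. is_Inter s U \<^bold>\<and> F s))"

definition CO_delta :: "var \<Rightarrow> var \<Rightarrow> var \<Rightarrow> form" where
  "CO_delta X T s = countable_Inter_of (\<lambda>u. clopen X T u) s"

definition G_delta :: "var \<Rightarrow> var \<Rightarrow> form" where
  "G_delta T s = countable_Inter_of (\<lambda>u. u \<^bold>\<in> T) s"


subsection \<open>Real-valued continuous functions\<close>

definition operation :: "var \<Rightarrow> var \<Rightarrow> form" where
  "operation f R = (\<^bold>\<exists>P. (\<^bold>\<forall>p. p \<^bold>\<in> P \<^bold>\<longleftrightarrow> (\<^bold>\<exists>x\<^bold>\<in>R. \<^bold>\<exists>y\<^bold>\<in>R. opair p x y)) \<^bold>\<and> maps f P R)"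

definition assoc_comm_unit :: "var \<Rightarrow> var \<Rightarrow> var \<Rightarrow> form" where
  "assoc_comm_unit R f e = (operation f R \<^bold>\<and> e \<^bold>\<in> R \<^bold>\<and>
     (\<^bold>\<forall>x\<^bold>\<in>R. \<^bold>\<forall>y\<^bold>\<in>R. \<^bold>\<forall>z\<^bold>\<in>R. \<^bold>\<forall>u. \<^bold>\<forall>v. \<^bold>\<forall>w.
        rel2 f x y u \<^bold>\<and> rel2 f u z w \<^bold>\<and> rel2 f y z v \<^bold>\<longrightarrow> rel2 f x v w) \<^bold>\<and>
     (\<^bold>\<forall>x\<^bold>\<in>R. \<^bold>\<forall>y\<^bold>\<in>R. \<^bold>\<forall>u. rel2 f x y u \<^bold>\<longrightarrow> rel2 f y x u) \<^bold>\<and>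
     (\<^bold>\<forall>x\<^bold>\<in>R. rel2 f x e x))"

definition field :: "var \<Rightarrow> var \<Rightarrow> var \<Rightarrow> var \<Rightarrow> var \<Rightarrow> form" where
  "field R zero one add mul = (
     assoc_comm_unit R add zero \<^bold>\<and> assoc_comm_unit R mul one \<^bold>\<and> \<^bold>\<not> zero \<^bold>= one \<^bold>\<and>
     (\<^bold>\<forall>x\<^bold>\<in>R. \<^bold>\<exists>y\<^bold>\<in>R. rel2 add x y zero) \<^bold>\<and>
     (\<^bold>\<forall>x\<^bold>\<in>R. \<^bold>\<not> x \<^bold>= zero \<^bold>\<longrightarrow> (\<^bold>\<exists>y\<^bold>\<in>R. rel2 mul x y one)) \<^bold>\<and>
     (\<^bold>\<forall>x\<^bold>\<in>R. \<^bold>\<forall>y\<^bold>\<in>R. \<^bold>\<forall>z\<^bold>\<in>R. \<^bold>\<forall>s. \<^bold>\<forall>t. \<^bold>\<forall>u. \<^bold>\<forall>v.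
        rel2 add y z s \<^bold>\<and> rel2 mul x s t \<^bold>\<and> rel2 mul x y u \<^bold>\<and> rel2 mul x z v \<^bold>\<longrightarrow> rel2 add u v t))"

definition strict_linear_order :: "var \<Rightarrow> var \<Rightarrow> form" where
  "strict_linear_order R lt = (
     (\<^bold>\<forall>x\<^bold>\<in>R. \<^bold>\<not> rel lt x x) \<^bold>\<and>
     (\<^bold>\<forall>x\<^bold>\<in>R. \<^bold>\<forall>y\<^bold>\<in>R. \<^bold>\<forall>z\<^bold>\<in>R. rel lt x y \<^bold>\<and> rel lt y z \<^bold>\<longrightarrow> rel lt x z) \<^bold>\<and>
     (\<^bold>\<forall>x\<^bold>\<in>R. \<^bold>\<forall>y\<^bold>\<in>R. rel lt x y \<^bold>\<or> x \<^bold>= y \<^bold>\<or> rel lt y x))"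

definition ordered_field :: "var \<Rightarrow> var \<Rightarrow> var \<Rightarrow> var \<Rightarrow> var \<Rightarrow> var \<Rightarrow> form" where
  "ordered_field R zero one add mul lt = (
     field R zero one add mul \<^bold>\<and> strict_linear_order R lt \<^bold>\<and>
     (\<^bold>\<forall>x\<^bold>\<in>R. \<^bold>\<forall>y\<^bold>\<in>R. \<^bold>\<forall>z\<^bold>\<in>R. \<^bold>\<forall>u. \<^bold>\<forall>v.
        rel lt x y \<^bold>\<and> rel2 add x z u \<^bold>\<and> rel2 add y z v \<^bold>\<longrightarrow> rel lt u v) \<^bold>\<and>
     (\<^bold>\<forall>x\<^bold>\<in>R. \<^bold>\<forall>y\<^bold>\<in>R. \<^bold>\<forall>u. rel lt zero x \<^bold>\<and> rel lt zero y \<^bold>\<and> rel2 mul x y u \<^bold>\<longrightarrow> rel lt zero u))"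

definition upper_bound :: "var \<Rightarrow> var \<Rightarrow> var \<Rightarrow> form" where
  "upper_bound lt S b = (\<^bold>\<forall>x\<^bold>\<in>S. rel lt x b \<^bold>\<or> x \<^bold>= b)"

definition complete_order :: "var \<Rightarrow> var \<Rightarrow> form" where
  "complete_order R lt =
     (\<^bold>\<forall>S. S \<^bold>\<subseteq> R \<^bold>\<and> nonempty S \<^bold>\<and> (\<^bold>\<exists>b\<^bold>\<in>R. upper_bound lt S b) \<^bold>\<longrightarrow>
        (\<^bold>\<exists>b\<^bold>\<in>R. upper_bound lt S b \<^bold>\<and>
           (\<^bold>\<forall>c\<^bold>\<in>R. upper_bound lt S c \<^bold>\<longrightarrow> rel lt b c \<^bold>\<or> b \<^bold>= c)))"

text \<open>The ordered field of real numbers, which ZF determines up to unique isomorphism as the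
  Dedekind-complete ordered field. The claim about zero-sets is made for every such field.\<close>

definition reals :: "var \<Rightarrow> var \<Rightarrow> var \<Rightarrow> var \<Rightarrow> var \<Rightarrow> var \<Rightarrow> form" where
  "reals R zero one add mul lt =
     (ordered_field R zero one add mul lt \<^bold>\<and> complete_order R lt)"

definition real_open :: "var \<Rightarrow> var \<Rightarrow> var \<Rightarrow> form" where
  "real_open R lt V = (V \<^bold>\<subseteq> R \<^bold>\<and>
     (\<^bold>\<forall>x\<^bold>\<in>V. \<^bold>\<exists>a\<^bold>\<in>R. \<^bold>\<exists>b\<^bold>\<in>R. rel lt a x \<^bold>\<and> rel lt x b \<^bold>\<and>
        (\<^bold>\<forall>y\<^bold>\<in>R. rel lt a y \<^bold>\<and> rel lt y b \<^bold>\<longrightarrow> y \<^bold>\<in> V)))"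

definition continuous_real :: "var \<Rightarrow> var \<Rightarrow> var \<Rightarrow> var \<Rightarrow> var \<Rightarrow> form" where
  "continuous_real X T R lt f = (maps f X R \<^bold>\<and>
     (\<^bold>\<forall>V. real_open R lt V \<^bold>\<longrightarrow>
        (\<^bold>\<exists>u\<^bold>\<in>T. \<^bold>\<forall>x. x \<^bold>\<in> u \<^bold>\<longleftrightarrow> (x \<^bold>\<in> X \<^bold>\<and> (\<^bold>\<exists>y\<^bold>\<in>V. rel f x y)))))"

definition zero_set :: "var \<Rightarrow> var \<Rightarrow> var \<Rightarrow> var \<Rightarrow> var \<Rightarrow> var \<Rightarrow> form" where
  "zero_set X T R zero lt s =
     (\<^bold>\<exists>f. continuous_real X T R lt f \<^bold>\<and> (\<^bold>\<forall>x. x \<^bold>\<in> s \<^bold>\<longleftrightarrow> (x \<^bold>\<in> X \<^bold>\<and> rel f x zero)))"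


subsection \<open>The two claims\<close>

text \<open>\<open>delta_topology T D\<close>: \<open>D\<close> is the topology that has the \<open>G\<^sub>\<delta>\<close>-sets of \<open>T\<close> as a base.\<close>

definition delta_topology :: "var \<Rightarrow> var \<Rightarrow> form" where
  "delta_topology T D =
     (\<^bold>\<forall>s. s \<^bold>\<in> D \<^bold>\<longleftrightarrow> (\<^bold>\<exists>U. (\<^bold>\<forall>u\<^bold>\<in>U. G_delta T u) \<^bold>\<and> is_Union s U))"

definition P_space :: "var \<Rightarrow> var \<Rightarrow> form" where
  "P_space X T = (topology X T \<^bold>\<and> (\<^bold>\<forall>s. G_delta T s \<^bold>\<longrightarrow> s \<^bold>\<in> T))"

definition families_stable :: form where
  "families_stable = (\<^bold>\<forall>X. \<^bold>\<forall>T. topology X T \<^bold>\<longrightarrow>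
     stable_under_countable_Inter (\<lambda>s. CO_delta X T s) \<^bold>\<and>
     (\<^bold>\<forall>R. \<^bold>\<forall>zero. \<^bold>\<forall>one. \<^bold>\<forall>add. \<^bold>\<forall>mul. \<^bold>\<forall>lt. reals R zero one add mul lt \<^bold>\<longrightarrow>
        stable_under_countable_Inter (\<lambda>s. zero_set X T R zero lt s)) \<^bold>\<and>
     stable_under_countable_Inter (\<lambda>s. G_delta T s))"

definition delta_is_P_space :: form where
  "delta_is_P_space = (\<^bold>\<forall>X. \<^bold>\<forall>T. topology X T \<^bold>\<longrightarrow>
     (\<^bold>\<exists>D. delta_topology T D \<^bold>\<and> P_space X D))"

end

theory Submission
  imports Defs "HOL-Library.Countable_Set"
begin

text \<open>
  By Henkin's completeness theorem it suffices to argue inside an arbitrary model of ZF, where the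
  classical proofs can be carried out as long as separation, replacement and induction are applied
  to predicates definable with parameters only.

  Under CMC, for each member \<open>u\<^sub>n\<close> of a countable family one chooses a nonempty finite set \<open>F\<^sub>n\<close> of
  witnesses: sequences of (cl)open sets with intersection \<open>u\<^sub>n\<close>, or functions with zero-set
  \<open>u\<^sub>n\<close>. Finite sets are harmless: intersecting the first \<open>k\<close> terms of all witnesses in
  \<open>F\<^sub>0, \<dots>, F\<^sub>k\<close> gives a single sequence of (cl)open sets, and the supremum of
  \<open>min (\<epsilon>\<^sub>n) \<bar>g x\<bar>\<close> over \<open>n\<close> and \<open>g \<in> F\<^sub>n\<close>, with \<open>\<epsilon>\<^sub>n\<close> decreasing to 0, is a single continuous function.

  For (i) implies (ii), let \<open>x\<close> lie in every \<open>w\<^sub>n\<close>, where each \<open>w\<^sub>n\<close> includes a \<open>G\<^sub>\<delta>\<close>-set containing \<open>x\<close>.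
  Such sets cannot be chosen simultaneously, but each \<open>w\<^sub>n\<close> is a \<open>G\<^sub>\<delta>\<close>-set of the topology that consists
  of the neighbourhoods of \<open>x\<close> and the empty set. By (i) for that topology, so is their
  intersection, and taking interiors yields a \<open>G\<^sub>\<delta>\<close>-set between \<open>x\<close> and the intersection.
\<close>

section \<open>Completeness of the calculus\<close>

text \<open>A model supplied by completeness may be far from standard: its \<open>om\<close> need
  not look like the type \<open>nat\<close>, its subsets are only those that exist as elements, and
  a HOL function on its elements is in general not one of its functions. HOL's choice operator must
  therefore never leak into the model. Single elements may be fixed freely, but every infinite
  family has to be a definable term that separation or replacement turns into an element. The
  predicates \<open>dfn\<close> and \<open>dfnT\<close>, whose closure rules mirror the syntax,
  reduce this check to an application of introduction rules. Operations that would be partial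
  receive a fixed default, so that they are definable everywhere. The real numbers are affected as
  well: only bounded sets that exist in the model have suprema, and sequences come from a recursion
  theorem proved inside the model. That models may be taken on \<open>nat\<close> with identity as
  equality rests on ZF having no finite model: the quotient of the countable term model is still
  infinite.\<close>

lemma rename_rename: "rename r (rename s p) = rename (r \<circ> s) p"
proof (induction p arbitrary: r s)
  case (All p)
  have "case_nat 0 (\<lambda>i. Suc (r i)) \<circ> case_nat 0 (\<lambda>i. Suc (s i)) = case_nat 0 (\<lambda>i. Suc ((r \<circ> s) i))"
    by (auto simp: fun_eq_iff split: nat.split)
  then show ?case unfolding rename.simps All by simp
qed auto

lemma rename_cong: "free_below n p \<Longrightarrow> (\<And>i. i < n \<Longrightarrow> r i = s i) \<Longrightarrow> rename r p = rename s p"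
proof (induction p arbitrary: r s n)
  case (All p)
  show ?case
    using All.prems by (auto intro!: All.IH[of "Suc n"] split: nat.split)
next
  case (Imp p q)
  then show ?case using Imp.IH(1)[of n r s] Imp.IH(2)[of n r s] by simp
qed auto

lemma rename_id: "rename (\<lambda>i. i) p = p"
proof (induction p)
  case (All p)
  have "case_nat 0 Suc = (\<lambda>i. i)"
    by (auto simp: fun_eq_iff split: nat.split)
  then show ?case using All by simp
qed auto

lemma free_below_mono: "free_below n p \<Longrightarrow> n \<le> m \<Longrightarrow> free_below m p"
proof (induction p arbitrary: n m)
  case (All p)
  then show ?case using All.IH[of "Suc n" "Suc m"] by simp
next
  case (Imp p q)
  then show ?case using Imp.IH(1)[of n m] Imp.IH(2)[of n m] by simp
qed auto

lemma ex_free_below: "\<exists>n. free_below n p"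
proof (induction p)
  case (Mem i j)
  show ?case by (rule exI[of _ "Suc (max i j)"]) auto
next
  case (Eql i j)
  show ?case by (rule exI[of _ "Suc (max i j)"]) auto
next
  case (Imp p q)
  then obtain m n where "free_below m p" "free_below n q" by auto
  then have "free_below (max m n) (Imp p q)"
    using free_below_mono[of m p "max m n"] free_below_mono[of n q "max m n"] by simp
  then show ?case ..
next
  case (All p)
  then obtain n where "free_below n p" ..
  then have "free_below n (All p)" using free_below_mono[of n p "Suc n"] by simp
  then show ?case ..
qed auto

lemma rename_inst:
  "rename r (inst t p) = inst (r t) (rename (case_nat 0 (\<lambda>i. Suc (r i))) p)"
proof -
  have "r \<circ> case_nat t (\<lambda>i. i) = case_nat (r t) (\<lambda>i. i) \<circ> case_nat 0 (\<lambda>i. Suc (r i))"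
    by (auto simp: fun_eq_iff split: nat.split)
  then show ?thesis by (simp add: inst_def rename_rename)
qed

text \<open>Terms are variables, so a renaming is also an assignment in a model made of variables.
  Instantiating under a lifted renaming then amounts to extending the assignment, which is what the
  quantifier case of \<open>henkin_truth\<close> requires.\<close>

lemma inst_rename_lift:
  "inst t (rename (case_nat 0 (\<lambda>i. Suc (r i))) p) = rename (case_nat t r) p"
proof -
  have "case_nat t (\<lambda>i. i) \<circ> case_nat 0 (\<lambda>i. Suc (r i)) = case_nat t r"
    by (auto simp: fun_eq_iff split: nat.split)
  then show ?thesis by (simp add: inst_def rename_rename)
qed

section \<open>Structural properties of derivability\<close>

lemma proves_mono: "H \<turnstile> p \<Longrightarrow> H \<subseteq> K \<Longrightarrow> K \<turnstile> p"
proof (induction arbitrary: K rule: proves.induct)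
  case (ImpI p H q)
  then show ?case using ImpI.IH[of "insert p K"] by (blast intro: proves.ImpI)
next
  case (Contr p H)
  then show ?case using Contr.IH[of "insert (Imp p Fls) K"] by (blast intro: proves.Contr)
next
  case (AllI H p)
  then show ?case using AllI.IH[of "rename Suc ` K"] by (blast intro: proves.AllI)
next
  case (Subst H s t p)
  then show ?case by (blast intro: proves.Subst)
next
  case (ImpE H p q)
  then show ?case by (blast intro: proves.ImpE)
next
  case (AllE H p t)
  then show ?case by (blast intro: proves.AllE)
qed (auto intro: proves.Assm proves.Refl)

text \<open>The renaming need not be injective. Under \<open>AllI\<close> its lifting commutes with
  the shift of the hypotheses, so the induction hypothesis is used at the lifted renaming.\<close>

lemma proves_rename: "H \<turnstile> p \<Longrightarrow> rename r ` H \<turnstile> rename r p"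
proof (induction arbitrary: r rule: proves.induct)
  case (AllI H p)
  have "rename (case_nat 0 (\<lambda>i. Suc (r i))) \<circ> rename Suc = rename Suc \<circ> rename r"
    by (auto simp: fun_eq_iff rename_rename comp_def)
  then have "rename (case_nat 0 (\<lambda>i. Suc (r i))) ` rename Suc ` H = rename Suc ` rename r ` H"
    by (simp add: image_comp)
  then have "(rename Suc ` rename r ` H \<turnstile> rename (case_nat 0 (\<lambda>i. Suc (r i))) p)"
    using AllI.IH by metis
  then show ?case by (simp add: proves.AllI)
next
  case (AllE H p t)
  then show ?case by (simp add: rename_inst proves.AllE)
next
  case (Subst H s t p)
  then show ?case
    using proves.Subst[of "rename r ` H" "r s" "r t"] by (simp add: rename_inst)
next
  case (ImpE H p q)
  then show ?case by (metis proves.ImpE rename.simps(4))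
qed (simp_all add: proves.Assm proves.Refl proves.ImpI proves.Contr)

lemma proves_compact: "(H \<turnstile> p) \<Longrightarrow> \<exists>F\<subseteq>H. finite F \<and> (F \<turnstile> p)"
proof (induction rule: proves.induct)
  case (Assm p H)
  then show ?case by (intro exI[of _ "{p}"]) (auto intro: proves.Assm)
next
  case (ImpI p H q)
  then obtain F where F: "F \<subseteq> insert p H" "finite F" "F \<turnstile> q" by auto
  then have "insert p (F - {p}) \<turnstile> q" by (elim proves_mono) auto
  then show ?case
    using F by (intro exI[of _ "F - {p}"]) (auto intro: proves.ImpI)
next
  case (ImpE H p q)
  then obtain F G where "F \<subseteq> H" "finite F" "F \<turnstile> Imp p q" "G \<subseteq> H" "finite G" "G \<turnstile> p" by auto
  moreover from this have "F \<union> G \<turnstile> q"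
    by (meson proves.ImpE proves_mono sup_ge1 sup_ge2)
  ultimately show ?case by (intro exI[of _ "F \<union> G"]) auto
next
  case (Contr p H)
  then obtain F where F: "F \<subseteq> insert (Imp p Fls) H" "finite F" "F \<turnstile> Fls" by auto
  then have "insert (Imp p Fls) (F - {Imp p Fls}) \<turnstile> Fls" by (elim proves_mono) auto
  then show ?case
    using F by (intro exI[of _ "F - {Imp p Fls}"]) (auto intro: proves.Contr)
next
  case (AllI H p)
  then obtain F where F: "F \<subseteq> rename Suc ` H" "finite F" "F \<turnstile> p" by auto
  then obtain G where "G \<subseteq> H" "finite G" "F = rename Suc ` G"
    by (metis finite_subset_image)
  then show ?case using F by (auto intro: proves.AllI)
next
  case (AllE H p t)
  then show ?case by (auto intro: proves.AllE)
next
  case (Refl H t)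
  then show ?case by (intro exI[of _ "{}"]) (auto intro: proves.Refl)
next
  case (Subst H s t p)
  then obtain F G where "F \<subseteq> H" "finite F" "F \<turnstile> Eql s t" "G \<subseteq> H" "finite G" "G \<turnstile> inst s p" by auto
  moreover from this have "F \<union> G \<turnstile> inst t p"
    by (meson proves.Subst proves_mono sup_ge1 sup_ge2)
  ultimately show ?case by (intro exI[of _ "F \<union> G"]) auto
qed

text \<open>\<open>AllI\<close> wants the hypotheses shifted, whereas a Henkin witness is an
  ordinary variable \<open>c\<close>. The renaming that sends \<open>c\<close> to 0 and shifts
  everything else acts on \<open>H\<close> as the plain shift, because \<open>c\<close> does not
  occur there, and it undoes \<open>inst c p\<close>.\<close>

lemma generalize_fresh:
  assumes H: "\<And>q. q \<in> H \<Longrightarrow> free_below c q" and p: "free_below c (All p)"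
    and prov: "H \<turnstile> inst c p"
  shows "H \<turnstile> All p"
proof -
  let ?r = "\<lambda>i. if i = c then 0 else Suc i"
  have "rename ?r ` H = rename Suc ` H"
    by (rule image_cong[OF refl]) (rule rename_cong[OF H], auto)
  moreover have "rename ?r (inst c p) = p"
  proof -
    have "rename (?r \<circ> case_nat c (\<lambda>i. i)) p = rename (\<lambda>i. i) p"
      using p by (intro rename_cong[of "Suc c"]) (auto split: nat.split)
    then show ?thesis by (simp add: inst_def rename_rename rename_id)
  qed
  ultimately have "rename Suc ` H \<turnstile> p"
    using proves_rename[OF prov, of ?r] by simp
  then show ?thesis by (rule proves.AllI)
qed

section \<open>Enumeration of formulas and the Henkin construction\<close>

primrec fm_code :: "fm \<Rightarrow> nat" where
  "fm_code Fls = prod_encode (0, 0)"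
| "fm_code (Mem i j) = prod_encode (1, prod_encode (i, j))"
| "fm_code (Eql i j) = prod_encode (2, prod_encode (i, j))"
| "fm_code (Imp p q) = prod_encode (3, prod_encode (fm_code p, fm_code q))"
| "fm_code (All p) = prod_encode (4, fm_code p)"

lemma fm_code_inject: "fm_code p = fm_code q \<Longrightarrow> p = q"
proof (induction p arbitrary: q)
  case Fls
  then show ?case by (cases q) simp_all
next
  case (Mem i j)
  then show ?case by (cases q) simp_all
next
  case (Eql i j)
  then show ?case by (cases q) simp_all
next
  case (Imp p1 p2)
  then show ?case by (cases q) simp_all
next
  case (All p)
  then show ?case by (cases q) simp_all
qed

instance fm :: countable
  by standard (intro exI[of _ fm_code] injI, erule fm_code_inject)

definition bounded_vars :: "fm set \<Rightarrow> bool" where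
  "bounded_vars H \<longleftrightarrow> (\<exists>n. \<forall>q\<in>H. free_below n q)"

lemma bounded_vars_insert: "bounded_vars (insert p H) \<longleftrightarrow> bounded_vars H"
proof
  assume "bounded_vars H"
  then obtain n where n: "\<forall>q\<in>H. free_below n q" by (auto simp: bounded_vars_def)
  obtain m where "free_below m p" using ex_free_below by blast
  then have "\<forall>q\<in>insert p H. free_below (max m n) q"
    using n free_below_mono[of m _ "max m n"] free_below_mono[of n _ "max m n"] by auto
  then show "bounded_vars (insert p H)" by (auto simp: bounded_vars_def)
qed (auto simp: bounded_vars_def)

definition fresh :: "fm set \<Rightarrow> nat" where
  "fresh H = (SOME n. \<forall>q\<in>H. free_below n q)"

lemma fresh: "bounded_vars H \<Longrightarrow> q \<in> H \<Longrightarrow> free_below (fresh H) q"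
  unfolding bounded_vars_def fresh_def by (rule someI2_ex[where Q = "\<lambda>n. free_below n q"]) auto

fun henkin_witness :: "fm set \<Rightarrow> fm \<Rightarrow> fm set" where
  "henkin_witness H (All p) = insert (Imp (inst (fresh (insert (All p) H)) p) Fls) H"
| "henkin_witness H p = H"

text \<open>The negation of a rejected formula is already derivable and need not be added. A
  rejected universal formula contributes a refuted instance at a fresh variable.\<close>

definition henkin_step :: "fm set \<Rightarrow> fm \<Rightarrow> fm set" where
  "henkin_step H p = (if (insert p H \<turnstile> Fls) then henkin_witness H p else insert p H)"

primrec henkin_chain :: "fm set \<Rightarrow> nat \<Rightarrow> fm set" where
  "henkin_chain H 0 = H"
| "henkin_chain H (Suc n) = henkin_step (henkin_chain H n) (from_nat n)"

definition henkin :: "fm set \<Rightarrow> fm set" where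
  "henkin H = (\<Union>n. henkin_chain H n)"

lemma henkin_witness_superset: "H \<subseteq> henkin_witness H p"
  by (cases p) auto

lemma bounded_henkin_step: "bounded_vars H \<Longrightarrow> bounded_vars (henkin_step H p)"
  by (cases p) (auto simp: henkin_step_def bounded_vars_insert)

text \<open>The only delicate case is a rejected \<open>All q\<close>. If refuting the instance at
  the fresh variable were inconsistent, that instance would be derivable classically and would
  generalise to \<open>All q\<close>, whose negation is derivable.\<close>

lemma consistent_henkin_step:
  assumes bd: "bounded_vars H" and con: "\<not> (H \<turnstile> Fls)"
  shows "\<not> (henkin_step H p \<turnstile> Fls)"
proof (cases "insert p H \<turnstile> Fls")
  case True
  show ?thesis
  proof (cases "\<exists>q. p = All q")
    case False
    then show ?thesis using con by (cases p) (auto simp: henkin_step_def)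
  next
    case allp: True
    then obtain q where q: "p = All q" ..
    define c where "c = fresh (insert p H)"
    have fr: "free_below c h" if "h \<in> insert p H" for h
      unfolding c_def using bd that by (intro fresh) (simp_all add: bounded_vars_insert)
    have False if "henkin_step H p \<turnstile> Fls"
    proof -
      from that have "insert (Imp (inst c q) Fls) H \<turnstile> Fls"
        using True by (simp add: henkin_step_def q c_def)
      then have "H \<turnstile> inst c q" by (rule proves.Contr)
      then have "H \<turnstile> All q"
        using fr q by (intro generalize_fresh[of H c]) (auto simp del: free_below.simps)
      moreover have "H \<turnstile> Imp p Fls" using True by (rule proves.ImpI)
      ultimately show False using con q proves.ImpE by blast
    qed
    then show ?thesis ..
  qed
qed (simp add: henkin_step_def)

lemma henkin_chain_mono: "m \<le> n \<Longrightarrow> henkin_chain H m \<subseteq> henkin_chain H n"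
  by (rule lift_Suc_mono_le[of "henkin_chain H"])
     (use henkin_witness_superset in \<open>auto simp: henkin_step_def\<close>)

lemma bounded_henkin_chain: "bounded_vars H \<Longrightarrow> bounded_vars (henkin_chain H n)"
  by (induction n) (auto intro: bounded_henkin_step)

lemma consistent_henkin_chain:
  "bounded_vars H \<Longrightarrow> \<not> (H \<turnstile> Fls) \<Longrightarrow> \<not> (henkin_chain H n \<turnstile> Fls)"
  by (induction n) (auto dest: consistent_henkin_step bounded_henkin_chain)

lemma consistent_henkin:
  assumes "bounded_vars H" "\<not> (H \<turnstile> Fls)"
  shows "\<not> (henkin H \<turnstile> Fls)"
proof
  assume "henkin H \<turnstile> Fls"
  then obtain F where F: "F \<subseteq> henkin H" "finite F" "F \<turnstile> Fls"
    using proves_compact by blast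
  have "\<exists>n. F \<subseteq> henkin_chain H n"
    using F(2,1)
  proof induction
    case (insert p F)
    then obtain m n where "F \<subseteq> henkin_chain H m" "p \<in> henkin_chain H n"
      by (auto simp: henkin_def)
    then have "insert p F \<subseteq> henkin_chain H (max m n)"
      using henkin_chain_mono[of m "max m n" H] henkin_chain_mono[of n "max m n" H] by auto
    then show ?case ..
  qed simp
  then show False
    using F(3) consistent_henkin_chain[OF assms] proves_mono by blast
qed

lemma henkin_chain_subset: "henkin_chain H n \<subseteq> henkin H"
  by (auto simp: henkin_def)

text \<open>The formula \<open>p\<close> is decided at stage \<open>to_nat p\<close>. Since it is
  not derivable in the end, it was rejected there, and both conclusions are read off from that
  stage.\<close>

lemma henkin_complete:
  assumes "\<not> (henkin H \<turnstile> p)"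
  shows "henkin H \<turnstile> Imp p Fls" "\<And>q. p = All q \<Longrightarrow> \<exists>c. (henkin H \<turnstile> Imp (inst c q) Fls)"
proof -
  let ?n = "to_nat p"
  have inc: "insert p (henkin_chain H ?n) \<turnstile> Fls"
  proof (rule ccontr)
    assume "\<not> ?thesis"
    then have "p \<in> henkin_chain H (Suc ?n)" by (simp add: henkin_step_def)
    then show False
      using assms henkin_chain_subset proves.Assm by blast
  qed
  then have "henkin_chain H ?n \<turnstile> Imp p Fls" by (rule proves.ImpI)
  then show "henkin H \<turnstile> Imp p Fls" using henkin_chain_subset proves_mono by blast
  fix q assume q: "p = All q"
  then have "\<exists>c. Imp (inst c q) Fls \<in> henkin_chain H (Suc ?n)"
    using inc by (auto simp: henkin_step_def)
  then show "\<exists>c. (henkin H \<turnstile> Imp (inst c q) Fls)"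
    using henkin_chain_subset proves.Assm by blast
qed

section \<open>Truth in the term model\<close>

primrec sat :: "('a \<Rightarrow> 'a \<Rightarrow> bool) \<Rightarrow> ('a \<Rightarrow> 'a \<Rightarrow> bool) \<Rightarrow> (nat \<Rightarrow> 'a) \<Rightarrow> fm \<Rightarrow> bool" where
  "sat Q E e Fls \<longleftrightarrow> False"
| "sat Q E e (Mem i j) \<longleftrightarrow> E (e i) (e j)"
| "sat Q E e (Eql i j) \<longleftrightarrow> Q (e i) (e j)"
| "sat Q E e (Imp p q) \<longleftrightarrow> (sat Q E e p \<longrightarrow> sat Q E e q)"
| "sat Q E e (All p) \<longleftrightarrow> (\<forall>x. sat Q E (case_nat x e) p)"

lemma case_nat_comp: "case_nat x e \<circ> case_nat 0 (\<lambda>i. Suc (r i)) = case_nat x (e \<circ> r)"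
  by (auto simp: fun_eq_iff split: nat.split)

lemma sat_rename: "sat Q E e (rename r p) \<longleftrightarrow> sat Q E (e \<circ> r) p"
proof (induction p arbitrary: e r)
  case (All p)
  show ?case by (simp only: rename.simps sat.simps All case_nat_comp)
qed auto

lemma sat_cong: "free_below n p \<Longrightarrow> (\<And>i. i < n \<Longrightarrow> e i = e' i) \<Longrightarrow> sat Q E e p \<longleftrightarrow> sat Q E e' p"
proof (induction p arbitrary: e e' n)
  case (All p)
  have "sat Q E (case_nat x e) p \<longleftrightarrow> sat Q E (case_nat x e') p" for x
    using All.prems by (intro All.IH[of "Suc n"]) (auto split: nat.split)
  then show ?case by simp
next
  case (Imp p q)
  then show ?case using Imp.IH(1)[of n e e'] Imp.IH(2)[of n e e'] by simp
qed auto

text \<open>The domain consists of the variables, hence an environment \<open>e\<close> is literally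
  a renaming, and the claim is proved for all \<open>e\<close> at once. Completeness gives the
  implication case, the refuted instances give the quantifier case.\<close>

lemma henkin_truth:
  assumes con: "\<not> (henkin H \<turnstile> Fls)"
  shows "(henkin H \<turnstile> rename e p) \<longleftrightarrow> sat (\<lambda>i j. (henkin H \<turnstile> Eql i j)) (\<lambda>i j. (henkin H \<turnstile> Mem i j)) e p"
proof (induction p arbitrary: e)
  case (Imp p q)
  have "(henkin H \<turnstile> Imp a b) \<longleftrightarrow> ((henkin H \<turnstile> a) \<longrightarrow> (henkin H \<turnstile> b))" for a b
  proof
    assume *: "(henkin H \<turnstile> a) \<longrightarrow> (henkin H \<turnstile> b)"
    show "henkin H \<turnstile> Imp a b"
    proof (cases "henkin H \<turnstile> a")
      case True
      then show ?thesis using * by (meson proves.ImpI proves_mono subset_insertI)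
    next
      case False
      then have "insert a (henkin H) \<turnstile> Imp a Fls"
        using henkin_complete(1) by (meson proves_mono subset_insertI)
      then have "insert a (henkin H) \<turnstile> Fls"
        by (rule proves.ImpE) (simp add: proves.Assm)
      then show ?thesis by (meson proves.Contr proves.ImpI proves_mono subset_insertI)
    qed
  qed (auto intro: proves.ImpE)
  then show ?case using Imp by simp
next
  case (All p)
  let ?q = "rename (case_nat 0 (\<lambda>i. Suc (e i))) p"
  have "(henkin H \<turnstile> All ?q) \<longleftrightarrow> (\<forall>t. (henkin H \<turnstile> inst t ?q))"
  proof
    assume *: "\<forall>t. (henkin H \<turnstile> inst t ?q)"
    show "henkin H \<turnstile> All ?q"
    proof (rule ccontr)
      assume "\<not> ?thesis"
      then obtain c where "henkin H \<turnstile> Imp (inst c ?q) Fls"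
        using henkin_complete(2) by blast
      then show False using * con proves.ImpE by blast
    qed
  qed (auto intro: proves.AllE)
  then show ?case using All by (simp add: inst_rename_lift)
qed (use con in auto)

text \<open>The formula passed to the substitution rule is a template with variable 0 as its hole.
  All other variables carry a \<open>Suc\<close>, since \<open>inst\<close> lowers them by
  one.\<close>

lemma proves_eql_sym: "H \<turnstile> Eql s t \<Longrightarrow> H \<turnstile> Eql t s"
  using proves.Subst[of H s t "Eql 0 (Suc s)"] proves.Refl by (simp add: inst_def)

lemma proves_eql_trans: "H \<turnstile> Eql s t \<Longrightarrow> H \<turnstile> Eql t u \<Longrightarrow> H \<turnstile> Eql s u"
  using proves.Subst[of H t u "Eql (Suc s) 0"] by (simp add: inst_def)

lemma proves_mem_cong:
  assumes "H \<turnstile> Eql s s'" "H \<turnstile> Eql t t'" "H \<turnstile> Mem s t"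
  shows "H \<turnstile> Mem s' t'"
proof -
  have "H \<turnstile> Mem s' t"
    using proves.Subst[of H s s' "Mem 0 (Suc t)"] assms by (simp add: inst_def)
  then show ?thesis
    using proves.Subst[of H t t' "Mem (Suc s') 0"] assms by (simp add: inst_def)
qed

text \<open>Equality is interpreted by derivable equality of variables, which is only a congruence.
  This is why \<open>sat\<close> takes the interpretation of equality as an argument.\<close>

lemma completeness_weak:
  assumes "bounded_vars H" "\<not> (H \<turnstile> p)"
  obtains Q E :: "nat \<Rightarrow> nat \<Rightarrow> bool" and e
  where "equivp Q" "\<And>a b a' b'. Q a a' \<Longrightarrow> Q b b' \<Longrightarrow> E a b \<Longrightarrow> E a' b'"
    "\<And>q. q \<in> H \<Longrightarrow> sat Q E e q" "\<not> sat Q E e p"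
proof -
  let ?H = "insert (Imp p Fls) H"
  let ?Q = "\<lambda>i j. (henkin ?H \<turnstile> Eql i j)" and ?E = "\<lambda>i j. (henkin ?H \<turnstile> Mem i j)"
  have bd: "bounded_vars ?H" using assms by (simp add: bounded_vars_insert)
  have "\<not> (?H \<turnstile> Fls)" using assms(2) proves.Contr by blast
  then have con: "\<not> (henkin ?H \<turnstile> Fls)" by (rule consistent_henkin[OF bd])
  note truth = henkin_truth[OF con, of "\<lambda>i. i", unfolded rename_id]
  have sub: "henkin ?H \<turnstile> q" if "q \<in> ?H" for q
    using that henkin_chain_subset[of ?H 0] by (auto intro: proves.Assm)
  show ?thesis
  proof (rule that[of ?Q ?E "\<lambda>i. i"])
    show "equivp ?Q"
      by (intro equivpI reflpI sympI transpI)
         (auto intro: proves.Refl proves_eql_sym proves_eql_trans)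
    show "?E a' b'" if "?Q a a'" "?Q b b'" "?E a b" for a b a' b'
      using that by (rule proves_mem_cong)
    show "sat ?Q ?E (\<lambda>i. i) q" if "q \<in> H" for q
      using that sub truth by blast
    have "sat ?Q ?E (\<lambda>i. i) (Imp p Fls)"
      using sub truth by blast
    then show "\<not> sat ?Q ?E (\<lambda>i. i) p" by simp
  qed
qed

section \<open>Passage to models in which equality is identity\<close>

lemma sat_quotient:
  assumes surj: "surj h" and Q: "\<And>a b. Q a b \<longleftrightarrow> h a = h b"
    and E: "\<And>a b. E a b \<longleftrightarrow> E' (h a) (h b)"
  shows "sat Q E e p \<longleftrightarrow> sat (=) E' (h \<circ> e) p"
proof (induction p arbitrary: e)
  case (All p)
  have "h \<circ> case_nat x e = case_nat (h x) (h \<circ> e)" for x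
    by (auto simp: fun_eq_iff split: nat.split)
  then have "sat Q E e (All p) \<longleftrightarrow> (\<forall>x. sat (=) E' (case_nat (h x) (h \<circ> e)) p)"
    by (simp only: sat.simps All)
  also have "\<dots> \<longleftrightarrow> (\<forall>y. sat (=) E' (case_nat y (h \<circ> e)) p)"
    using surj by (metis surjD)
  finally show ?case by (simp only: sat.simps)
qed (auto simp: Q E)

text \<open>The classes are re-indexed by \<open>nat\<close>, so that all models considered share
  one fixed domain type. Countably many classes biject with \<open>nat\<close> as soon as no finite
  set meets all of them, hence the hypothesis on finite \<open>F\<close>.\<close>

lemma sat_eq_quotient:
  fixes Q E :: "nat \<Rightarrow> nat \<Rightarrow> bool"
  assumes eqv: "equivp Q" and cong: "\<And>a b a' b'. Q a a' \<Longrightarrow> Q b b' \<Longrightarrow> E a b \<Longrightarrow> E a' b'"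
    and inf: "\<And>F. finite F \<Longrightarrow> \<exists>x. \<forall>y\<in>F. \<not> Q x y"
  obtains h :: "nat \<Rightarrow> nat" and E' where "\<And>e p. sat Q E e p \<longleftrightarrow> sat (=) E' (h \<circ> e) p"
proof -
  let ?K = "range Q"
  have cls: "Q a = Q b \<longleftrightarrow> Q a b" for a b
    using eqv by (simp add: equivp_def)
  have "countable ?K" by (rule countable_image[OF countableI_type])
  moreover have "infinite ?K"
  proof
    assume "finite ?K"
    then obtain F where "finite F" "?K = Q ` F"
      using finite_subset_image[of ?K Q UNIV] by auto
    moreover obtain x where x: "\<forall>y\<in>F. \<not> Q x y" using inf[OF \<open>finite F\<close>] ..
    ultimately have "Q x \<in> Q ` F" by (simp only: rangeI flip: \<open>?K = Q ` F\<close>)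
    then obtain y where "y \<in> F" "Q x = Q y" by (rule imageE)
    then show False using cls x by simp
  qed
  ultimately have bij: "bij_betw (to_nat_on ?K) ?K UNIV"
    by (rule to_nat_on_infinite)
  define h where "h a = to_nat_on ?K (Q a)" for a
  have h: "h a = h b \<longleftrightarrow> Q a b" for a b
    unfolding h_def
    by (rule trans[OF inj_on_eq_iff[OF bij_betw_imp_inj_on[OF bij] rangeI rangeI] cls])
  have surj: "surj h"
    using bij_betw_imp_surj_on[OF bij] by (simp add: h_def[abs_def] image_image)
  define E' where "E' u v \<longleftrightarrow> (\<exists>a b. h a = u \<and> h b = v \<and> E a b)" for u v
  have E': "E a b \<longleftrightarrow> E' (h a) (h b)" for a b
  proof
    assume "E' (h a) (h b)"
    then obtain a' b' where "h a' = h a" "h b' = h b" "E a' b'"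
      unfolding E'_def by blast
    then show "E a b" using cong h by blast
  qed (auto simp: E'_def)
  show thesis
    by (rule that[of E' h], rule sat_quotient[OF surj]) (simp_all only: h E')
qed


section \<open>Models of ZF\<close>

text \<open>Levels below \<open>d\<close> are interpreted by \<open>\<rho>\<close>, the free parameters by \<open>c\<close>.\<close>

definition hold ::
  "('a \<Rightarrow> 'a \<Rightarrow> bool) \<Rightarrow> ('a \<Rightarrow> 'a \<Rightarrow> bool) \<Rightarrow> (nat \<Rightarrow> 'a) \<Rightarrow> nat \<Rightarrow> (nat \<Rightarrow> 'a) \<Rightarrow> form \<Rightarrow> bool" where
  "hold Q E c d \<rho> A \<longleftrightarrow> sat Q E (\<lambda>i. if i < d then \<rho> (d - Suc i) else c (i - d)) (A d)"

named_theorems hold_simps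

lemma hold_fls [hold_simps]: "hold Q E c d \<rho> fls \<longleftrightarrow> False"
  by (simp add: hold_def fls_def)

lemma hold_mem [hold_simps]: "x < d \<Longrightarrow> y < d \<Longrightarrow> hold Q E c d \<rho> (x \<^bold>\<in> y) \<longleftrightarrow> E (\<rho> x) (\<rho> y)"
  by (simp add: hold_def mem_def)

lemma hold_eql [hold_simps]: "x < d \<Longrightarrow> y < d \<Longrightarrow> hold Q E c d \<rho> (x \<^bold>= y) \<longleftrightarrow> Q (\<rho> x) (\<rho> y)"
  by (simp add: hold_def eql_def)

lemma hold_imp [hold_simps]:
  "hold Q E c d \<rho> (A \<^bold>\<longrightarrow> B) \<longleftrightarrow> (hold Q E c d \<rho> A \<longrightarrow> hold Q E c d \<rho> B)"
  by (simp add: hold_def imp_def)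

text \<open>A bound variable is named by its level, so the new value is stored at position
  \<open>d\<close> and the earlier levels keep their values. Reading levels backwards gives the de
  Bruijn environment, where the new value comes first.\<close>

lemma hold_all [hold_simps]:
  "hold Q E c d \<rho> (all F) \<longleftrightarrow> (\<forall>v. hold Q E c (Suc d) (\<rho>(d := v)) (F d))"
proof -
  have "case_nat v (\<lambda>i. if i < d then \<rho> (d - Suc i) else c (i - d)) =
      (\<lambda>i. if i < Suc d then (\<rho>(d := v)) (Suc d - Suc i) else c (i - Suc d))" for v
    by (auto simp: fun_eq_iff split: nat.split)
  then show ?thesis by (simp add: hold_def all_def)
qed

lemma hold_neg [hold_simps]: "hold Q E c d \<rho> (\<^bold>\<not> A) \<longleftrightarrow> \<not> hold Q E c d \<rho> A"
  by (simp add: neg_def hold_simps)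

lemma hold_disj [hold_simps]:
  "hold Q E c d \<rho> (A \<^bold>\<or> B) \<longleftrightarrow> hold Q E c d \<rho> A \<or> hold Q E c d \<rho> B"
  by (auto simp: disj_def hold_simps)

lemma hold_conj [hold_simps]:
  "hold Q E c d \<rho> (A \<^bold>\<and> B) \<longleftrightarrow> hold Q E c d \<rho> A \<and> hold Q E c d \<rho> B"
  by (simp add: conj_def hold_simps)

lemma hold_iff [hold_simps]:
  "hold Q E c d \<rho> (A \<^bold>\<longleftrightarrow> B) \<longleftrightarrow> (hold Q E c d \<rho> A \<longleftrightarrow> hold Q E c d \<rho> B)"
  by (auto simp: iff_def hold_simps)

lemma hold_ex [hold_simps]:
  "hold Q E c d \<rho> (ex F) \<longleftrightarrow> (\<exists>v. hold Q E c (Suc d) (\<rho>(d := v)) (F d))"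
  by (simp add: ex_def hold_simps)

lemma hold_ball [hold_simps]:
  "a < d \<Longrightarrow> hold Q E c d \<rho> (ball a F) \<longleftrightarrow>
    (\<forall>v. E v (\<rho> a) \<longrightarrow> hold Q E c (Suc d) (\<rho>(d := v)) (F d))"
  by (simp add: ball_def hold_simps)

lemma hold_bex [hold_simps]:
  "a < d \<Longrightarrow> hold Q E c d \<rho> (bex a F) \<longleftrightarrow>
    (\<exists>v. E v (\<rho> a) \<and> hold Q E c (Suc d) (\<rho>(d := v)) (F d))"
  by (simp add: bex_def hold_simps)

lemma hold_with1 [hold_simps]:
  assumes "x < d"
  shows "hold Q E c d \<rho> (with1 p x) \<longleftrightarrow> sat Q E (case_nat (\<rho> x) c) p"
proof -
  have "(\<lambda>i. if i < d then \<rho> (d - Suc i) else c (i - d)) \<circ> case_nat (d - Suc x) (\<lambda>i. d + i)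
      = case_nat (\<rho> x) c"
    using assms by (auto simp: fun_eq_iff split: nat.split)
  then show ?thesis by (simp only: hold_def with1_def sat_rename)
qed

lemma hold_with2 [hold_simps]:
  assumes "x < d" "y < d"
  shows "hold Q E c d \<rho> (with2 p x y) \<longleftrightarrow> sat Q E (case_nat (\<rho> x) (case_nat (\<rho> y) c)) p"
proof -
  have "(\<lambda>i. if i < d then \<rho> (d - Suc i) else c (i - d)) \<circ>
      case_nat (d - Suc x) (case_nat (d - Suc y) (\<lambda>i. d + i))
      = case_nat (\<rho> x) (case_nat (\<rho> y) c)"
    using assms by (auto simp: fun_eq_iff split: nat.split)
  then show ?thesis by (simp only: hold_def with2_def sat_rename)
qed

lemma sat_sentence: "sat Q E e (sentence A) \<longleftrightarrow> hold Q E e 0 \<rho> A"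
  by (simp add: hold_def sentence_def)

section \<open>The content of the axioms in a model\<close>

lemma sat_funpow_All:
  "sat Q E e ((All ^^ n) p) \<Longrightarrow> (\<And>i. e' (i + n) = e i) \<Longrightarrow> sat Q E e' p"
proof (induction n arbitrary: p e')
  case 0
  then have "e' = e" by (simp add: fun_eq_iff)
  then show ?case using 0 by simp
next
  case (Suc n)
  have "sat Q E e ((All ^^ n) (All p))"
    using Suc.prems(1) by (simp only: funpow_Suc_right comp_apply)
  then have "sat Q E (\<lambda>i. e' (Suc i)) (All p)"
    by (rule Suc.IH) (use Suc.prems(2) in simp)
  then have "sat Q E (case_nat (e' 0) (\<lambda>i. e' (Suc i))) p" by simp
  moreover have "case_nat (e' 0) (\<lambda>i. e' (Suc i)) = e'"
    by (simp add: fun_eq_iff split: nat.split)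
  ultimately show ?case by simp
qed

text \<open>The closures quantify away all parameters, so an axiom schema true in one environment is
  true in every other. Only the values below the bound \<open>n\<close> matter, and these can be set
  at will.\<close>

lemma sat_universal_closures:
  assumes "\<And>q. q \<in> universal_closures p \<Longrightarrow> sat Q E e q"
  shows "sat Q E e' p"
proof -
  obtain n where n: "free_below n p" using ex_free_below by blast
  then have "sat Q E e ((All ^^ n) p)"
    by (intro assms) (auto simp: universal_closures_def)
  then have "sat Q E (\<lambda>i. if i < n then e' i else e (i - n)) p"
    by (rule sat_funpow_All) simp
  moreover have "sat Q E (\<lambda>i. if i < n then e' i else e (i - n)) p \<longleftrightarrow> sat Q E e' p"
    by (rule sat_cong[OF n]) simp
  ultimately show ?thesis by (rule iffD1[rotated])
qed

text \<open>Equality is still an arbitrary relation \<open>Q\<close>, because infinity of the domain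
  modulo \<open>Q\<close> has to be known before the quotient is formed.\<close>

locale zf_sat =
  fixes Q E :: "'a \<Rightarrow> 'a \<Rightarrow> bool" and e :: "nat \<Rightarrow> 'a"
  assumes sat_ZF: "q \<in> ZF \<Longrightarrow> sat Q E e q"
begin

lemma hold_ZF:
  "A \<in> {Extensionality, Foundation, Pairing, Unions, Powerset, Infinity} \<Longrightarrow> hold Q E e 0 \<rho> A"
  using sat_ZF[of "sentence A"] by (simp only: sat_sentence[of _ _ _ _ \<rho>] ZF_def) blast

lemma extensionality: "(\<And>x. E x a \<longleftrightarrow> E x b) \<Longrightarrow> Q a b"
  using hold_ZF[of Extensionality] by (simp add: Extensionality_def hold_simps)

lemma foundation: "E z a \<Longrightarrow> \<exists>x. E x a \<and> (\<forall>y. E y x \<longrightarrow> \<not> E y a)"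
  using hold_ZF[of Foundation] by (auto simp: Foundation_def nonempty_def hold_simps)

lemma pairing: "\<exists>c. \<forall>x. E x c \<longleftrightarrow> Q x a \<or> Q x b"
  using hold_ZF[of Pairing] by (simp add: Pairing_def hold_simps)

lemma unions: "\<exists>b. \<forall>x. E x b \<longleftrightarrow> (\<exists>y. E y a \<and> E x y)"
  using hold_ZF[of Unions] by (simp add: Unions_def hold_simps)

lemma powerset: "\<exists>b. \<forall>x. E x b \<longleftrightarrow> (\<forall>y. E y x \<longrightarrow> E y a)"
  using hold_ZF[of Powerset] by (simp add: Powerset_def subset_def hold_simps)

lemma infinity: "\<exists>w. (\<exists>z. E z w \<and> (\<forall>x. \<not> E x z)) \<and>
    (\<forall>x. E x w \<longrightarrow> (\<exists>s. E s w \<and> (\<forall>z. E z s \<longleftrightarrow> E z x \<or> Q z x)))"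
  using hold_ZF[of Infinity]
  by (simp add: Infinity_def is_inductive_def empty_def succ_def hold_simps)

lemma separation: "\<exists>b. \<forall>x. E x b \<longleftrightarrow> E x a \<and> sat Q E (case_nat x c) p"
proof -
  have "sat Q E c (sentence (Separation p))"
    by (rule sat_universal_closures, rule sat_ZF) (auto simp: ZF_def)
  then show ?thesis
    by (simp add: sat_sentence[of _ _ _ _ undefined] Separation_def hold_simps)
qed

lemma replacement:
  assumes "\<And>x y z. E x a \<Longrightarrow> sat Q E (case_nat x (case_nat y c)) p \<Longrightarrow>
    sat Q E (case_nat x (case_nat z c)) p \<Longrightarrow> Q y z"
  shows "\<exists>b. \<forall>y. E y b \<longleftrightarrow> (\<exists>x. E x a \<and> sat Q E (case_nat x (case_nat y c)) p)"
proof -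
  have "sat Q E c (sentence (Replacement p))"
    by (rule sat_universal_closures, rule sat_ZF) (auto simp: ZF_def)
  then show ?thesis
    using assms by (simp add: sat_sentence[of _ _ _ _ undefined] Replacement_def hold_simps)
qed

end

text \<open>If finitely many elements covered the domain up to \<open>Q\<close>, finitely many
  pairings and unions would produce a universal set \<open>m\<close>. Then \<open>m\<close> would be
  a member of itself, and its singleton would contradict foundation.\<close>

lemma zf_sat_infinite:
  assumes zf: "zf_sat Q E e" and eqv: "equivp Q"
    and cong: "\<And>a b a' b'. Q a a' \<Longrightarrow> Q b b' \<Longrightarrow> E a b \<Longrightarrow> E a' b'"
    and F: "finite F"
  shows "\<exists>x. \<forall>y\<in>F. \<not> Q x y"
proof (rule ccontr)
  interpret zf_sat Q E e by fact
  assume "\<nexists>x. \<forall>y\<in>F. \<not> Q x y"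
  then have cover: "\<exists>y\<in>F. Q x y" for x by blast
  have "\<exists>m. \<forall>x. E x m \<longleftrightarrow> (\<exists>y\<in>F. Q x y)"
    using F
  proof induction
    case empty
    then show ?case using infinity by blast
  next
    case (insert a F)
    then obtain m where m: "\<forall>x. E x m \<longleftrightarrow> (\<exists>y\<in>F. Q x y)" by blast
    obtain s where s: "\<forall>x. E x s \<longleftrightarrow> Q x a \<or> Q x a" using pairing by blast
    obtain c where c: "\<forall>x. E x c \<longleftrightarrow> Q x m \<or> Q x s" using pairing by blast
    obtain u where u: "\<forall>x. E x u \<longleftrightarrow> (\<exists>y. E y c \<and> E x y)" using unions by blast
    have refl: "Q x x" for x using eqv by (simp add: equivp_reflp)
    have "E x u \<longleftrightarrow> E x m \<or> E x s" for x
      using u c cong[OF refl, of _ _ x] refl by metis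
    then have "E x u \<longleftrightarrow> (\<exists>y\<in>insert a F. Q x y)" for x using m s by auto
    then show ?case by blast
  qed
  then obtain m where m: "E x m" for x using cover by blast
  obtain s where s: "\<forall>x. E x s \<longleftrightarrow> Q x m \<or> Q x m" using pairing by blast
  have "E m s" using s eqv by (simp add: equivp_reflp)
  then obtain x where x: "E x s" "\<forall>y. E y x \<longrightarrow> \<not> E y s"
    using foundation by blast
  have "Q m x" using x(1) s eqv by (meson equivp_symp)
  then have "E m x" using cong[OF _ _ m] eqv by (meson equivp_reflp)
  then show False using x(2) \<open>E m s\<close> by blast
qed

text \<open>The schemata have parameters, but only their closures are axioms. Hence 0 bounds the
  free variables of the whole infinite theory, as the Henkin construction demands.\<close>

lemma ZF_free_below: "q \<in> ZF \<Longrightarrow> free_below 0 q"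
proof -
  have "free_below k ((All ^^ n) p)" if "free_below (k + n) p" for k n p
    using that by (induction n arbitrary: k) simp_all
  then have *: "free_below 0 ((All ^^ n) p)" if "free_below n p" for n p
    using that by simp
  assume "q \<in> ZF"
  then consider A where "A \<in> {Extensionality, Foundation, Pairing, Unions, Powerset, Infinity}"
      "q = sentence A" | p where "q \<in> universal_closures p"
    by (auto simp only: ZF_def)
  then show ?thesis
  proof cases
    case 1
    then show ?thesis
      by (auto simp: sentence_def Extensionality_def Foundation_def Pairing_def Unions_def
          Powerset_def Infinity_def is_inductive_def empty_def succ_def nonempty_def subset_def
          all_def ex_def ball_def bex_def iff_def conj_def disj_def neg_def imp_def mem_def eql_def
          fls_def)
  next
    case 2
    then show ?thesis using * by (auto simp: universal_closures_def)
  qed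
qed

theorem ZF_completeness:
  assumes "\<And>(E :: nat \<Rightarrow> nat \<Rightarrow> bool) e. zf_sat (=) E e \<Longrightarrow> sat (=) E e p"
  shows "ZF \<turnstile> p"
proof (rule ccontr)
  assume "\<not> (ZF \<turnstile> p)"
  moreover have "bounded_vars ZF" using ZF_free_below by (auto simp: bounded_vars_def)
  ultimately obtain Q E :: "nat \<Rightarrow> nat \<Rightarrow> bool" and e
    where Q: "equivp Q" "\<And>a b a' b'. Q a a' \<Longrightarrow> Q b b' \<Longrightarrow> E a b \<Longrightarrow> E a' b'"
      and ZF: "\<And>q. q \<in> ZF \<Longrightarrow> sat Q E e q" and p: "\<not> sat Q E e p"
    using completeness_weak by blast
  have "zf_sat Q E e" using ZF by (simp add: zf_sat_def)
  then have inf: "\<exists>x. \<forall>y\<in>F. \<not> Q x y" if "finite F" for F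
    by (rule zf_sat_infinite[OF _ Q(1) _ that]) (rule Q(2); assumption)
  show False
  proof (rule sat_eq_quotient[of Q E])
    show "equivp Q" by fact
    show "E a' b'" if "Q a a'" "Q b b'" "E a b" for a b a' b'
      using that by (rule Q(2))
    show "\<exists>x. \<forall>y\<in>F. \<not> Q x y" if "finite F" for F
      using that by (rule inf)
    fix h :: "nat \<Rightarrow> nat" and E' :: "nat \<Rightarrow> nat \<Rightarrow> bool"
    assume h: "\<And>e p. sat Q E e p \<longleftrightarrow> sat (=) E' (h \<circ> e) p"
    have "zf_sat (=) E' (h \<circ> e)" using ZF by (simp add: zf_sat_def h del: comp_apply)
    then have "sat (=) E' (h \<circ> e) p" by (rule assms)
    then show False using p h[of e p] by iprover
  qed
qed


section \<open>Definability in a model\<close>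

locale zf_model =
  fixes E :: "'a \<Rightarrow> 'a \<Rightarrow> bool"  (infix "\<epsilon>" 50) and e0 :: "nat \<Rightarrow> 'a"
  assumes zf: "zf_sat (=) (\<epsilon>) e0"
begin

sublocale zf_sat "(=)" "(\<epsilon>)" e0
  by (fact zf)

text \<open>Environments are de Bruijn style: a quantifier shifts the environment by one.
  The free variables of a formula are assigned either variables of the environment or constants,
  so definability is with parameters.\<close>

definition val :: "(nat \<Rightarrow> nat + 'a) \<Rightarrow> (nat \<Rightarrow> 'a) \<Rightarrow> nat \<Rightarrow> 'a" where
  "val T e i = (case T i of Inl j \<Rightarrow> e j | Inr c \<Rightarrow> c)"

definition dfn :: "((nat \<Rightarrow> 'a) \<Rightarrow> bool) \<Rightarrow> bool" where
  "dfn P \<longleftrightarrow> (\<exists>p T. P = (\<lambda>e. sat (=) (\<epsilon>) (val T e) p))"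

text \<open>Without function symbols, an operation is definable when its graph is: variable 0 holds
  the value and the arguments are shifted up.\<close>

definition dfnT :: "((nat \<Rightarrow> 'a) \<Rightarrow> 'a) \<Rightarrow> bool" where
  "dfnT t \<longleftrightarrow> dfn (\<lambda>e. e 0 = t (\<lambda>i. e (Suc i)))"

lemma dfnI: "(\<And>e. P e \<longleftrightarrow> sat (=) (\<epsilon>) (val T e) p) \<Longrightarrow> dfn P"
  by (auto simp: dfn_def fun_eq_iff)

lemma dfnE:
  assumes "dfn P"
  obtains p T where "\<And>e. P e \<longleftrightarrow> sat (=) (\<epsilon>) (val T e) p"
  using assms by (auto simp: dfn_def)

section \<open>Closure properties of definability\<close>

lemma dfn_mem_var: "dfn (\<lambda>e. e i \<epsilon> e j)"
  by (rule dfnI[of _ Inl "Mem i j"]) (simp add: val_def)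

lemma dfn_eq_var: "dfn (\<lambda>e. e i = e j)"
  by (rule dfnI[of _ Inl "Eql i j"]) (simp add: val_def)

lemma dfn_eq_const: "dfn (\<lambda>e. e i = c)"
  by (rule dfnI[of _ "case_nat (Inl i) (\<lambda>_. Inr c)" "Eql 0 1"]) (simp add: val_def)

lemma dfn_rename:
  assumes "dfn P"
  shows "dfn (\<lambda>e. P (\<lambda>i. e (r i)))"
proof -
  obtain p T where P: "\<And>e. P e \<longleftrightarrow> sat (=) (\<epsilon>) (val T e) p"
    using assms by (rule dfnE) blast
  have "val T (\<lambda>i. e (r i)) = val (map_sum r (\<lambda>c. c) \<circ> T) e" for e
    by (auto simp: val_def fun_eq_iff split: sum.split)
  then show ?thesis using P by (intro dfnI) simp
qed

named_theorems dfn

lemma dfn_const [dfn]: "dfn (\<lambda>e. P)"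
  by (rule dfnI[of _ Inl "if P then Imp Fls Fls else Fls"]) simp

lemma dfn_imp [dfn]:
  assumes "dfn P" "dfn Q"
  shows "dfn (\<lambda>e. P e \<longrightarrow> Q e)"
proof -
  obtain p T where P: "\<And>e. P e \<longleftrightarrow> sat (=) (\<epsilon>) (val T e) p"
    using assms(1) by (rule dfnE) blast
  obtain q S where Q: "\<And>e. Q e \<longleftrightarrow> sat (=) (\<epsilon>) (val S e) q"
    using assms(2) by (rule dfnE) blast
  \<comment> \<open>The two formulas come with separate assignments of their variables. Even indices
    carry the first and odd indices the second.\<close>
  let ?U = "\<lambda>i. if even i then T (i div 2) else S (i div 2)"
  have "val ?U e \<circ> (\<lambda>i. 2 * i) = val T e" "val ?U e \<circ> (\<lambda>i. 2 * i + 1) = val S e" for e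
    by (auto simp: val_def fun_eq_iff)
  then have "(P e \<longrightarrow> Q e) \<longleftrightarrow> sat (=) (\<epsilon>) (val ?U e)
      (Imp (rename (\<lambda>i. 2 * i) p) (rename (\<lambda>i. 2 * i + 1) q))" for e
    by (simp only: P Q sat.simps sat_rename)
  then show ?thesis by (rule dfnI)
qed

lemma dfn_not [dfn]: "dfn P \<Longrightarrow> dfn (\<lambda>e. \<not> P e)"
  using dfn_imp[OF _ dfn_const, of P False] by simp

lemma dfn_conj [dfn]: "dfn P \<Longrightarrow> dfn Q \<Longrightarrow> dfn (\<lambda>e. P e \<and> Q e)"
  using dfn_not[OF dfn_imp[OF _ dfn_not, of P Q]] by simp

lemma dfn_disj [dfn]: "dfn P \<Longrightarrow> dfn Q \<Longrightarrow> dfn (\<lambda>e. P e \<or> Q e)"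
  using dfn_imp[OF dfn_not, of P Q] by (simp add: disj_imp)

lemma dfn_iff [dfn]: "dfn P \<Longrightarrow> dfn Q \<Longrightarrow> dfn (\<lambda>e. P e \<longleftrightarrow> Q e)"
  using dfn_conj[OF dfn_imp dfn_imp, of P Q Q P] by (simp add: iff_conv_conj_imp)

lemma dfn_all [dfn]:
  assumes "dfn (\<lambda>e. Q (\<lambda>i. e (Suc i)) (e 0))"
  shows "dfn (\<lambda>e. \<forall>v. Q e v)"
proof -
  obtain p T where "\<And>e. Q (\<lambda>i. e (Suc i)) (e 0) \<longleftrightarrow> sat (=) (\<epsilon>) (val T e) p"
    using assms by (rule dfnE) blast
  from this[of "case_nat v e" for v e]
  have Q: "Q e v \<longleftrightarrow> sat (=) (\<epsilon>) (val T (case_nat v e)) p" for e v by simp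
  \<comment> \<open>Several variables of \<open>p\<close> may be assigned the quantified element.
    All of them are merged into index 0, the one that the new quantifier binds; the value of
    \<open>S\<close> at such variables is a dummy that is never read.\<close>
  define r where "r i = (if T i = Inl 0 then 0 else Suc i)" for i
  define S where "S i = (case T i of Inl 0 \<Rightarrow> Inr undefined | Inl (Suc j) \<Rightarrow> Inl j | Inr c \<Rightarrow> Inr c)" for i
  have "case_nat v (val S e) \<circ> r = val T (case_nat v e)" for v e
    by (auto simp: fun_eq_iff val_def S_def r_def split: sum.split nat.split)
  then have "(\<forall>v. Q e v) \<longleftrightarrow> sat (=) (\<epsilon>) (val S e) (All (rename r p))" for e
    by (simp only: Q sat.simps sat_rename)
  then show ?thesis by (rule dfnI)
qed

lemma dfn_ex [dfn]:
  assumes "dfn (\<lambda>e. Q (\<lambda>i. e (Suc i)) (e 0))"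
  shows "dfn (\<lambda>e. \<exists>v. Q e v)"
  using dfn_not[OF dfn_all[OF dfn_not[OF assms]]] by simp

lemma dfn_shift: "dfn P \<Longrightarrow> dfn (\<lambda>e. P (\<lambda>i. e (Suc i)))"
  by (rule dfn_rename)

lemma dfnT_shift: "dfnT t \<Longrightarrow> dfnT (\<lambda>e. t (\<lambda>i. e (Suc i)))"
  unfolding dfnT_def by (drule dfn_rename[of _ "case_nat 0 (\<lambda>i. Suc (Suc i))"]) simp

text \<open>Nested terms are flattened by quantifying over their values. A new relation then has to
  be proved definable at two variables only, and this lemma with its variants extends the result to
  all definable arguments.\<close>

lemma dfn_app2:
  assumes R: "dfn (\<lambda>e. R (e 0) (e (Suc 0)))" and s: "dfnT s" and t: "dfnT t"
  shows "dfn (\<lambda>e. R (s e) (t e))"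
proof -
  have "dfn (\<lambda>e. e (Suc 0) = s (\<lambda>i. e (Suc (Suc i))))"
    using dfn_rename[OF s[unfolded dfnT_def], of "case_nat (Suc 0) (\<lambda>i. Suc (Suc i))"] by simp
  moreover have "dfn (\<lambda>e. e 0 = t (\<lambda>i. e (Suc (Suc i))))"
    using dfn_rename[OF t[unfolded dfnT_def], of "case_nat 0 (\<lambda>i. Suc (Suc i))"] by simp
  moreover have "dfn (\<lambda>e. R (e (Suc 0)) (e 0))"
    using dfn_rename[OF R, of "case_nat (Suc 0) (\<lambda>i. 0)"] by simp
  ultimately have "dfn (\<lambda>e. e (Suc 0) = s (\<lambda>i. e (Suc (Suc i))) \<and>
      e 0 = t (\<lambda>i. e (Suc (Suc i))) \<and> R (e (Suc 0)) (e 0))"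
    by (intro dfn_conj)
  then have "dfn (\<lambda>e. \<exists>y z. y = s e \<and> z = t e \<and> R y z)"
    by (intro dfn_ex)
  then show ?thesis by simp
qed

lemma dfn_mem [dfn]: "dfnT s \<Longrightarrow> dfnT t \<Longrightarrow> dfn (\<lambda>e. s e \<epsilon> t e)"
  by (rule dfn_app2) (rule dfn_mem_var)

lemma dfn_eq [dfn]: "dfnT s \<Longrightarrow> dfnT t \<Longrightarrow> dfn (\<lambda>e. s e = t e)"
  by (rule dfn_app2) (rule dfn_eq_var)

lemma dfnT_var [dfn]: "dfnT (\<lambda>e. e i)" and dfnT_const [dfn]: "dfnT (\<lambda>e. c)"
  by (simp_all add: dfnT_def dfn_eq_var dfn_eq_const)

lemma dfn_app1: "dfn (\<lambda>e. R (e 0)) \<Longrightarrow> dfnT t \<Longrightarrow> dfn (\<lambda>e. R (t e))"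
  by (rule dfn_app2[where R = "\<lambda>x y. R x"]) auto

lemma dfnT_app1: "dfnT (\<lambda>e. G (e 0)) \<Longrightarrow> dfnT t \<Longrightarrow> dfnT (\<lambda>e. G (t e))"
  unfolding dfnT_def[of "\<lambda>e. G (e 0)"] dfnT_def[of "\<lambda>e. G (t e)"]
  by (rule dfn_app2[where R = "\<lambda>x y. x = G y"]) (auto intro: dfnT_shift dfnT_var)

lemma dfn_app3:
  assumes R: "dfn (\<lambda>e. R (e 0) (e (Suc 0)) (e (Suc (Suc 0))))"
    and s: "dfnT s" and t: "dfnT t" and u: "dfnT u"
  shows "dfn (\<lambda>e. R (s e) (t e) (u e))"
proof -
  have "dfn (\<lambda>e. R (s (\<lambda>i. e (Suc i))) (t (\<lambda>i. e (Suc i))) (e 0))"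
  proof -
    have "dfn (\<lambda>e. R (s (\<lambda>i. e (Suc (Suc i)))) (e 0) (e (Suc 0)))"
    proof -
      have "dfn (\<lambda>e. e 0 = s (\<lambda>i. e (Suc (Suc (Suc i)))) \<and> R (e 0) (e (Suc 0)) (e (Suc (Suc 0))))"
        by (intro dfn_conj R dfn_eq dfnT_var dfnT_shift s)
      then have "dfn (\<lambda>e. \<exists>y. y = s (\<lambda>i. e (Suc (Suc i))) \<and> R y (e 0) (e (Suc 0)))"
        by (intro dfn_ex)
      then show ?thesis by simp
    qed
    then have "dfn (\<lambda>e. e 0 = t (\<lambda>i. e (Suc (Suc i))) \<and> R (s (\<lambda>i. e (Suc (Suc i)))) (e 0) (e (Suc 0)))"
      by (intro dfn_conj dfn_eq dfnT_var dfnT_shift t)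
    then have "dfn (\<lambda>e. \<exists>y. y = t (\<lambda>i. e (Suc i)) \<and> R (s (\<lambda>i. e (Suc i))) y (e 0))"
      by (intro dfn_ex)
    then show ?thesis by simp
  qed
  then have "dfn (\<lambda>e. e 0 = u (\<lambda>i. e (Suc i)) \<and> R (s (\<lambda>i. e (Suc i))) (t (\<lambda>i. e (Suc i))) (e 0))"
    by (intro dfn_conj dfn_eq dfnT_var dfnT_shift u)
  then have "dfn (\<lambda>e. \<exists>y. y = u e \<and> R (s e) (t e) y)"
    by (intro dfn_ex)
  then show ?thesis by simp
qed

lemma dfnT_app2:
  "dfnT (\<lambda>e. G (e 0) (e (Suc 0))) \<Longrightarrow> dfnT s \<Longrightarrow> dfnT t \<Longrightarrow> dfnT (\<lambda>e. G (s e) (t e))"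
  unfolding dfnT_def[of "\<lambda>e. G (e 0) (e (Suc 0))"] dfnT_def[of "\<lambda>e. G (s e) (t e)"]
  by (rule dfn_app3[where R = "\<lambda>x y z. x = G y z"]) (auto intro: dfnT_shift dfnT_var)

lemma dfnT_if [dfn]:
  assumes "dfn P" "dfnT s" "dfnT t"
  shows "dfnT (\<lambda>e. if P e then s e else t e)"
proof -
  have "dfn (\<lambda>e. (P (\<lambda>i. e (Suc i)) \<longrightarrow> e 0 = s (\<lambda>i. e (Suc i))) \<and>
      (\<not> P (\<lambda>i. e (Suc i)) \<longrightarrow> e 0 = t (\<lambda>i. e (Suc i))))"
    by (intro dfn dfn_shift dfnT_shift assms)
  then show ?thesis unfolding dfnT_def by (rule back_subst[of dfn]) auto
qed

lemma dfn_ex1 [dfn]: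
  assumes "dfn (\<lambda>e. Q (\<lambda>i. e (Suc i)) (e 0))"
  shows "dfn (\<lambda>e. \<exists>!v. Q e v)"
proof -
  have *: "dfn (\<lambda>e. Q (\<lambda>i. e (Suc (Suc i))) (e 0))"
    using dfn_rename[OF assms, of "case_nat 0 (\<lambda>i. Suc (Suc i))"] by simp
  have "dfn (\<lambda>e. \<exists>v. Q e v \<and> (\<forall>w. Q e w \<longrightarrow> w = v))"
    by (intro dfn assms *)
  then show ?thesis by (simp add: Ex1_def)
qed

text \<open>Unlike \<open>THE\<close>, \<open>the1 P\<close> is a fixed element when there is no unique witness, so that it is
  definable in every case.\<close>

definition the1 :: "('a \<Rightarrow> bool) \<Rightarrow> 'a" where
  "the1 P = (if \<exists>!y. P y then THE y. P y else undefined)"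

lemma the1_equality: "P y \<Longrightarrow> (\<And>z. P z \<Longrightarrow> z = y) \<Longrightarrow> the1 P = y"
  unfolding the1_def by (metis the_equality)

lemma dfnT_the1 [dfn]:
  assumes "dfn (\<lambda>e. Q (\<lambda>i. e (Suc i)) (e 0))"
  shows "dfnT (\<lambda>e. the1 (Q e))"
proof -
  have "y = the1 P \<longleftrightarrow> ((\<exists>!z. P z) \<longrightarrow> P y) \<and> (\<not> (\<exists>!z. P z) \<longrightarrow> y = undefined)"
    for y and P :: "'a \<Rightarrow> bool"
    unfolding the1_def by (auto intro: theI2)
  moreover have "dfn (\<lambda>e. ((\<exists>!z. Q (\<lambda>i. e (Suc i)) z) \<longrightarrow> Q (\<lambda>i. e (Suc i)) (e 0)) \<and>
      (\<not> (\<exists>!z. Q (\<lambda>i. e (Suc i)) z) \<longrightarrow> e 0 = undefined))"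
    by (intro dfn_conj dfn_imp dfn_not dfn_shift[where P = "\<lambda>e. \<exists>!z. Q e z"] dfn_ex1 assms dfn)
  ultimately show ?thesis by (simp only: dfnT_def)
qed

section \<open>Comprehension inside the model\<close>

definition isset :: "('a \<Rightarrow> bool) \<Rightarrow> bool" where
  "isset P \<longleftrightarrow> (\<exists>b. \<forall>x. x \<epsilon> b \<longleftrightarrow> P x)"

text \<open>A total comprehension term: its definability needs no proof that the set exists, and
  existence is owed only when its members are described through \<open>mk_iff\<close>.\<close>

definition mk :: "('a \<Rightarrow> bool) \<Rightarrow> 'a" where
  "mk P = the1 (\<lambda>b. \<forall>x. x \<epsilon> b \<longleftrightarrow> P x)"

lemma mk_iff: "isset P \<Longrightarrow> x \<epsilon> mk P \<longleftrightarrow> P x"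
proof -
  assume "isset P"
  then obtain b where b: "\<forall>x. x \<epsilon> b \<longleftrightarrow> P x" by (auto simp: isset_def)
  then have "mk P = b"
    unfolding mk_def by (intro the1_equality extensionality) auto
  then show ?thesis using b by simp
qed

lemma dfnT_mk [dfn]:
  assumes "dfn (\<lambda>e. Q (\<lambda>i. e (Suc i)) (e 0))"
  shows "dfnT (\<lambda>e. mk (Q e))"
proof -
  have *: "dfn (\<lambda>e. Q (\<lambda>i. e (Suc (Suc i))) (e 0))"
    using dfn_rename[OF assms, of "case_nat 0 (\<lambda>i. Suc (Suc i))"] by simp
  show ?thesis unfolding mk_def by (intro dfn *)
qed

lemma isset_sep:
  assumes "dfn (\<lambda>e. P (e 0))"
  shows "isset (\<lambda>x. x \<epsilon> a \<and> P x)"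
proof -
  obtain p T where P: "\<And>e. P (e 0) \<longleftrightarrow> sat (=) (\<epsilon>) (val T e) p"
    using assms by (rule dfnE) blast
  \<comment> \<open>\<open>P\<close> reads the environment at position 0 only, so it may be
    evaluated in the constant environment. All environment variables merge into index 0, while
    constants of the model become the parameters \<open>c\<close>, shifted by one.\<close>
  define r where "r i = (case T i of Inl _ \<Rightarrow> 0 | Inr _ \<Rightarrow> Suc i)" for i
  define c where "c = val T undefined"
  have "case_nat x c \<circ> r = val T (\<lambda>i. x)" for x
    by (auto simp: fun_eq_iff val_def c_def r_def split: sum.split)
  then have "P x \<longleftrightarrow> sat (=) (\<epsilon>) (case_nat x c) (rename r p)" for x
    using P[of "\<lambda>i. x"] by (simp add: sat_rename)
  then show ?thesis using separation by (simp add: isset_def)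
qed

lemma isset_subset: "dfn (\<lambda>e. P (e 0)) \<Longrightarrow> (\<And>x. P x \<Longrightarrow> x \<epsilon> a) \<Longrightarrow> isset P"
  using isset_sep[of P a] unfolding isset_def by metis

lemma isset_repl:
  assumes "dfnT (\<lambda>e. G (e 0))"
  shows "isset (\<lambda>y. \<exists>x. x \<epsilon> a \<and> y = G x)"
proof -
  obtain p T where P: "\<And>e. e 0 = G (e (Suc 0)) \<longleftrightarrow> sat (=) (\<epsilon>) (val T e) p"
    using assms unfolding dfnT_def by (rule dfnE) blast
  \<comment> \<open>The graph of \<open>G\<close> has the value at position 0 and the argument after
    it, whereas \<open>replacement\<close> expects the argument at index 0 and the value at index 1.
    Constants move above both.\<close>
  define r where "r i = (case T i of Inl 0 \<Rightarrow> Suc 0 | Inl (Suc _) \<Rightarrow> 0 | Inr _ \<Rightarrow> Suc (Suc i))" for i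
  define c where "c = val T undefined"
  have "case_nat x (case_nat y c) \<circ> r = val T (case_nat y (\<lambda>i. x))" for x y
    by (auto simp: fun_eq_iff val_def c_def r_def split: sum.split nat.split)
  then have *: "y = G x \<longleftrightarrow> sat (=) (\<epsilon>) (case_nat x (case_nat y c)) (rename r p)" for x y
    using P[of "case_nat y (\<lambda>i. x)"] by (simp add: sat_rename)
  show ?thesis unfolding isset_def * by (rule replacement) (simp flip: *)
qed

section \<open>Pairs, functions and natural numbers\<close>

definition emp where "emp = mk (\<lambda>x. False)"
definition upair where "upair a b = mk (\<lambda>x. x = a \<or> x = b)"
definition pr where "pr a b = upair (upair a a) (upair a b)"
definition un where "un a = mk (\<lambda>x. \<exists>y. y \<epsilon> a \<and> x \<epsilon> y)"
definition suc where "suc n = mk (\<lambda>z. z \<epsilon> n \<or> z = n)"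
definition pow where "pow a = mk (\<lambda>x. \<forall>y. y \<epsilon> x \<longrightarrow> y \<epsilon> a)"

lemma emp_iff [simp]: "\<not> x \<epsilon> emp"
proof -
  have "isset (\<lambda>x. False)" using isset_sep[OF dfn_const, of "undefined" False] by simp
  then show ?thesis by (simp add: emp_def mk_iff)
qed

lemma upair_iff [simp]: "x \<epsilon> upair a b \<longleftrightarrow> x = a \<or> x = b"
  using pairing unfolding upair_def by (subst mk_iff) (simp_all add: isset_def)

lemma un_iff [simp]: "x \<epsilon> un a \<longleftrightarrow> (\<exists>y. y \<epsilon> a \<and> x \<epsilon> y)"
  using unions unfolding un_def by (subst mk_iff) (simp_all add: isset_def)

lemma pow_iff [simp]: "x \<epsilon> pow a \<longleftrightarrow> (\<forall>y. y \<epsilon> x \<longrightarrow> y \<epsilon> a)"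
  using powerset unfolding pow_def by (subst mk_iff) (simp_all add: isset_def)

lemma suc_iff [simp]: "z \<epsilon> suc n \<longleftrightarrow> z \<epsilon> n \<or> z = n"
proof -
  have "\<forall>z. z \<epsilon> un (upair n (upair n n)) \<longleftrightarrow> z \<epsilon> n \<or> z = n" by auto
  then have "isset (\<lambda>z. z \<epsilon> n \<or> z = n)" unfolding isset_def by (rule exI)
  then show ?thesis by (simp add: suc_def mk_iff)
qed

lemma ext_iff: "a = b \<longleftrightarrow> (\<forall>x. x \<epsilon> a \<longleftrightarrow> x \<epsilon> b)"
  using extensionality by blast

lemma upair_eq: "upair a b = upair c d \<longleftrightarrow> a = c \<and> b = d \<or> a = d \<and> b = c"
  unfolding ext_iff[of "upair a b"] upair_iff by metis

lemma pr_inject [simp]: "pr a b = pr c d \<longleftrightarrow> a = c \<and> b = d"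
  unfolding pr_def upair_eq by auto

lemma dfnT_upair [dfn]: "dfnT s \<Longrightarrow> dfnT t \<Longrightarrow> dfnT (\<lambda>e. upair (s e) (t e))"
  by (rule dfnT_app2) (unfold upair_def, intro dfn)

lemma dfnT_pr [dfn]: "dfnT s \<Longrightarrow> dfnT t \<Longrightarrow> dfnT (\<lambda>e. pr (s e) (t e))"
  by (rule dfnT_app2) (unfold pr_def, intro dfn)

lemma dfnT_suc [dfn]: "dfnT s \<Longrightarrow> dfnT (\<lambda>e. suc (s e))"
  by (rule dfnT_app1) (unfold suc_def, intro dfn)

lemma dfnT_pow [dfn]: "dfnT s \<Longrightarrow> dfnT (\<lambda>e. pow (s e))"
  by (rule dfnT_app1) (unfold pow_def, intro dfn)

section \<open>Products and functions\<close>

definition prd where "prd a b = mk (\<lambda>p. \<exists>x y. x \<epsilon> a \<and> y \<epsilon> b \<and> p = pr x y)"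

text \<open>The product is assembled from its rows: replacement in the second coordinate gives one
  row, replacement in the first gives the set of rows, and their union is the product.\<close>

lemma isset_prd: "isset (\<lambda>p. \<exists>x y. x \<epsilon> a \<and> y \<epsilon> b \<and> p = pr x y)"
proof -
  define G where "G x = mk (\<lambda>p. \<exists>y. y \<epsilon> b \<and> p = pr x y)" for x
  have G: "p \<epsilon> G x \<longleftrightarrow> (\<exists>y. y \<epsilon> b \<and> p = pr x y)" for p x
    unfolding G_def by (rule mk_iff, rule isset_repl) (intro dfn)
  have "isset (\<lambda>y. \<exists>x. x \<epsilon> a \<and> y = G x)"
    by (rule isset_repl) (unfold G_def, intro dfn)
  then obtain c where "\<forall>y. y \<epsilon> c \<longleftrightarrow> (\<exists>x. x \<epsilon> a \<and> y = G x)" by (auto simp: isset_def)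
  then have "\<forall>p. p \<epsilon> un c \<longleftrightarrow> (\<exists>x y. x \<epsilon> a \<and> y \<epsilon> b \<and> p = pr x y)"
    by (auto simp: G)
  then show ?thesis unfolding isset_def by (rule exI)
qed

lemma prd_iff [simp]: "p \<epsilon> prd a b \<longleftrightarrow> (\<exists>x y. x \<epsilon> a \<and> y \<epsilon> b \<and> p = pr x y)"
  unfolding prd_def by (rule mk_iff[OF isset_prd])

definition mkfun where "mkfun a G = mk (\<lambda>p. \<exists>x. x \<epsilon> a \<and> p = pr x (G x))"
text \<open>Application is total, with a fixed default where \<open>f\<close> has no unique value.
  Quantifiers over sequences may thus range over all elements of the model, without a side condition
  that the element be a function.\<close>

definition ap where "ap f x = the1 (\<lambda>y. pr x y \<epsilon> f)"

lemma the1I: "\<exists>!y. P y \<Longrightarrow> P (the1 P)"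
  unfolding the1_def by (simp add: theI')

lemma dfnT_ap [dfn]: "dfnT s \<Longrightarrow> dfnT t \<Longrightarrow> dfnT (\<lambda>e. ap (s e) (t e))"
  by (rule dfnT_app2) (unfold ap_def, intro dfn)

lemma mkfun_iff:
  assumes G: "dfnT (\<lambda>e. G (e 0))"
  shows "p \<epsilon> mkfun a G \<longleftrightarrow> (\<exists>x. x \<epsilon> a \<and> p = pr x (G x))"
proof -
  note [dfn] = dfnT_app1[OF G]
  show ?thesis unfolding mkfun_def by (rule mk_iff, rule isset_repl) (intro dfn)
qed

lemma ap_mkfun:
  assumes G: "dfnT (\<lambda>e. G (e 0))" and x: "x \<epsilon> a"
  shows "ap (mkfun a G) x = G x"
  unfolding ap_def mkfun_iff[OF G] using x by (intro the1_equality) auto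

definition fnc where
  "fnc f a \<longleftrightarrow> (\<forall>p. p \<epsilon> f \<longrightarrow> (\<exists>x. x \<epsilon> a \<and> (\<exists>y. p = pr x y))) \<and> (\<forall>x. x \<epsilon> a \<longrightarrow> (\<exists>!y. pr x y \<epsilon> f))"

lemma dfn_fnc [dfn]: "dfnT s \<Longrightarrow> dfnT t \<Longrightarrow> dfn (\<lambda>e. fnc (s e) (t e))"
  by (rule dfn_app2) (unfold fnc_def, intro dfn)

lemma fnc_mkfun:
  assumes G: "dfnT (\<lambda>e. G (e 0))"
  shows "fnc (mkfun a G) a"
  unfolding fnc_def mkfun_iff[OF G] by auto

lemma fnc_pr_iff:
  assumes f: "fnc f a"
  shows "pr x y \<epsilon> f \<longleftrightarrow> x \<epsilon> a \<and> y = ap f x"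
proof -
  have "pr x y \<epsilon> f \<longleftrightarrow> y = ap f x" if x: "x \<epsilon> a"
  proof -
    have "\<exists>!y. pr x y \<epsilon> f" using f x unfolding fnc_def by blast
    then obtain z where z: "pr x z \<epsilon> f" "\<And>y. pr x y \<epsilon> f \<Longrightarrow> y = z" by (elim ex1E) blast
    have "ap f x = z" unfolding ap_def by (rule the1_equality, rule z(1), erule z(2))
    then show ?thesis using z by blast
  qed
  moreover have "x \<epsilon> a" if "pr x y \<epsilon> f"
  proof -
    have "\<exists>x'. x' \<epsilon> a \<and> (\<exists>y'. pr x y = pr x' y')"
      using f that by (simp only: fnc_def)
    then show ?thesis by auto
  qed
  ultimately show ?thesis by blast
qed

section \<open>Natural numbers of the model\<close>

definition indset where
  "indset w \<longleftrightarrow> emp \<epsilon> w \<and> (\<forall>x. x \<epsilon> w \<longrightarrow> suc x \<epsilon> w)"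

definition om where "om = mk (\<lambda>n. \<forall>w. indset w \<longrightarrow> n \<epsilon> w)"

lemma ex_indset: "\<exists>w. indset w"
proof -
  have "s = suc x \<longleftrightarrow> (\<forall>z. z \<epsilon> s \<longleftrightarrow> z \<epsilon> x \<or> z = x)" for s x
    by (simp add: ext_iff[of s])
  moreover have "s = emp \<longleftrightarrow> (\<forall>z. \<not> z \<epsilon> s)" for s
    by (simp add: ext_iff[of s])
  ultimately show ?thesis using infinity unfolding indset_def by metis
qed

lemma om_iff: "n \<epsilon> om \<longleftrightarrow> (\<forall>w. indset w \<longrightarrow> n \<epsilon> w)"
proof -
  have "isset (\<lambda>n. \<forall>w. indset w \<longrightarrow> n \<epsilon> w)"
  proof (rule isset_subset)
    have [dfn]: "dfnT (\<lambda>e. emp)" by (rule dfnT_const)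
    show "dfn (\<lambda>e. \<forall>w. indset w \<longrightarrow> e 0 \<epsilon> w)"
      unfolding indset_def by (intro dfn)
    show "n \<epsilon> (SOME w. indset w)" if "\<forall>w. indset w \<longrightarrow> n \<epsilon> w" for n
      using someI_ex[OF ex_indset] that by blast
  qed
  then show ?thesis by (simp add: om_def mk_iff)
qed

lemma om_0 [simp]: "emp \<epsilon> om" and om_suc [simp]: "n \<epsilon> om \<Longrightarrow> suc n \<epsilon> om"
  by (auto simp: om_iff indset_def)

text \<open>Since \<open>om\<close> may contain nonstandard elements, induction is available for
  definable predicates only: these cut out an inductive subset by separation. The case
  \<open>def\<close> is this obligation in every induction.\<close>

lemma om_induct [consumes 1, case_names def 0 suc]:
  assumes n: "n \<epsilon> om" and P: "dfn (\<lambda>e. P (e 0))" and 0: "P emp"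
    and suc: "\<And>n. n \<epsilon> om \<Longrightarrow> P n \<Longrightarrow> P (suc n)"
  shows "P n"
proof -
  obtain w where w: "\<And>n. n \<epsilon> w \<longleftrightarrow> n \<epsilon> om \<and> P n"
    using isset_sep[OF P, of om] by (auto simp: isset_def)
  then have "indset w" using 0 suc by (simp add: indset_def)
  then show ?thesis using n w by (auto simp: om_iff)
qed

lemma om_trans:
  assumes "n \<epsilon> om"
  shows "m \<epsilon> n \<Longrightarrow> k \<epsilon> m \<Longrightarrow> k \<epsilon> n"
proof -
  from assms have "\<forall>m k. m \<epsilon> n \<longrightarrow> k \<epsilon> m \<longrightarrow> k \<epsilon> n"
  proof (induction rule: om_induct)
    case def
    show ?case by (intro dfn)
  qed auto
  then show "m \<epsilon> n \<Longrightarrow> k \<epsilon> m \<Longrightarrow> k \<epsilon> n" by blast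
qed

lemma om_mem:
  assumes "n \<epsilon> om" "m \<epsilon> n"
  shows "m \<epsilon> om"
proof -
  from assms(1) have "\<forall>m. m \<epsilon> n \<longrightarrow> m \<epsilon> om"
  proof (induction rule: om_induct)
    case def
    show ?case by (intro dfn)
  qed auto
  then show ?thesis using assms(2) by blast
qed

lemma not_mem_self: "\<not> x \<epsilon> x"
  using foundation[of x "upair x x"] by auto

lemma suc_inject: "suc m = suc n \<longleftrightarrow> m = n"
proof
  assume *: "suc m = suc n"
  show "m = n"
  proof (rule ccontr)
    assume "m \<noteq> n"
    moreover have "m \<epsilon> suc n" "n \<epsilon> suc m"
      unfolding *[symmetric] by simp (unfold *, simp)
    ultimately have "m \<epsilon> n" "n \<epsilon> m" by auto
    then show False using foundation[of m "upair m n"] by auto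
  qed
qed simp

lemma suc_not_emp: "suc n \<noteq> emp"
  by (metis emp_iff suc_iff)

lemma om_linear:
  assumes "m \<epsilon> om" "n \<epsilon> om"
  shows "m \<epsilon> n \<or> m = n \<or> n \<epsilon> m"
proof -
  have zero: "emp \<epsilon> k \<or> k = emp" if "k \<epsilon> om" for k
    using that
  proof (induction rule: om_induct)
    case def
    show ?case by (intro dfn)
  qed auto
  have step: "suc i \<epsilon> k \<or> suc i = k" if "k \<epsilon> om" "i \<epsilon> k" for i k
  proof -
    from that(1) have "\<forall>i. i \<epsilon> k \<longrightarrow> suc i \<epsilon> k \<or> suc i = k"
    proof (induction rule: om_induct)
      case def
      show ?case by (intro dfn)
    qed auto
    then show ?thesis using that(2) by blast
  qed
  from assms(2) show ?thesis
  proof (induction rule: om_induct)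
    case def
    show ?case by (intro dfn)
  next
    case 0
    show ?case using zero[OF assms(1)] by auto
  next
    case (suc n)
    then show ?case using step[OF assms(1)] by auto
  qed
qed

text \<open>Foundation, applied to the set of solutions, yields an element none of whose members is
  a solution. Membership is the order of \<open>om\<close>, and its linearity gives
  uniqueness.\<close>

lemma least_om:
  assumes P: "dfn (\<lambda>e. P (e 0))" and n: "n \<epsilon> om" "P n"
  shows "\<exists>!m. m \<epsilon> om \<and> P m \<and> (\<forall>k. k \<epsilon> m \<longrightarrow> \<not> P k)"
proof -
  obtain w where w: "\<And>n. n \<epsilon> w \<longleftrightarrow> n \<epsilon> om \<and> P n"
    using isset_sep[OF P, of om] by (auto simp: isset_def)
  then obtain m where "m \<epsilon> w" "\<And>k. k \<epsilon> m \<Longrightarrow> \<not> k \<epsilon> w"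
    using foundation[of n w] n by blast
  then show ?thesis
    by (intro ex1I[of _ m]) (use w om_mem om_linear in blast)+
qed

section \<open>The meaning of the sentences in a model\<close>

definition sub (infix "\<sqsubseteq>" 50) where "a \<sqsubseteq> b \<longleftrightarrow> (\<forall>x. x \<epsilon> a \<longrightarrow> x \<epsilon> b)"
definition inhab where "inhab a \<longleftrightarrow> (\<exists>x. x \<epsilon> a)"
definition maps_to where "maps_to f a b \<longleftrightarrow> fnc f a \<and> (\<forall>x y. pr x y \<epsilon> f \<longrightarrow> y \<epsilon> b)"
definition biject where "biject f a b \<longleftrightarrow> maps_to f a b \<and> (\<forall>y. y \<epsilon> b \<longrightarrow> (\<exists>!x. pr x y \<epsilon> f))"
definition equip where "equip a b \<longleftrightarrow> (\<exists>f. biject f a b)"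
definition fin where "fin a \<longleftrightarrow> (\<exists>n. n \<epsilon> om \<and> equip a n)"
definition ctb where "ctb a \<longleftrightarrow> (\<exists>b. b \<sqsubseteq> om \<and> equip a b)"
definition choice_fn where "choice_fn f a \<longleftrightarrow> fnc f a \<and>
  (\<forall>x. x \<epsilon> a \<longrightarrow> (\<forall>y. pr x y \<epsilon> f \<longrightarrow> inhab y \<and> fin y \<and> y \<sqsubseteq> x))"
definition model_CMC where "model_CMC \<longleftrightarrow>
  (\<forall>a. (\<not> fin a \<and> ctb a) \<and> (\<forall>x. x \<epsilon> a \<longrightarrow> inhab x) \<longrightarrow> (\<exists>f. choice_fn f a))"

definition union_of where "union_of s U \<longleftrightarrow> (\<forall>x. x \<epsilon> s \<longleftrightarrow> (\<exists>u. u \<epsilon> U \<and> x \<epsilon> u))"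
definition inter_of where "inter_of s U \<longleftrightarrow> (\<forall>x. x \<epsilon> s \<longleftrightarrow> (\<forall>u. u \<epsilon> U \<longrightarrow> x \<epsilon> u))"
definition top_on where "top_on X T \<longleftrightarrow> (\<forall>u. u \<epsilon> T \<longrightarrow> u \<sqsubseteq> X) \<and> emp \<epsilon> T \<and> X \<epsilon> T \<and>
  (\<forall>u. u \<epsilon> T \<longrightarrow> (\<forall>v. v \<epsilon> T \<longrightarrow> (\<exists>s. s \<epsilon> T \<and> (\<forall>x. x \<epsilon> s \<longleftrightarrow> x \<epsilon> u \<and> x \<epsilon> v)))) \<and>
  (\<forall>U. U \<sqsubseteq> T \<longrightarrow> (\<exists>s. s \<epsilon> T \<and> union_of s U))"
definition clop where "clop X T u \<longleftrightarrow> u \<epsilon> T \<and> (\<exists>v. v \<epsilon> T \<and> (\<forall>x. x \<epsilon> v \<longleftrightarrow> x \<epsilon> X \<and> \<not> x \<epsilon> u))"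
definition cinter where "cinter P s \<longleftrightarrow>
  (\<exists>U. inhab U \<and> ctb U \<and> (\<forall>u. u \<epsilon> U \<longrightarrow> P u) \<and> inter_of s U)"
definition stable where "stable P \<longleftrightarrow>
  (\<forall>U. inhab U \<and> ctb U \<and> (\<forall>u. u \<epsilon> U \<longrightarrow> P u) \<longrightarrow> (\<exists>s. inter_of s U \<and> P s))"

definition acu where "acu R f e \<longleftrightarrow> maps_to f (prd R R) R \<and> e \<epsilon> R \<and>
  (\<forall>x. x \<epsilon> R \<longrightarrow> (\<forall>y. y \<epsilon> R \<longrightarrow> (\<forall>z. z \<epsilon> R \<longrightarrow> (\<forall>u v w. pr (pr x y) u \<epsilon> f \<and> pr (pr u z) w \<epsilon> f \<and>
     pr (pr y z) v \<epsilon> f \<longrightarrow> pr (pr x v) w \<epsilon> f)))) \<and>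
  (\<forall>x. x \<epsilon> R \<longrightarrow> (\<forall>y. y \<epsilon> R \<longrightarrow> (\<forall>u. pr (pr x y) u \<epsilon> f \<longrightarrow> pr (pr y x) u \<epsilon> f))) \<and>
  (\<forall>x. x \<epsilon> R \<longrightarrow> pr (pr x e) x \<epsilon> f)"
definition fld where "fld R zero one add mul \<longleftrightarrow> acu R add zero \<and> acu R mul one \<and> zero \<noteq> one \<and>
  (\<forall>x. x \<epsilon> R \<longrightarrow> (\<exists>y. y \<epsilon> R \<and> pr (pr x y) zero \<epsilon> add)) \<and>
  (\<forall>x. x \<epsilon> R \<longrightarrow> x \<noteq> zero \<longrightarrow> (\<exists>y. y \<epsilon> R \<and> pr (pr x y) one \<epsilon> mul)) \<and>
  (\<forall>x. x \<epsilon> R \<longrightarrow> (\<forall>y. y \<epsilon> R \<longrightarrow> (\<forall>z. z \<epsilon> R \<longrightarrow> (\<forall>s t u v.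
     pr (pr y z) s \<epsilon> add \<and> pr (pr x s) t \<epsilon> mul \<and> pr (pr x y) u \<epsilon> mul \<and> pr (pr x z) v \<epsilon> mul \<longrightarrow>
     pr (pr u v) t \<epsilon> add))))"
definition slo where "slo R lt \<longleftrightarrow> (\<forall>x. x \<epsilon> R \<longrightarrow> \<not> pr x x \<epsilon> lt) \<and>
  (\<forall>x. x \<epsilon> R \<longrightarrow> (\<forall>y. y \<epsilon> R \<longrightarrow> (\<forall>z. z \<epsilon> R \<longrightarrow> pr x y \<epsilon> lt \<and> pr y z \<epsilon> lt \<longrightarrow> pr x z \<epsilon> lt))) \<and>
  (\<forall>x. x \<epsilon> R \<longrightarrow> (\<forall>y. y \<epsilon> R \<longrightarrow> pr x y \<epsilon> lt \<or> x = y \<or> pr y x \<epsilon> lt))"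
definition ofld where "ofld R zero one add mul lt \<longleftrightarrow> fld R zero one add mul \<and> slo R lt \<and>
  (\<forall>x. x \<epsilon> R \<longrightarrow> (\<forall>y. y \<epsilon> R \<longrightarrow> (\<forall>z. z \<epsilon> R \<longrightarrow> (\<forall>u v.
     pr x y \<epsilon> lt \<and> pr (pr x z) u \<epsilon> add \<and> pr (pr y z) v \<epsilon> add \<longrightarrow> pr u v \<epsilon> lt)))) \<and>
  (\<forall>x. x \<epsilon> R \<longrightarrow> (\<forall>y. y \<epsilon> R \<longrightarrow> (\<forall>u.
     pr zero x \<epsilon> lt \<and> pr zero y \<epsilon> lt \<and> pr (pr x y) u \<epsilon> mul \<longrightarrow> pr zero u \<epsilon> lt)))"
definition ubound where "ubound lt S b \<longleftrightarrow> (\<forall>x. x \<epsilon> S \<longrightarrow> pr x b \<epsilon> lt \<or> x = b)"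
definition complete where "complete R lt \<longleftrightarrow>
  (\<forall>S. S \<sqsubseteq> R \<and> inhab S \<and> (\<exists>b. b \<epsilon> R \<and> ubound lt S b) \<longrightarrow>
    (\<exists>b. b \<epsilon> R \<and> ubound lt S b \<and> (\<forall>c. c \<epsilon> R \<longrightarrow> ubound lt S c \<longrightarrow> pr b c \<epsilon> lt \<or> b = c)))"
definition is_reals where "is_reals R zero one add mul lt \<longleftrightarrow>
  ofld R zero one add mul lt \<and> complete R lt"
definition ropen where "ropen R lt V \<longleftrightarrow> V \<sqsubseteq> R \<and>
  (\<forall>x. x \<epsilon> V \<longrightarrow> (\<exists>a. a \<epsilon> R \<and> (\<exists>b. b \<epsilon> R \<and> pr a x \<epsilon> lt \<and> pr x b \<epsilon> lt \<and>
     (\<forall>y. y \<epsilon> R \<longrightarrow> pr a y \<epsilon> lt \<and> pr y b \<epsilon> lt \<longrightarrow> y \<epsilon> V))))"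
definition cont where "cont X T R lt f \<longleftrightarrow> maps_to f X R \<and>
  (\<forall>V. ropen R lt V \<longrightarrow> (\<exists>u. u \<epsilon> T \<and> (\<forall>x. x \<epsilon> u \<longleftrightarrow> x \<epsilon> X \<and> (\<exists>y. y \<epsilon> V \<and> pr x y \<epsilon> f))))"
definition zset where "zset X T R zero lt s \<longleftrightarrow>
  (\<exists>f. cont X T R lt f \<and> (\<forall>x. x \<epsilon> s \<longleftrightarrow> x \<epsilon> X \<and> pr x zero \<epsilon> f))"
definition dtop where "dtop T D \<longleftrightarrow>
  (\<forall>s. s \<epsilon> D \<longleftrightarrow> (\<exists>U. (\<forall>u. u \<epsilon> U \<longrightarrow> cinter (\<lambda>u. u \<epsilon> T) u) \<and> union_of s U))"
definition pspace where "pspace X T \<longleftrightarrow> top_on X T \<and> (\<forall>s. cinter (\<lambda>u. u \<epsilon> T) s \<longrightarrow> s \<epsilon> T)"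
definition model_stable where "model_stable \<longleftrightarrow> (\<forall>X T. top_on X T \<longrightarrow>
  stable (cinter (clop X T)) \<and>
  (\<forall>R zero one add mul lt. is_reals R zero one add mul lt \<longrightarrow> stable (zset X T R zero lt)) \<and>
  stable (cinter (\<lambda>u. u \<epsilon> T)))"
definition model_pspace where "model_pspace \<longleftrightarrow>
  (\<forall>X T. top_on X T \<longrightarrow> (\<exists>D. dtop T D \<and> pspace X D))"

section \<open>Translation of the object-level formulas\<close>

abbreviation holds where "holds \<equiv> hold (=) (\<epsilon>)"

named_theorems holds

text \<open>Side conditions on levels: an outer level stays below the new depth, and it differs from
  the fresh level, so that updating the environment there leaves it unchanged.\<close>

lemmas [holds] = less_SucI fun_upd_apply less_imp_neq

lemma holds_subset [holds]: "a < d \<Longrightarrow> b < d \<Longrightarrow> holds c d \<rho> (a \<^bold>\<subseteq> b) \<longleftrightarrow> \<rho> a \<sqsubseteq> \<rho> b"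
  by (simp add: subset_def sub_def hold_simps holds)

lemma holds_empty [holds]: "a < d \<Longrightarrow> holds c d \<rho> (empty a) \<longleftrightarrow> \<rho> a = emp"
  by (simp add: empty_def hold_simps holds ext_iff[of _ emp])

lemma holds_nonempty [holds]: "a < d \<Longrightarrow> holds c d \<rho> (nonempty a) \<longleftrightarrow> inhab (\<rho> a)"
  by (simp add: nonempty_def inhab_def hold_simps holds)

lemma holds_succ [holds]: "s < d \<Longrightarrow> x < d \<Longrightarrow> holds c d \<rho> (succ s x) \<longleftrightarrow> \<rho> s = suc (\<rho> x)"
  by (simp add: succ_def hold_simps holds ext_iff[of _ "suc _"])

lemma holds_is_inductive [holds]:
  "w < d \<Longrightarrow> holds c d \<rho> (is_inductive w) \<longleftrightarrow> indset (\<rho> w)"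
  by (simp add: is_inductive_def indset_def hold_simps holds)

lemma holds_opair [holds]:
  "p < d \<Longrightarrow> x < d \<Longrightarrow> y < d \<Longrightarrow> holds c d \<rho> (opair p x y) \<longleftrightarrow> \<rho> p = pr (\<rho> x) (\<rho> y)"
proof -
  have "p = pr x y \<longleftrightarrow> (\<forall>u. u \<epsilon> p \<longleftrightarrow> (\<forall>z. z \<epsilon> u \<longleftrightarrow> z = x) \<or> (\<forall>z. z \<epsilon> u \<longleftrightarrow> z = x \<or> z = y))"
    for p x y
    by (simp add: pr_def ext_iff[of _ "upair _ _"])
  then show "p < d \<Longrightarrow> x < d \<Longrightarrow> y < d \<Longrightarrow> ?thesis"
    by (simp add: opair_def hold_simps holds)
qed

lemma holds_rel [holds]:
  "r < d \<Longrightarrow> x < d \<Longrightarrow> y < d \<Longrightarrow> holds c d \<rho> (rel r x y) \<longleftrightarrow> pr (\<rho> x) (\<rho> y) \<epsilon> \<rho> r"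
  by (simp add: rel_def hold_simps holds)

lemma holds_rel2 [holds]:
  "f < d \<Longrightarrow> x < d \<Longrightarrow> y < d \<Longrightarrow> z < d \<Longrightarrow>
    holds c d \<rho> (rel2 f x y z) \<longleftrightarrow> pr (pr (\<rho> x) (\<rho> y)) (\<rho> z) \<epsilon> \<rho> f"
  by (simp add: rel2_def hold_simps holds)

lemma holds_function_on [holds]:
  "f < d \<Longrightarrow> a < d \<Longrightarrow> holds c d \<rho> (function_on f a) \<longleftrightarrow> fnc (\<rho> f) (\<rho> a)"
  by (simp add: function_on_def fnc_def ex1_def Ex1_def hold_simps holds)

lemma holds_maps [holds]:
  "f < d \<Longrightarrow> a < d \<Longrightarrow> b < d \<Longrightarrow> holds c d \<rho> (maps f a b) \<longleftrightarrow> maps_to (\<rho> f) (\<rho> a) (\<rho> b)"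
  by (simp add: maps_def maps_to_def hold_simps holds)

lemma holds_bijection [holds]:
  "f < d \<Longrightarrow> a < d \<Longrightarrow> b < d \<Longrightarrow> holds c d \<rho> (bijection f a b) \<longleftrightarrow> biject (\<rho> f) (\<rho> a) (\<rho> b)"
  by (simp add: bijection_def biject_def ex1_def Ex1_def hold_simps holds)

lemma holds_equipotent [holds]:
  "a < d \<Longrightarrow> b < d \<Longrightarrow> holds c d \<rho> (equipotent a b) \<longleftrightarrow> equip (\<rho> a) (\<rho> b)"
  by (simp add: equipotent_def equip_def hold_simps holds)

lemma holds_omega [holds]: "w < d \<Longrightarrow> holds c d \<rho> (omega w) \<longleftrightarrow> \<rho> w = om"
proof -
  have "w = om \<longleftrightarrow> indset w \<and> (\<forall>v. indset v \<longrightarrow> w \<sqsubseteq> v)" for w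
    unfolding sub_def ext_iff[of w om] om_iff by (auto simp: indset_def)
  then show "w < d \<Longrightarrow> ?thesis" by (simp add: omega_def hold_simps holds)
qed

lemma holds_finite_set [holds]: "a < d \<Longrightarrow> holds c d \<rho> (finite_set a) \<longleftrightarrow> fin (\<rho> a)"
  by (simp add: finite_set_def fin_def hold_simps holds)

lemma holds_countable_set [holds]: "a < d \<Longrightarrow> holds c d \<rho> (countable_set a) \<longleftrightarrow> ctb (\<rho> a)"
  by (simp add: countable_set_def ctb_def hold_simps holds)

lemma holds_CMC [holds]: "holds c d \<rho> CMC \<longleftrightarrow> model_CMC"
  by (simp add: CMC_def denumerable_def multiple_choice_function_def model_CMC_def choice_fn_def
      hold_simps holds)

lemma holds_is_Union [holds]:
  "s < d \<Longrightarrow> U < d \<Longrightarrow> holds c d \<rho> (is_Union s U) \<longleftrightarrow> union_of (\<rho> s) (\<rho> U)"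
  by (simp add: is_Union_def union_of_def hold_simps holds)

lemma holds_is_Inter [holds]:
  "s < d \<Longrightarrow> U < d \<Longrightarrow> holds c d \<rho> (is_Inter s U) \<longleftrightarrow> inter_of (\<rho> s) (\<rho> U)"
  by (simp add: is_Inter_def inter_of_def hold_simps holds)

lemma holds_topology [holds]:
  "X < d \<Longrightarrow> T < d \<Longrightarrow> holds c d \<rho> (topology X T) \<longleftrightarrow> top_on (\<rho> X) (\<rho> T)"
  by (simp add: topology_def top_on_def hold_simps holds)

lemma holds_clopen [holds]:
  "X < d \<Longrightarrow> T < d \<Longrightarrow> u < d \<Longrightarrow> holds c d \<rho> (clopen X T u) \<longleftrightarrow> clop (\<rho> X) (\<rho> T) (\<rho> u)"
  by (simp add: clopen_def clop_def hold_simps holds)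

lemma holds_CO_delta [holds]:
  "X < d \<Longrightarrow> T < d \<Longrightarrow> s < d \<Longrightarrow>
    holds c d \<rho> (CO_delta X T s) \<longleftrightarrow> cinter (clop (\<rho> X) (\<rho> T)) (\<rho> s)"
  by (simp add: CO_delta_def countable_Inter_of_def cinter_def hold_simps holds)

lemma holds_G_delta [holds]:
  "T < d \<Longrightarrow> s < d \<Longrightarrow> holds c d \<rho> (G_delta T s) \<longleftrightarrow> cinter (\<lambda>u. u \<epsilon> \<rho> T) (\<rho> s)"
  by (simp add: G_delta_def countable_Inter_of_def cinter_def hold_simps holds)

lemma holds_operation [holds]:
  "f < d \<Longrightarrow> R < d \<Longrightarrow> holds c d \<rho> (operation f R) \<longleftrightarrow> maps_to (\<rho> f) (prd (\<rho> R) (\<rho> R)) (\<rho> R)"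
proof -
  have "(\<forall>p. p \<epsilon> P \<longleftrightarrow> (\<exists>x. x \<epsilon> R \<and> (\<exists>y. y \<epsilon> R \<and> p = pr x y))) \<longleftrightarrow> P = prd R R" for P R
    unfolding ext_iff[of P "prd R R"] by auto
  then show "f < d \<Longrightarrow> R < d \<Longrightarrow> ?thesis"
    by (simp add: operation_def hold_simps holds)
qed

lemma holds_assoc_comm_unit [holds]:
  "R < d \<Longrightarrow> f < d \<Longrightarrow> e < d \<Longrightarrow> holds c d \<rho> (assoc_comm_unit R f e) \<longleftrightarrow> acu (\<rho> R) (\<rho> f) (\<rho> e)"
  by (simp add: assoc_comm_unit_def acu_def hold_simps holds)

lemma holds_field [holds]:
  "R < d \<Longrightarrow> zero < d \<Longrightarrow> one < d \<Longrightarrow> add < d \<Longrightarrow> mul < d \<Longrightarrow>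
    holds c d \<rho> (field R zero one add mul) \<longleftrightarrow> fld (\<rho> R) (\<rho> zero) (\<rho> one) (\<rho> add) (\<rho> mul)"
  by (simp add: field_def fld_def hold_simps holds)

lemma holds_strict_linear_order [holds]:
  "R < d \<Longrightarrow> lt < d \<Longrightarrow> holds c d \<rho> (strict_linear_order R lt) \<longleftrightarrow> slo (\<rho> R) (\<rho> lt)"
  by (simp add: strict_linear_order_def slo_def hold_simps holds)

lemma holds_ordered_field [holds]:
  "R < d \<Longrightarrow> zero < d \<Longrightarrow> one < d \<Longrightarrow> add < d \<Longrightarrow> mul < d \<Longrightarrow> lt < d \<Longrightarrow>
    holds c d \<rho> (ordered_field R zero one add mul lt) \<longleftrightarrow>
    ofld (\<rho> R) (\<rho> zero) (\<rho> one) (\<rho> add) (\<rho> mul) (\<rho> lt)"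
  by (simp add: ordered_field_def ofld_def hold_simps holds)

lemma holds_upper_bound [holds]:
  "lt < d \<Longrightarrow> S < d \<Longrightarrow> b < d \<Longrightarrow> holds c d \<rho> (upper_bound lt S b) \<longleftrightarrow> ubound (\<rho> lt) (\<rho> S) (\<rho> b)"
  by (simp add: upper_bound_def ubound_def hold_simps holds)

lemma holds_complete_order [holds]:
  "R < d \<Longrightarrow> lt < d \<Longrightarrow> holds c d \<rho> (complete_order R lt) \<longleftrightarrow> complete (\<rho> R) (\<rho> lt)"
  by (simp add: complete_order_def complete_def hold_simps holds)

lemma holds_reals [holds]:
  "R < d \<Longrightarrow> zero < d \<Longrightarrow> one < d \<Longrightarrow> add < d \<Longrightarrow> mul < d \<Longrightarrow> lt < d \<Longrightarrow>
    holds c d \<rho> (reals R zero one add mul lt) \<longleftrightarrow>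
    is_reals (\<rho> R) (\<rho> zero) (\<rho> one) (\<rho> add) (\<rho> mul) (\<rho> lt)"
  by (simp add: reals_def is_reals_def hold_simps holds)

lemma holds_real_open [holds]:
  "R < d \<Longrightarrow> lt < d \<Longrightarrow> V < d \<Longrightarrow> holds c d \<rho> (real_open R lt V) \<longleftrightarrow> ropen (\<rho> R) (\<rho> lt) (\<rho> V)"
  by (simp add: real_open_def ropen_def hold_simps holds)

lemma holds_continuous_real [holds]:
  "X < d \<Longrightarrow> T < d \<Longrightarrow> R < d \<Longrightarrow> lt < d \<Longrightarrow> f < d \<Longrightarrow>
    holds c d \<rho> (continuous_real X T R lt f) \<longleftrightarrow> cont (\<rho> X) (\<rho> T) (\<rho> R) (\<rho> lt) (\<rho> f)"
  by (simp add: continuous_real_def cont_def hold_simps holds)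

lemma holds_zero_set [holds]:
  "X < d \<Longrightarrow> T < d \<Longrightarrow> R < d \<Longrightarrow> zero < d \<Longrightarrow> lt < d \<Longrightarrow> s < d \<Longrightarrow>
    holds c d \<rho> (zero_set X T R zero lt s) \<longleftrightarrow> zset (\<rho> X) (\<rho> T) (\<rho> R) (\<rho> zero) (\<rho> lt) (\<rho> s)"
  by (simp add: zero_set_def zset_def hold_simps holds)

lemma holds_families_stable [holds]: "holds c d \<rho> families_stable \<longleftrightarrow> model_stable"
  by (simp add: families_stable_def model_stable_def stable_under_countable_Inter_def stable_def
      hold_simps holds)

lemma holds_delta_is_P_space [holds]: "holds c d \<rho> delta_is_P_space \<longleftrightarrow> model_pspace"
  by (simp add: delta_is_P_space_def model_pspace_def delta_topology_def dtop_def P_space_def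
      pspace_def hold_simps holds)

section \<open>Finite and countable sets, multiple choice\<close>

lemma equipI:
  assumes G: "dfnT (\<lambda>e. G (e 0))"
    and "\<And>x. x \<epsilon> a \<Longrightarrow> G x \<epsilon> b" "\<And>y. y \<epsilon> b \<Longrightarrow> \<exists>x. x \<epsilon> a \<and> y = G x"
    and "\<And>x x'. x \<epsilon> a \<Longrightarrow> x' \<epsilon> a \<Longrightarrow> G x = G x' \<Longrightarrow> x = x'"
  shows "equip a b"
proof -
  have "biject (mkfun a G) a b"
    unfolding biject_def maps_to_def mkfun_iff[OF G]
  proof (intro conjI allI impI)
    show "fnc (mkfun a G) a" by (rule fnc_mkfun[OF G])
    fix x y assume "\<exists>z. z \<epsilon> a \<and> pr x y = pr z (G z)"
    then show "y \<epsilon> b" using assms(2) by auto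
  next
    fix y assume "y \<epsilon> b"
    then obtain x where "x \<epsilon> a" "y = G x" using assms(3) by blast
    then show "\<exists>!x. \<exists>z. z \<epsilon> a \<and> pr x y = pr z (G z)"
      by (intro ex1I[of _ x]) (auto intro: assms(4))
  qed
  then show ?thesis unfolding equip_def by (rule exI)
qed

lemma equipE:
  assumes "equip a b"
  obtains f where "\<And>x. x \<epsilon> a \<Longrightarrow> ap f x \<epsilon> b" "\<And>y. y \<epsilon> b \<Longrightarrow> \<exists>x. x \<epsilon> a \<and> ap f x = y"
    "\<And>x x'. x \<epsilon> a \<Longrightarrow> x' \<epsilon> a \<Longrightarrow> ap f x = ap f x' \<Longrightarrow> x = x'"
proof -
  obtain f where f: "biject f a b" using assms by (auto simp: equip_def)
  then have fn: "fnc f a" by (simp add: biject_def maps_to_def)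
  have b: "ap f x \<epsilon> b" if "x \<epsilon> a" for x
    using f that unfolding biject_def maps_to_def fnc_pr_iff[OF fn] by blast
  have ex1: "\<exists>!x. x \<epsilon> a \<and> y = ap f x" if "y \<epsilon> b" for y
    using f that unfolding biject_def fnc_pr_iff[OF fn] by blast
  show thesis
  proof (rule that[of f])
    show "\<exists>x. x \<epsilon> a \<and> ap f x = y" if "y \<epsilon> b" for y
      using ex1[OF that] by blast
    show "x = x'" if "x \<epsilon> a" "x' \<epsilon> a" "ap f x = ap f x'" for x x'
      using ex1[OF b[OF that(1)]] that by blast
  qed (rule b)
qed

lemma fin_om: "n \<epsilon> om \<Longrightarrow> fin n"
proof -
  have "equip n n" by (rule equipI[where G = "\<lambda>x. x", OF dfnT_var]) auto
  then show "n \<epsilon> om \<Longrightarrow> fin n" by (auto simp: fin_def)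
qed

lemma fin_inj_image:
  assumes a: "fin a" and G: "dfnT (\<lambda>e. G (e 0))"
    and inj: "\<And>x x'. x \<epsilon> a \<Longrightarrow> x' \<epsilon> a \<Longrightarrow> G x = G x' \<Longrightarrow> x = x'"
    and b: "\<And>y. y \<epsilon> b \<longleftrightarrow> (\<exists>x. x \<epsilon> a \<and> y = G x)"
  shows "fin b"
proof -
  obtain n f where n: "n \<epsilon> om" and f: "\<And>x. x \<epsilon> a \<Longrightarrow> ap f x \<epsilon> n"
    "\<And>y. y \<epsilon> n \<Longrightarrow> \<exists>x. x \<epsilon> a \<and> ap f x = y"
    "\<And>x x'. x \<epsilon> a \<Longrightarrow> x' \<epsilon> a \<Longrightarrow> ap f x = ap f x' \<Longrightarrow> x = x'"
    using a equipE unfolding fin_def by metis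
  note [dfn] = dfnT_app1[OF G]
  define H where "H y = the1 (\<lambda>k. \<exists>x. x \<epsilon> a \<and> y = G x \<and> k = ap f x)" for y
  have H: "H (G x) = ap f x" if "x \<epsilon> a" for x
    unfolding H_def by (rule the1_equality) (use that inj in blast)+
  have "equip b n"
  proof (rule equipI[where G = H])
    show "dfnT (\<lambda>e. H (e 0))" unfolding H_def by (intro dfn)
    show "H y \<epsilon> n" if "y \<epsilon> b" for y using that b f(1) H by auto
    show "\<exists>x. x \<epsilon> b \<and> y = H x" if "y \<epsilon> n" for y using f(2)[OF that] b H by metis
    show "y = y'" if "y \<epsilon> b" "y' \<epsilon> b" "H y = H y'" for y y'
    proof -
      obtain x x' where "x \<epsilon> a" "y = G x" "x' \<epsilon> a" "y' = G x'" using \<open>y \<epsilon> b\<close> \<open>y' \<epsilon> b\<close> b by auto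
      then show ?thesis using that(3) H f(3) by metis
    qed
  qed
  then show ?thesis using n by (auto simp: fin_def)
qed

text \<open>An enumeration may repeat. Sending each member to its least index turns it into an
  injection definably, without choice.\<close>

lemma ctbI:
  assumes G: "dfnT (\<lambda>e. G (e 0))" and a: "\<And>y. y \<epsilon> a \<longleftrightarrow> (\<exists>n. n \<epsilon> om \<and> y = G n)"
  shows "ctb a"
proof -
  note [dfn] = dfnT_app1[OF G]
  define H where "H y = the1 (\<lambda>n. n \<epsilon> om \<and> y = G n \<and> (\<forall>k. k \<epsilon> n \<longrightarrow> y \<noteq> G k))" for y
  have dH: "dfnT (\<lambda>e. H (e 0))" unfolding H_def by (intro dfn)
  have H: "H y \<epsilon> om \<and> y = G (H y)" if y: "y \<epsilon> a" for y
  proof -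
    obtain n where n: "n \<epsilon> om" "y = G n" using y a[of y] by auto
    have "dfn (\<lambda>e. y = G (e 0))" by (intro dfn)
    from the1I[OF least_om[of "\<lambda>n. y = G n", OF this n]] show ?thesis
      unfolding H_def by iprover
  qed
  obtain b where b: "\<And>n. n \<epsilon> b \<longleftrightarrow> (\<exists>y. y \<epsilon> a \<and> n = H y)"
    using isset_repl[OF dH, of a] by (auto simp: isset_def)
  have "equip a b"
  proof (rule equipI[OF dH])
    show "H y \<epsilon> b" if "y \<epsilon> a" for y using that b by auto
    show "\<exists>y. y \<epsilon> a \<and> n = H y" if "n \<epsilon> b" for n using that b by blast
    show "y = y'" if "y \<epsilon> a" "y' \<epsilon> a" "H y = H y'" for y y'
      using H[OF that(1)] H[OF that(2)] that(3) by simp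
  qed
  moreover have "b \<sqsubseteq> om" using b H by (auto simp: sub_def)
  ultimately show ?thesis by (auto simp: ctb_def)
qed

text \<open>Later arguments use sequences indexed by all of \<open>om\<close>. Indices that number
  no member receive the fixed member \<open>z\<close>, which is why \<open>a\<close> has to be
  inhabited.\<close>

lemma ctbE:
  assumes "ctb a" "inhab a"
  obtains f where "\<And>y. y \<epsilon> a \<longleftrightarrow> (\<exists>n. n \<epsilon> om \<and> y = ap f n)"
proof -
  obtain z where z: "z \<epsilon> a" using assms(2) by (auto simp: inhab_def)
  obtain b g where b: "b \<sqsubseteq> om" and g: "\<And>x. x \<epsilon> a \<Longrightarrow> ap g x \<epsilon> b"
    "\<And>x x'. x \<epsilon> a \<Longrightarrow> x' \<epsilon> a \<Longrightarrow> ap g x = ap g x' \<Longrightarrow> x = x'"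
    using assms(1) equipE unfolding ctb_def by metis
  define G where "G n = (if \<exists>y. y \<epsilon> a \<and> ap g y = n then the1 (\<lambda>y. y \<epsilon> a \<and> ap g y = n) else z)" for n
  have dG: "dfnT (\<lambda>e. G (e 0))" unfolding G_def by (intro dfn)
  have G: "G (ap g y) = y" if "y \<epsilon> a" for y
  proof -
    have "the1 (\<lambda>y'. y' \<epsilon> a \<and> ap g y' = ap g y) = y"
      by (rule the1_equality) (use that g(2) in blast)+
    then show ?thesis using that by (auto simp: G_def)
  qed
  have Ga: "G n \<epsilon> a" for n
  proof (cases "\<exists>y. y \<epsilon> a \<and> ap g y = n")
    case True
    then show ?thesis using G by metis
  next
    case False
    then have "G n = z" unfolding G_def by (rule if_not_P)
    then show ?thesis using z by simp
  qed
  have "y \<epsilon> a \<longleftrightarrow> (\<exists>n. n \<epsilon> om \<and> y = ap (mkfun om G) n)" for y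
  proof
    assume y: "y \<epsilon> a"
    then have "ap g y \<epsilon> om" using g(1) b by (auto simp: sub_def)
    then show "\<exists>n. n \<epsilon> om \<and> y = ap (mkfun om G) n"
      using G[OF y] ap_mkfun[OF dG] by metis
  qed (use Ga ap_mkfun[OF dG] in auto)
  then show thesis by (rule that)
qed

lemma no_inj_om:
  assumes "n \<epsilon> om"
  shows "\<not> (\<exists>f. (\<forall>i. i \<epsilon> om \<longrightarrow> ap f i \<epsilon> n) \<and>
    (\<forall>i j. i \<epsilon> om \<longrightarrow> j \<epsilon> om \<longrightarrow> ap f i = ap f j \<longrightarrow> i = j))"
  using assms
proof (induction rule: om_induct)
  case def
  show ?case by (intro dfn)
next
  case 0
  show ?case using om_0 emp_iff by blast
next
  case (suc n)
  show ?case
  proof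
    assume "\<exists>f. (\<forall>i. i \<epsilon> om \<longrightarrow> ap f i \<epsilon> suc n) \<and>
      (\<forall>i j. i \<epsilon> om \<longrightarrow> j \<epsilon> om \<longrightarrow> ap f i = ap f j \<longrightarrow> i = j)"
    then obtain f where f: "\<And>i. i \<epsilon> om \<Longrightarrow> ap f i \<epsilon> n \<or> ap f i = n"
      and inj: "\<And>i j. i \<epsilon> om \<Longrightarrow> j \<epsilon> om \<Longrightarrow> ap f i = ap f j \<Longrightarrow> i = j" by auto
    \<comment> \<open>The argument \<open>emp\<close> is dropped and its value handed to the
      argument that was sent to \<open>n\<close>. By injectivity at most one argument has the value
      \<open>n\<close>, so all values of \<open>G\<close> lie in \<open>n\<close> and remain
      distinct.\<close>
    define G where "G i = (if ap f (suc i) = n then ap f emp else ap f (suc i))" for i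
    have dG: "dfnT (\<lambda>e. G (e 0))" unfolding G_def by (intro dfn)
    have "ap (mkfun om G) i \<epsilon> n" if "i \<epsilon> om" for i
      unfolding ap_mkfun[OF dG that] G_def
      using f[of "suc i"] f[of emp] inj[of emp "suc i"] that suc_not_emp[of i] by auto
    moreover have "i = j" if "i \<epsilon> om" "j \<epsilon> om" "ap (mkfun om G) i = ap (mkfun om G) j" for i j
      using that(3) inj[of "suc i" "suc j"] inj[of emp "suc j"] inj[of emp "suc i"]
        suc_not_emp[of i] suc_not_emp[of j] that(1,2)
      unfolding ap_mkfun[OF dG that(1)] ap_mkfun[OF dG that(2)] G_def
      by (auto simp: suc_inject split: if_splits)
    ultimately show False using suc.IH by blast
  qed
qed

lemma dfnT_prd [dfn]: "dfnT s \<Longrightarrow> dfnT t \<Longrightarrow> dfnT (\<lambda>e. prd (s e) (t e))"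
  by (rule dfnT_app2) (unfold prd_def, intro dfn)

text \<open>The sets \<open>X n \<times> {n}\<close> are pairwise different, hence form a denumerable family even if the
  \<open>X n\<close> repeat.\<close>

lemma CMC_sequence:
  assumes CMC: model_CMC and dX: "dfnT (\<lambda>e. X (e 0))" and X: "\<And>n. n \<epsilon> om \<Longrightarrow> inhab (X n)"
  obtains F where "\<And>n. n \<epsilon> om \<Longrightarrow> inhab (ap F n) \<and> fin (ap F n) \<and> ap F n \<sqsubseteq> X n"
proof -
  note [dfn] = dfnT_app1[OF dX]
  define A where "A n = prd (X n) (upair n n)" for n
  have dA: "dfnT (\<lambda>e. A (e 0))" unfolding A_def by (intro dfn)
  note [dfn] = dfnT_app1[OF dA]
  have A: "p \<epsilon> A n \<longleftrightarrow> (\<exists>x. x \<epsilon> X n \<and> p = pr x n)" for p n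
    by (auto simp: A_def)
  have Ai: "inhab (A n)" if "n \<epsilon> om" for n using X[OF that] A by (auto simp: inhab_def)
  have A_inj: "m = n" if mn: "m \<epsilon> om" "A m = A n" for m n
  proof -
    obtain p where "p \<epsilon> A m" using Ai[OF mn(1)] by (auto simp: inhab_def)
    moreover from this have "p \<epsilon> A n" using mn(2) by simp
    ultimately show ?thesis using A by auto
  qed
  obtain a where a: "\<And>y. y \<epsilon> a \<longleftrightarrow> (\<exists>n. n \<epsilon> om \<and> y = A n)"
    using isset_repl[OF dA, of om] by (auto simp: isset_def)
  have "ctb a" by (rule ctbI[OF dA a])
  \<comment> \<open>An injection of the family into a natural number, composed with the injective
    sequence \<open>A\<close>, would contradict \<open>no_inj_om\<close>.\<close>
  moreover have "\<not> fin a"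
  proof
    assume "fin a"
    then obtain m h where m: "m \<epsilon> om" and h: "\<And>x. x \<epsilon> a \<Longrightarrow> ap h x \<epsilon> m"
      "\<And>x x'. x \<epsilon> a \<Longrightarrow> x' \<epsilon> a \<Longrightarrow> ap h x = ap h x' \<Longrightarrow> x = x'"
      using equipE unfolding fin_def by metis
    have dG: "dfnT (\<lambda>e. ap h (A (e 0)))" by (intro dfn)
    have "ap (mkfun om (\<lambda>n. ap h (A n))) i \<epsilon> m" if "i \<epsilon> om" for i
      unfolding ap_mkfun[OF dG that] using h(1) a that by blast
    moreover have "i = j" if "i \<epsilon> om" "j \<epsilon> om"
      "ap (mkfun om (\<lambda>n. ap h (A n))) i = ap (mkfun om (\<lambda>n. ap h (A n))) j" for i j
      using that h(2) a A_inj unfolding ap_mkfun[OF dG that(1)] ap_mkfun[OF dG that(2)] by metis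
    ultimately show False using no_inj_om[OF m] by blast
  qed
  moreover have "\<forall>x. x \<epsilon> a \<longrightarrow> inhab x" using a Ai by auto
  ultimately obtain c where c: "choice_fn c a" using CMC by (auto simp: model_CMC_def)
  then have cf: "fnc c a" by (simp add: choice_fn_def)
  have cA: "inhab (ap c (A n)) \<and> fin (ap c (A n)) \<and> ap c (A n) \<sqsubseteq> A n" if "n \<epsilon> om" for n
    using c that a unfolding choice_fn_def fnc_pr_iff[OF cf] by blast
  \<comment> \<open>The tag \<open>n\<close> is stripped from the chosen pairs. All pairs in
    question carry the same tag, so stripping is injective and keeps the set finite.\<close>
  define F where "F n = mk (\<lambda>x. pr x n \<epsilon> ap c (A n))" for n
  have dF: "dfnT (\<lambda>e. F (e 0))" unfolding F_def by (intro dfn)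
  have F: "x \<epsilon> F n \<longleftrightarrow> pr x n \<epsilon> ap c (A n)" if n: "n \<epsilon> om" for x n
    unfolding F_def
  proof (rule mk_iff, rule isset_subset)
    show "dfn (\<lambda>e. pr (e 0) n \<epsilon> ap c (A n))" by (intro dfn)
    show "x \<epsilon> X n" if "pr x n \<epsilon> ap c (A n)" for x
      using cA[OF n] that A[of "pr x n" n] by (auto simp: sub_def)
  qed
  have "inhab (F n) \<and> fin (F n) \<and> F n \<sqsubseteq> X n" if n: "n \<epsilon> om" for n
  proof (intro conjI)
    have p: "\<exists>x. p = pr x n \<and> x \<epsilon> X n" if "p \<epsilon> ap c (A n)" for p
      using cA[OF n] that A by (auto simp: sub_def)
    show "inhab (F n)" using cA[OF n] F[OF n] p unfolding inhab_def by metis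
    show "F n \<sqsubseteq> X n" unfolding sub_def F[OF n] using p by (metis pr_inject)
    define G where "G p = the1 (\<lambda>x. p = pr x n)" for p
    have G: "G (pr x n) = x" for x unfolding G_def by (rule the1_equality) auto
    have dG: "dfnT (\<lambda>e. G (e 0))" unfolding G_def by (intro dfn)
    have "fin (ap c (A n))" using cA[OF n] by blast
    then show "fin (F n)"
    proof (rule fin_inj_image[OF _ dG])
      show "q = q'" if "q \<epsilon> ap c (A n)" "q' \<epsilon> ap c (A n)" "G q = G q'" for q q'
        using p[OF that(1)] p[OF that(2)] that(3) G by auto
      show "y \<epsilon> F n \<longleftrightarrow> (\<exists>x. x \<epsilon> ap c (A n) \<and> y = G x)" for y
        using F[OF n] p G by metis
    qed
  qed
  then show thesis using that[of "mkfun om F"] ap_mkfun[OF dF] by simp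
qed

section \<open>Stability of countable intersections under multiple choice\<close>

definition traced where
  "traced P X \<phi> \<longleftrightarrow> (\<exists>s. P s \<and> (\<forall>x. x \<epsilon> s \<longleftrightarrow> x \<epsilon> X \<and> \<phi> x))"

definition inter_closed where
  "inter_closed P \<longleftrightarrow> (\<forall>u v. P u \<longrightarrow> P v \<longrightarrow> (\<exists>s. P s \<and> (\<forall>x. x \<epsilon> s \<longleftrightarrow> x \<epsilon> u \<and> x \<epsilon> v)))"

lemma traced_fin_all:
  assumes P: "dfn (\<lambda>e. P (e 0))" "inter_closed P" "P X"
    and \<phi>: "dfn (\<lambda>e. \<phi> (e 0) (e (Suc 0)))"
    and A: "fin A" "\<And>a. a \<epsilon> A \<Longrightarrow> traced P X (\<phi> a)"
  shows "traced P X (\<lambda>x. \<forall>a. a \<epsilon> A \<longrightarrow> \<phi> a x)"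
proof -
  note [dfn] = dfn_app1[OF P(1)] dfn_app2[OF \<phi>]
  obtain n f where n: "n \<epsilon> om" and f: "\<And>x. x \<epsilon> A \<Longrightarrow> ap f x \<epsilon> n"
    "\<And>x x'. x \<epsilon> A \<Longrightarrow> x' \<epsilon> A \<Longrightarrow> ap f x = ap f x' \<Longrightarrow> x = x'"
    using A(1) equipE unfolding fin_def by metis
  from n have "traced P X (\<lambda>x. \<forall>a. a \<epsilon> A \<longrightarrow> ap f a \<epsilon> n \<longrightarrow> \<phi> a x)"
  proof (induction rule: om_induct)
    case def
    show ?case unfolding traced_def by (intro dfn)
  next
    case 0
    show ?case unfolding traced_def by (rule exI[of _ X]) (simp add: P(3))
  next
    case (suc m)
    then obtain s where s: "P s" "\<And>x. x \<epsilon> s \<longleftrightarrow> x \<epsilon> X \<and> (\<forall>a. a \<epsilon> A \<longrightarrow> ap f a \<epsilon> m \<longrightarrow> \<phi> a x)"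
      by (auto simp: traced_def)
    show ?case
    proof (cases "\<exists>a. a \<epsilon> A \<and> ap f a = m")
      case False
      then show ?thesis using s unfolding traced_def by (intro exI[of _ s]) auto
    next
      case True
      then obtain a where a: "a \<epsilon> A" "ap f a = m" by blast
      obtain v where v: "P v" "\<And>x. x \<epsilon> v \<longleftrightarrow> x \<epsilon> X \<and> \<phi> a x"
        using A(2)[OF a(1)] by (auto simp: traced_def)
      obtain t where t: "P t" "\<And>x. x \<epsilon> t \<longleftrightarrow> x \<epsilon> s \<and> x \<epsilon> v"
        using P(2) s(1) v(1) unfolding inter_closed_def by blast
      have "b = a" if "b \<epsilon> A" "ap f b = m" for b using f(2) a that by simp
      then have "x \<epsilon> t \<longleftrightarrow> x \<epsilon> X \<and> (\<forall>a. a \<epsilon> A \<longrightarrow> ap f a \<epsilon> suc m \<longrightarrow> \<phi> a x)" for x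
        unfolding t(2) s(2) v(2) suc_iff using a by blast
      then show ?thesis using t(1) unfolding traced_def by blast
    qed
  qed
  then show ?thesis using f(1) by (simp add: traced_def)
qed

text \<open>In the sequence form a witness is one element of the model, so all witnesses for a given
  set can be gathered into a set to which multiple choice applies. It also makes definability
  evident.\<close>

lemma cinter_iff:
  assumes P: "dfn (\<lambda>e. P (e 0))"
  shows "cinter P s \<longleftrightarrow> (\<exists>W. (\<forall>i. i \<epsilon> om \<longrightarrow> P (ap W i)) \<and>
    (\<forall>x. x \<epsilon> s \<longleftrightarrow> (\<forall>i. i \<epsilon> om \<longrightarrow> x \<epsilon> ap W i)))"
proof
  assume "cinter P s"
  then obtain U where U: "inhab U" "ctb U" "\<And>u. u \<epsilon> U \<Longrightarrow> P u"
    "\<And>x. x \<epsilon> s \<longleftrightarrow> (\<forall>u. u \<epsilon> U \<longrightarrow> x \<epsilon> u)"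
    unfolding cinter_def inter_of_def by blast
  obtain W where W: "\<And>u. u \<epsilon> U \<longleftrightarrow> (\<exists>n. n \<epsilon> om \<and> u = ap W n)"
    by (rule ctbE[OF U(2,1)], rule that)
  have "P (ap W i)" if "i \<epsilon> om" for i
    using that by (intro U(3)) (auto simp: W)
  moreover have "x \<epsilon> s \<longleftrightarrow> (\<forall>i. i \<epsilon> om \<longrightarrow> x \<epsilon> ap W i)" for x
    by (auto simp: U(4) W)
  ultimately show "\<exists>W. (\<forall>i. i \<epsilon> om \<longrightarrow> P (ap W i)) \<and>
    (\<forall>x. x \<epsilon> s \<longleftrightarrow> (\<forall>i. i \<epsilon> om \<longrightarrow> x \<epsilon> ap W i))"
    by blast
next
  assume "\<exists>W. (\<forall>i. i \<epsilon> om \<longrightarrow> P (ap W i)) \<and>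
    (\<forall>x. x \<epsilon> s \<longleftrightarrow> (\<forall>i. i \<epsilon> om \<longrightarrow> x \<epsilon> ap W i))"
  then obtain W where W: "\<And>i. i \<epsilon> om \<Longrightarrow> P (ap W i)"
    "\<And>x. x \<epsilon> s \<longleftrightarrow> (\<forall>i. i \<epsilon> om \<longrightarrow> x \<epsilon> ap W i)" by blast
  have dW: "dfnT (\<lambda>e. ap W (e 0))" by (intro dfn)
  obtain U where U: "\<And>u. u \<epsilon> U \<longleftrightarrow> (\<exists>n. n \<epsilon> om \<and> u = ap W n)"
    using isset_repl[OF dW, of om] by (auto simp: isset_def)
  have "ctb U" by (rule ctbI[OF dW U])
  moreover have "inhab U" unfolding inhab_def U using om_0 by blast
  ultimately show "cinter P s"
    unfolding cinter_def inter_of_def by (intro exI[of _ U]) (use U W in auto)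
qed

lemma stable_cinter:
  assumes CMC: model_CMC and P: "dfn (\<lambda>e. P (e 0))" "inter_closed P" "P X"
    and X: "\<And>u. P u \<Longrightarrow> u \<sqsubseteq> X"
  shows "stable (cinter P)"
  unfolding stable_def
proof (intro allI impI, elim conjE)
  note [dfn] = dfn_app1[OF P(1)]
  fix U assume U: "inhab U" "ctb U" "\<forall>u. u \<epsilon> U \<longrightarrow> cinter P u"
  obtain f where f: "\<And>u. u \<epsilon> U \<longleftrightarrow> (\<exists>n. n \<epsilon> om \<and> u = ap f n)"
    by (rule ctbE[OF U(2,1)], rule that)
  \<comment> \<open>\<open>ap\<close> ignores irrelevant members of \<open>W\<close>, so the
    unrestricted collection of witnesses need not be a set. The power set bound makes it
    one.\<close>
  define Y where "Y n = mk (\<lambda>W. W \<epsilon> pow (prd om (pow X)) \<and> (\<forall>i. i \<epsilon> om \<longrightarrow> P (ap W i)) \<and>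
    (\<forall>x. x \<epsilon> ap f n \<longleftrightarrow> (\<forall>i. i \<epsilon> om \<longrightarrow> x \<epsilon> ap W i)))" for n
  have dY: "dfnT (\<lambda>e. Y (e 0))" unfolding Y_def by (intro dfn)
  have Y: "W \<epsilon> Y n \<longleftrightarrow> W \<epsilon> pow (prd om (pow X)) \<and> (\<forall>i. i \<epsilon> om \<longrightarrow> P (ap W i)) \<and>
    (\<forall>x. x \<epsilon> ap f n \<longleftrightarrow> (\<forall>i. i \<epsilon> om \<longrightarrow> x \<epsilon> ap W i))" for W n
    unfolding Y_def by (rule mk_iff, rule isset_sep) (intro dfn)
  have "inhab (Y n)" if n: "n \<epsilon> om" for n
  proof -
    obtain W where W: "\<And>i. i \<epsilon> om \<Longrightarrow> P (ap W i)"
      "\<And>x. x \<epsilon> ap f n \<longleftrightarrow> (\<forall>i. i \<epsilon> om \<longrightarrow> x \<epsilon> ap W i)"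
    proof -
      have "ap f n \<epsilon> U" using f n by auto
      then have "cinter P (ap f n)" using U(3) by blast
      then show thesis using that unfolding cinter_iff[OF P(1)] by blast
    qed
    have dW: "dfnT (\<lambda>e. ap W (e 0))" by (intro dfn)
    \<comment> \<open>An arbitrary witness is replaced by its restriction to \<open>om\<close>,
      which has the same values there and lies within the bound.\<close>
    have "mkfun om (ap W) \<epsilon> Y n"
      unfolding Y pow_iff prd_iff mkfun_iff[OF dW]
      using X W by (auto simp: ap_mkfun[OF dW] sub_def)
    then show ?thesis by (auto simp: inhab_def)
  qed
  from CMC_sequence[OF CMC dY this] obtain F
    where F: "\<And>n. n \<epsilon> om \<Longrightarrow> inhab (ap F n)" "\<And>n. n \<epsilon> om \<Longrightarrow> fin (ap F n)"
      "\<And>n W. n \<epsilon> om \<Longrightarrow> W \<epsilon> ap F n \<Longrightarrow> W \<epsilon> Y n"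
    unfolding sub_def by metis
  \<comment> \<open>\<open>suc k\<close> stands for the indices up to and including
    \<open>k\<close>. The same bound limits the member of the family and the position in each
    witness, which leaves three nested finite intersections.\<close>
  define H where "H k = mk (\<lambda>x. x \<epsilon> X \<and> (\<forall>n. n \<epsilon> suc k \<longrightarrow> (\<forall>W. W \<epsilon> ap F n \<longrightarrow>
    (\<forall>i. i \<epsilon> suc k \<longrightarrow> x \<epsilon> ap W i))))" for k
  have dH: "dfnT (\<lambda>e. H (e 0))" unfolding H_def by (intro dfn)
  have H: "x \<epsilon> H k \<longleftrightarrow> x \<epsilon> X \<and> (\<forall>n. n \<epsilon> suc k \<longrightarrow> (\<forall>W. W \<epsilon> ap F n \<longrightarrow>
    (\<forall>i. i \<epsilon> suc k \<longrightarrow> x \<epsilon> ap W i)))" for x k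
    unfolding H_def by (rule mk_iff, rule isset_sep) (intro dfn)
  have PH: "P (H k)" if k: "k \<epsilon> om" for k
  proof -
    have mem: "j \<epsilon> om" if "j \<epsilon> suc k" for j using om_mem[OF om_suc[OF k] that] .
    have "traced P X (\<lambda>x. \<forall>n. n \<epsilon> suc k \<longrightarrow> (\<forall>W. W \<epsilon> ap F n \<longrightarrow>
      (\<forall>i. i \<epsilon> suc k \<longrightarrow> x \<epsilon> ap W i)))"
    proof (rule traced_fin_all[OF P])
      show "fin (suc k)" using k by (intro fin_om om_suc)
      show "dfn (\<lambda>e. \<forall>W. W \<epsilon> ap F (e 0) \<longrightarrow> (\<forall>i. i \<epsilon> suc k \<longrightarrow> e (Suc 0) \<epsilon> ap W i))"
        by (intro dfn)
      fix n assume n: "n \<epsilon> suc k"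
      show "traced P X (\<lambda>x. \<forall>W. W \<epsilon> ap F n \<longrightarrow> (\<forall>i. i \<epsilon> suc k \<longrightarrow> x \<epsilon> ap W i))"
      proof (rule traced_fin_all[OF P])
        show "fin (ap F n)" by (rule F(2)[OF mem[OF n]])
        show "dfn (\<lambda>e. \<forall>i. i \<epsilon> suc k \<longrightarrow> e (Suc 0) \<epsilon> ap (e 0) i)" by (intro dfn)
        fix W assume "W \<epsilon> ap F n"
        then have W: "P (ap W i)" if "i \<epsilon> om" for i using F(3)[OF mem[OF n]] Y that by blast
        show "traced P X (\<lambda>x. \<forall>i. i \<epsilon> suc k \<longrightarrow> x \<epsilon> ap W i)"
        proof (rule traced_fin_all[OF P])
          show "fin (suc k)" using k by (intro fin_om om_suc)
          show "dfn (\<lambda>e. e (Suc 0) \<epsilon> ap W (e 0))" by (intro dfn)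
          fix i assume "i \<epsilon> suc k"
          then show "traced P X (\<lambda>x. x \<epsilon> ap W i)"
            using W mem X unfolding traced_def sub_def by blast
        qed
      qed
    qed
    then obtain s where "P s" "\<And>x. x \<epsilon> s \<longleftrightarrow> x \<epsilon> H k" unfolding traced_def H by blast
    moreover from this have "s = H k" by (simp add: ext_iff)
    ultimately show ?thesis by simp
  qed
  \<comment> \<open>\<open>H emp\<close> serves as the bounding set for separation; being one of the
    intersected sets, it does not change the result.\<close>
  obtain s where s: "\<And>x. x \<epsilon> s \<longleftrightarrow> x \<epsilon> H emp \<and> (\<forall>k. k \<epsilon> om \<longrightarrow> x \<epsilon> H k)"
  proof -
    note [dfn] = dfnT_app1[OF dH]
    have "dfn (\<lambda>e. \<forall>k. k \<epsilon> om \<longrightarrow> e 0 \<epsilon> H k)" by (intro dfn)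
    then show ?thesis using isset_sep[of "\<lambda>x. \<forall>k. k \<epsilon> om \<longrightarrow> x \<epsilon> H k" "H emp"] that
      by (auto simp: isset_def)
  qed
  have "cinter P s"
    unfolding cinter_iff[OF P(1)]
    by (rule exI[of _ "mkfun om H"]) (use s PH om_0 in \<open>auto simp: ap_mkfun[OF dH]\<close>)
  moreover have "inter_of s U"
    unfolding inter_of_def
  proof (intro allI iffI impI)
    fix x u assume x: "x \<epsilon> s" and "u \<epsilon> U"
    then obtain n where n: "n \<epsilon> om" "u = ap f n" using f by auto
    obtain W where W: "W \<epsilon> ap F n" using F(1)[OF n(1)] by (auto simp: inhab_def)
    have "x \<epsilon> ap W i" if i: "i \<epsilon> om" for i
    proof -
      \<comment> \<open>The larger of \<open>n\<close> and \<open>i\<close> is a stage at which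
        position \<open>i\<close> of the witnesses for the set \<open>ap f n\<close> has been taken
        into account.\<close>
      have "\<exists>k. k \<epsilon> om \<and> n \<epsilon> suc k \<and> i \<epsilon> suc k"
        using om_linear[OF n(1) i] n(1) i by auto
      then show ?thesis using x W unfolding s H by blast
    qed
    then show "x \<epsilon> u" using F(3)[OF n(1) W] Y n(2) by blast
  next
    fix x assume x: "\<forall>u. u \<epsilon> U \<longrightarrow> x \<epsilon> u"
    then have W: "x \<epsilon> ap W i" if "n \<epsilon> om" "W \<epsilon> ap F n" "i \<epsilon> om" for n W i
      using F(3) Y f that by blast
    obtain W where "W \<epsilon> ap F emp" using F(1)[OF om_0] by (auto simp: inhab_def)
    then have "x \<epsilon> X"
      using F(3)[OF om_0] W[OF om_0 _ om_0] Y X om_0 unfolding sub_def by blast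
    then have "x \<epsilon> H k" if "k \<epsilon> om" for k
      unfolding H using W om_mem[OF om_suc[OF that]] by blast
    then show "x \<epsilon> s" using s om_0 by blast
  qed
  ultimately show "\<exists>s. inter_of s U \<and> cinter P s" by blast
qed

lemma stable_CO_G_delta:
  assumes CMC: model_CMC and T: "top_on X T"
  shows "stable (cinter (clop X T))" "stable (cinter (\<lambda>u. u \<epsilon> T))"
proof -
  have X: "u \<sqsubseteq> X" if "u \<epsilon> T" for u using T that by (simp add: top_on_def)
  have int: "\<exists>s. s \<epsilon> T \<and> (\<forall>x. x \<epsilon> s \<longleftrightarrow> x \<epsilon> u \<and> x \<epsilon> v)" if "u \<epsilon> T" "v \<epsilon> T" for u v
    using T that by (simp add: top_on_def)
  show "stable (cinter (\<lambda>u. u \<epsilon> T))"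
  proof (rule stable_cinter[OF CMC])
    show "dfn (\<lambda>e. e 0 \<epsilon> T)" by (intro dfn)
    show "inter_closed (\<lambda>u. u \<epsilon> T)" using int by (simp add: inter_closed_def)
    show "X \<epsilon> T" using T by (simp add: top_on_def)
  qed (rule X)
  show "stable (cinter (clop X T))"
  proof (rule stable_cinter[OF CMC])
    show "dfn (\<lambda>e. clop X T (e 0))" unfolding clop_def by (intro dfn)
    show "clop X T X" using T by (auto simp: clop_def top_on_def intro!: exI[of _ emp])
    show "u \<sqsubseteq> X" if "clop X T u" for u using that X by (simp add: clop_def)
    show "inter_closed (clop X T)"
      unfolding inter_closed_def
    proof (intro allI impI)
      fix u v assume "clop X T u" "clop X T v"
      then obtain u' v' where u: "u \<epsilon> T" "u' \<epsilon> T" "\<And>x. x \<epsilon> u' \<longleftrightarrow> x \<epsilon> X \<and> \<not> x \<epsilon> u"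
        and v: "v \<epsilon> T" "v' \<epsilon> T" "\<And>x. x \<epsilon> v' \<longleftrightarrow> x \<epsilon> X \<and> \<not> x \<epsilon> v"
        by (auto simp: clop_def)
      obtain s where s: "s \<epsilon> T" "\<And>x. x \<epsilon> s \<longleftrightarrow> x \<epsilon> u \<and> x \<epsilon> v" using int[OF u(1) v(1)] by blast
      have "upair u' v' \<sqsubseteq> T" using u v by (simp add: sub_def)
      then obtain t where "t \<epsilon> T" "union_of t (upair u' v')"
        using T unfolding top_on_def by blast
      then have "t \<epsilon> T \<and> (\<forall>x. x \<epsilon> t \<longleftrightarrow> x \<epsilon> X \<and> \<not> x \<epsilon> s)"
        using s u v by (auto simp: union_of_def)
      then show "\<exists>s. clop X T s \<and> (\<forall>x. x \<epsilon> s \<longleftrightarrow> x \<epsilon> u \<and> x \<epsilon> v)"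
        using s unfolding clop_def by blast
    qed
  qed
qed

section \<open>Countable intersections without choice\<close>

lemma dfn_sub [dfn]: "dfnT s \<Longrightarrow> dfnT t \<Longrightarrow> dfn (\<lambda>e. s e \<sqsubseteq> t e)"
  by (rule dfn_app2) (unfold sub_def, intro dfn)

lemma dfn_cinter:
  assumes P: "dfn (\<lambda>e. P (e 0))"
  shows "dfn (\<lambda>e. cinter P (e 0))"
proof -
  note [dfn] = dfn_app1[OF P]
  show ?thesis unfolding cinter_iff[OF P] by (intro dfn)
qed

text \<open>The union of all open subsets of \<open>s\<close> is taken, so no neighbourhood has to
  be selected for each point.\<close>

lemma open_nhds:
  assumes T: "top_on X T" and s: "\<And>x. x \<epsilon> s \<Longrightarrow> \<exists>u. u \<epsilon> T \<and> x \<epsilon> u \<and> u \<sqsubseteq> s"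
  shows "s \<epsilon> T"
proof -
  obtain U where U: "\<And>u. u \<epsilon> U \<longleftrightarrow> u \<epsilon> T \<and> u \<sqsubseteq> s"
  proof -
    have "dfn (\<lambda>e. e 0 \<sqsubseteq> s)" by (intro dfn)
    then show ?thesis using isset_sep[of "\<lambda>u. u \<sqsubseteq> s" T] that by (auto simp: isset_def)
  qed
  then have "U \<sqsubseteq> T" by (simp add: sub_def)
  then obtain t where t: "t \<epsilon> T" "union_of t U" using T unfolding top_on_def by blast
  have "x \<epsilon> t \<longleftrightarrow> x \<epsilon> s" for x
    using t(2) s U unfolding union_of_def sub_def by metis
  then show ?thesis using t(1) extensionality[of t s] by simp
qed

lemma top_onI:
  assumes "\<And>u. u \<epsilon> T \<Longrightarrow> u \<sqsubseteq> X" "emp \<epsilon> T" "X \<epsilon> T"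
    and int: "\<And>u v s. u \<epsilon> T \<Longrightarrow> v \<epsilon> T \<Longrightarrow> (\<And>x. x \<epsilon> s \<longleftrightarrow> x \<epsilon> u \<and> x \<epsilon> v) \<Longrightarrow> s \<epsilon> T"
    and un: "\<And>U. U \<sqsubseteq> T \<Longrightarrow> un U \<epsilon> T"
  shows "top_on X T"
  unfolding top_on_def
proof (intro conjI allI impI)
  fix u v assume uv: "u \<epsilon> T" "v \<epsilon> T"
  have "dfn (\<lambda>e. e 0 \<epsilon> v)" by (intro dfn)
  then obtain s where "\<And>x. x \<epsilon> s \<longleftrightarrow> x \<epsilon> u \<and> x \<epsilon> v"
    using isset_sep[of "\<lambda>x. x \<epsilon> v" u] by (auto simp: isset_def)
  then show "\<exists>s. s \<epsilon> T \<and> (\<forall>x. x \<epsilon> s \<longleftrightarrow> x \<epsilon> u \<and> x \<epsilon> v)"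
    using int[OF uv] by blast
next
  fix U assume "U \<sqsubseteq> T"
  then show "\<exists>s. s \<epsilon> T \<and> union_of s U"
    using un by (intro exI[of _ "un U"]) (simp add: union_of_def)
next
  show "u \<sqsubseteq> X" if "u \<epsilon> T" for u using that by (rule assms(1))
qed (fact assms)+

lemma G_delta_nhd_Inter:
  assumes stable: model_stable and T: "top_on X T"
    and W: "\<And>i. i \<epsilon> om \<Longrightarrow> ap W i \<sqsubseteq> X"
      "\<And>i. i \<epsilon> om \<Longrightarrow> \<exists>u. cinter (\<lambda>u. u \<epsilon> T) u \<and> x \<epsilon> u \<and> u \<sqsubseteq> ap W i"
    and s: "\<And>y. y \<epsilon> s \<longleftrightarrow> (\<forall>i. i \<epsilon> om \<longrightarrow> y \<epsilon> ap W i)"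
  shows "\<exists>u. cinter (\<lambda>u. u \<epsilon> T) u \<and> x \<epsilon> u \<and> u \<sqsubseteq> s"
proof -
  have dT: "dfn (\<lambda>e. e 0 \<epsilon> T)" for T by (intro dfn)
  have x: "x \<epsilon> ap W i" if "i \<epsilon> om" for i using W(2)[OF that] by (auto simp: sub_def)
  have TX: "u \<sqsubseteq> X" if "u \<epsilon> T" for u using T that by (simp add: top_on_def)
  define nhd where "nhd N \<longleftrightarrow> N \<sqsubseteq> X \<and> (\<exists>u. u \<epsilon> T \<and> x \<epsilon> u \<and> u \<sqsubseteq> N)" for N
  \<comment> \<open>The neighbourhoods of \<open>x\<close> are closed under supersets and finite
    intersections; adding the empty set makes them a topology.\<close>
  obtain N where N: "\<And>u. u \<epsilon> N \<longleftrightarrow> u = emp \<or> nhd u"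
  proof -
    have "isset (\<lambda>u. u = emp \<or> nhd u)"
    proof (rule isset_subset)
      show "dfn (\<lambda>e. e 0 = emp \<or> nhd (e 0))" unfolding nhd_def by (intro dfn)
      show "u \<epsilon> pow X" if "u = emp \<or> nhd u" for u
        using that by (auto simp: nhd_def sub_def)
    qed
    then show ?thesis using that by (auto simp: isset_def)
  qed
  have "top_on X N"
  proof (rule top_onI)
    show "u \<sqsubseteq> X" if "u \<epsilon> N" for u using that N by (auto simp: nhd_def sub_def)
    show "emp \<epsilon> N" using N by simp
    have "x \<epsilon> X" using x[OF om_0] W(1)[OF om_0] by (simp add: sub_def)
    then show "X \<epsilon> N" using T unfolding N nhd_def top_on_def sub_def by blast
    show "w \<epsilon> N" if mem: "u \<epsilon> N" "v \<epsilon> N" and w: "\<And>y. y \<epsilon> w \<longleftrightarrow> y \<epsilon> u \<and> y \<epsilon> v" for u v w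
    proof (cases "u = emp \<or> v = emp")
      case True
      then have "w = emp" using w by (intro extensionality) auto
      then show ?thesis using N by simp
    next
      case False
      then obtain u' v' where uv: "u' \<epsilon> T" "x \<epsilon> u'" "u' \<sqsubseteq> u" "v' \<epsilon> T" "x \<epsilon> v'" "v' \<sqsubseteq> v" "u \<sqsubseteq> X"
        using mem unfolding N nhd_def by blast
      obtain t where "t \<epsilon> T" "\<And>y. y \<epsilon> t \<longleftrightarrow> y \<epsilon> u' \<and> y \<epsilon> v'"
        using T uv(1,4) unfolding top_on_def by blast
      then have "t \<epsilon> T \<and> x \<epsilon> t \<and> t \<sqsubseteq> w" "w \<sqsubseteq> X" using uv w by (auto simp: sub_def)
      then show ?thesis unfolding N nhd_def by blast
    qed
    show "un U \<epsilon> N" if U: "U \<sqsubseteq> N" for U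
    proof (cases "\<exists>u. u \<epsilon> U \<and> u \<noteq> emp")
      case False
      have "un U = emp"
      proof (rule extensionality)
        show "y \<epsilon> un U \<longleftrightarrow> y \<epsilon> emp" for y using False by (metis emp_iff un_iff)
      qed
      then show ?thesis using N by simp
    next
      case True
      then obtain u where u: "u \<epsilon> U" "u \<noteq> emp" by blast
      then obtain v where v: "v \<epsilon> T" "x \<epsilon> v" "v \<sqsubseteq> u" using U N unfolding sub_def nhd_def by blast
      have "un U \<sqsubseteq> X"
        unfolding sub_def
      proof (intro allI impI)
        fix y assume "y \<epsilon> un U"
        then obtain w where w: "w \<epsilon> U" "y \<epsilon> w" by auto
        then have "w \<noteq> emp" using emp_iff by blast
        then show "y \<epsilon> X" using w U unfolding sub_def N nhd_def by blast
      qed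
      moreover have "v \<sqsubseteq> un U" using v(3) u(1) unfolding sub_def un_iff by blast
      ultimately show ?thesis unfolding N nhd_def using v by blast
    qed
  qed
  then have st: "stable (cinter (\<lambda>u. u \<epsilon> N))" using stable by (simp add: model_stable_def)
  have dW: "dfnT (\<lambda>e. ap W (e 0))" by (intro dfn)
  obtain U where U: "\<And>u. u \<epsilon> U \<longleftrightarrow> (\<exists>i. i \<epsilon> om \<and> u = ap W i)"
    using isset_repl[OF dW, of om] by (auto simp: isset_def)
  have "cinter (\<lambda>u. u \<epsilon> N) (ap W i)" if i: "i \<epsilon> om" for i
  proof -
    obtain u where u: "cinter (\<lambda>u. u \<epsilon> T) u" "x \<epsilon> u" "u \<sqsubseteq> ap W i" using W(2)[OF i] by blast
    obtain V where V: "\<And>j. j \<epsilon> om \<Longrightarrow> ap V j \<epsilon> T" "\<And>y. y \<epsilon> u \<longleftrightarrow> (\<forall>j. j \<epsilon> om \<longrightarrow> y \<epsilon> ap V j)"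
      using u(1) unfolding cinter_iff[OF dT] by blast
    \<comment> \<open>Each open \<open>ap V j\<close> is fattened by \<open>ap W i\<close>. The
      result is a neighbourhood of \<open>x\<close> as it includes an open set containing
      \<open>x\<close>, and the intersection over \<open>j\<close> is exactly \<open>ap W i\<close>,
      because the sets \<open>ap V j\<close> meet inside \<open>ap W i\<close>. The sequence
      \<open>V\<close> is fixed for one \<open>i\<close> at a time.\<close>
    define G where "G j = mk (\<lambda>y. y \<epsilon> X \<and> (y \<epsilon> ap V j \<or> y \<epsilon> ap W i))" for j
    have dG: "dfnT (\<lambda>e. G (e 0))" unfolding G_def by (intro dfn)
    have G: "y \<epsilon> G j \<longleftrightarrow> y \<epsilon> X \<and> (y \<epsilon> ap V j \<or> y \<epsilon> ap W i)" for y j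
      unfolding G_def by (rule mk_iff, rule isset_sep) (intro dfn)
    have "G j \<epsilon> N" if j: "j \<epsilon> om" for j
    proof -
      have "x \<epsilon> ap V j" using u(2) V(2) j by blast
      moreover have "ap V j \<sqsubseteq> G j" using TX[OF V(1)[OF j]] G by (auto simp: sub_def)
      moreover have "G j \<sqsubseteq> X" using G by (auto simp: sub_def)
      ultimately show ?thesis unfolding N nhd_def using V(1)[OF j] by blast
    qed
    moreover have "y \<epsilon> ap W i \<longleftrightarrow> (\<forall>j. j \<epsilon> om \<longrightarrow> y \<epsilon> G j)" for y
      unfolding G using W(1)[OF i] u(3) V(2) om_0 unfolding sub_def by blast
    ultimately show ?thesis
      unfolding cinter_iff[OF dT] by (intro exI[of _ "mkfun om G"]) (simp add: ap_mkfun[OF dG])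
  qed
  then have "\<forall>u. u \<epsilon> U \<longrightarrow> cinter (\<lambda>u. u \<epsilon> N) u" using U by auto
  moreover have "ctb U" by (rule ctbI[OF dW U])
  moreover have "inhab U" unfolding inhab_def U using om_0 by blast
  ultimately obtain s' where s': "inter_of s' U" "cinter (\<lambda>u. u \<epsilon> N) s'"
    using st unfolding stable_def by blast
  have "s' = s"
    by (rule extensionality) (use s'(1) in \<open>auto simp: inter_of_def s U\<close>)
  then obtain V where V: "\<And>j. j \<epsilon> om \<Longrightarrow> ap V j \<epsilon> N" "\<And>y. y \<epsilon> s \<longleftrightarrow> (\<forall>j. j \<epsilon> om \<longrightarrow> y \<epsilon> ap V j)"
    using s'(2) unfolding cinter_iff[OF dT] by blast
  have xs: "x \<epsilon> s" using x s by blast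
  \<comment> \<open>Interiors are definable, so the passage back from neighbourhoods to open sets
    requires no selection. As \<open>x\<close> lies in every \<open>ap V j\<close>, none of these is
    the added empty set, and \<open>x\<close> survives in each interior.\<close>
  define O' where "O' j = mk (\<lambda>y. y \<epsilon> X \<and> (\<exists>u. u \<epsilon> T \<and> u \<sqsubseteq> ap V j \<and> y \<epsilon> u))" for j
  have dO: "dfnT (\<lambda>e. O' (e 0))" unfolding O'_def by (intro dfn)
  have O': "y \<epsilon> O' j \<longleftrightarrow> y \<epsilon> X \<and> (\<exists>u. u \<epsilon> T \<and> u \<sqsubseteq> ap V j \<and> y \<epsilon> u)" for y j
    unfolding O'_def by (rule mk_iff, rule isset_sep) (intro dfn)
  note [dfn] = dfnT_app1[OF dO]
  have OT: "O' j \<epsilon> T" for j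
  proof (rule open_nhds[OF T])
    fix y assume "y \<epsilon> O' j"
    then obtain u where u: "u \<epsilon> T" "u \<sqsubseteq> ap V j" "y \<epsilon> u" using O' by blast
    then have "u \<sqsubseteq> O' j" using TX unfolding sub_def O' by blast
    then show "\<exists>u. u \<epsilon> T \<and> y \<epsilon> u \<and> u \<sqsubseteq> O' j" using u by blast
  qed
  have xO: "x \<epsilon> O' j" if j: "j \<epsilon> om" for j
  proof -
    have "x \<epsilon> ap V j" using xs V(2) j by blast
    then have "ap V j \<noteq> emp" using emp_iff by metis
    then obtain u where u: "u \<epsilon> T" "x \<epsilon> u" "u \<sqsubseteq> ap V j"
      using V(1)[OF j] unfolding N nhd_def by blast
    then show ?thesis using TX unfolding O' sub_def by blast
  qed
  obtain v where v: "\<And>y. y \<epsilon> v \<longleftrightarrow> (\<forall>j. j \<epsilon> om \<longrightarrow> y \<epsilon> O' j)"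
  proof -
    have "isset (\<lambda>y. \<forall>j. j \<epsilon> om \<longrightarrow> y \<epsilon> O' j)"
    proof (rule isset_subset)
      show "dfn (\<lambda>e. \<forall>j. j \<epsilon> om \<longrightarrow> e 0 \<epsilon> O' j)" by (intro dfn)
      show "y \<epsilon> O' emp" if "\<forall>j. j \<epsilon> om \<longrightarrow> y \<epsilon> O' j" for y using that om_0 by blast
    qed
    then show ?thesis using that by (auto simp: isset_def)
  qed
  have "cinter (\<lambda>u. u \<epsilon> T) v"
    unfolding cinter_iff[OF dT] by (intro exI[of _ "mkfun om O'"]) (simp add: ap_mkfun[OF dO] OT v)
  moreover have "v \<sqsubseteq> s" unfolding sub_def v V(2) O' by (auto simp: sub_def)
  ultimately show ?thesis using xO v by blast
qed

text \<open>Stability is used twice: for the given topology, to intersect two basic sets, and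
  through \<open>G_delta_nhd_Inter\<close> for the neighbourhood topology of each point, to
  intersect countably many open sets of \<open>D\<close>.\<close>

theorem model_stable_imp_pspace:
  assumes stable: model_stable
  shows model_pspace
  unfolding model_pspace_def
proof (intro allI impI)
  fix X T assume T: "top_on X T"
  have dT: "dfn (\<lambda>e. e 0 \<epsilon> T)" for T by (intro dfn)
  note [dfn] = dfn_app1[OF dfn_cinter[OF dT]]
  let ?G = "cinter (\<lambda>u. u \<epsilon> T)"
  have TX: "u \<sqsubseteq> X" if "u \<epsilon> T" for u using T that by (simp add: top_on_def)
  have open_G: "?G u" if u: "u \<epsilon> T" for u
  proof -
    have d: "dfnT (\<lambda>e. u)" by (rule dfnT_const)
    show ?thesis unfolding cinter_iff[OF dT]
    proof (intro exI conjI allI impI)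
      show "ap (mkfun om (\<lambda>_. u)) i \<epsilon> T" if "i \<epsilon> om" for i
        using u by (simp add: ap_mkfun[OF d that])
      show "x \<epsilon> u \<longleftrightarrow> (\<forall>i. i \<epsilon> om \<longrightarrow> x \<epsilon> ap (mkfun om (\<lambda>_. u)) i)" for x
        using ap_mkfun[OF d] om_0 by metis
    qed
  qed
  have GX: "u \<sqsubseteq> X" if "?G u" for u
    using that om_0 TX unfolding cinter_iff[OF dT] sub_def by blast
  obtain D where D: "\<And>s. s \<epsilon> D \<longleftrightarrow> (\<exists>U. (\<forall>u. u \<epsilon> U \<longrightarrow> ?G u) \<and> union_of s U)"
  proof -
    have "isset (\<lambda>s. \<exists>U. (\<forall>u. u \<epsilon> U \<longrightarrow> ?G u) \<and> union_of s U)"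
    proof (rule isset_subset)
      show "dfn (\<lambda>e. \<exists>U. (\<forall>u. u \<epsilon> U \<longrightarrow> ?G u) \<and> union_of (e 0) U)"
        unfolding union_of_def by (intro dfn)
      show "s \<epsilon> pow X" if "\<exists>U. (\<forall>u. u \<epsilon> U \<longrightarrow> ?G u) \<and> union_of s U" for s
        using that GX unfolding union_of_def sub_def pow_iff by blast
    qed
    then show ?thesis using that by (auto simp: isset_def)
  qed
  \<comment> \<open>The local description of membership in \<open>D\<close>. For the converse all
    \<open>G_delta\<close> subsets of \<open>s\<close> are united, again without selecting one per
    point.\<close>
  have D_iff: "s \<epsilon> D \<longleftrightarrow> (\<forall>x. x \<epsilon> s \<longrightarrow> (\<exists>u. ?G u \<and> x \<epsilon> u \<and> u \<sqsubseteq> s))" for s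
  proof
    assume "s \<epsilon> D"
    then show "\<forall>x. x \<epsilon> s \<longrightarrow> (\<exists>u. ?G u \<and> x \<epsilon> u \<and> u \<sqsubseteq> s)"
      unfolding D union_of_def sub_def by blast
  next
    assume s: "\<forall>x. x \<epsilon> s \<longrightarrow> (\<exists>u. ?G u \<and> x \<epsilon> u \<and> u \<sqsubseteq> s)"
    have "dfn (\<lambda>e. ?G (e 0) \<and> e 0 \<sqsubseteq> s)" by (intro dfn)
    then obtain U where U: "\<And>u. u \<epsilon> U \<longleftrightarrow> u \<epsilon> pow X \<and> ?G u \<and> u \<sqsubseteq> s"
      using isset_sep[of "\<lambda>u. ?G u \<and> u \<sqsubseteq> s" "pow X"] by (auto simp: isset_def)
    have U': "u \<epsilon> U \<longleftrightarrow> ?G u \<and> u \<sqsubseteq> s" for u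
      using U GX by (auto simp: sub_def)
    have "union_of s U" unfolding union_of_def U' using s by (auto simp: sub_def)
    then show "s \<epsilon> D" unfolding D using U' by blast
  qed
  have DX: "u \<sqsubseteq> X" if "u \<epsilon> D" for u
    using that GX unfolding D_iff sub_def by blast
  have top: "top_on X D"
  proof (rule top_onI)
    show "emp \<epsilon> D" by (simp add: D_iff)
    show "X \<epsilon> D" using T open_G unfolding D_iff top_on_def sub_def by blast
    show "s \<epsilon> D" if mem: "u \<epsilon> D" "v \<epsilon> D" and s: "\<And>x. x \<epsilon> s \<longleftrightarrow> x \<epsilon> u \<and> x \<epsilon> v" for u v s
      unfolding D_iff
    proof (intro allI impI)
      fix x assume "x \<epsilon> s"
      then obtain u' v' where uv: "?G u'" "x \<epsilon> u'" "u' \<sqsubseteq> u" "?G v'" "x \<epsilon> v'" "v' \<sqsubseteq> v"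
        using mem s unfolding D_iff by blast
      \<comment> \<open>The pair is presented as a countable family by a sequence that is
        \<open>u'\<close> at \<open>emp\<close> and \<open>v'\<close> at every other index, so that
        stability gives the binary intersection.\<close>
      have d: "dfnT (\<lambda>e. if e 0 = emp then u' else v')" by (intro dfn)
      have "y \<epsilon> upair u' v' \<longleftrightarrow> (\<exists>n. n \<epsilon> om \<and> y = (if n = emp then u' else v'))" for y
        using om_0 om_suc[OF om_0] suc_not_emp[of emp] upair_iff[of y u' v'] by metis
      then have "ctb (upair u' v')" by (rule ctbI[OF d])
      moreover have "inhab (upair u' v')" by (auto simp: inhab_def)
      moreover have "\<forall>u. u \<epsilon> upair u' v' \<longrightarrow> ?G u" using uv by auto
      ultimately have "inhab (upair u' v') \<and> ctb (upair u' v') \<and> (\<forall>u. u \<epsilon> upair u' v' \<longrightarrow> ?G u)"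
        by iprover
      moreover have "stable ?G" using stable T by (simp add: model_stable_def)
      ultimately obtain t where t: "inter_of t (upair u' v')" "?G t"
        unfolding stable_def by iprover
      have t': "y \<epsilon> t \<longleftrightarrow> y \<epsilon> u' \<and> y \<epsilon> v'" for y
        using t(1) by (auto simp: inter_of_def)
      have "t \<sqsubseteq> s" using uv(3,6) by (simp add: sub_def s t')
      then show "\<exists>t. ?G t \<and> x \<epsilon> t \<and> t \<sqsubseteq> s"
        using t(2) t' uv(2,5) by blast
    qed
    show "un U \<epsilon> D" if U: "U \<sqsubseteq> D" for U
      unfolding D_iff
    proof (intro allI impI)
      fix x assume "x \<epsilon> un U"
      then obtain w where w: "w \<epsilon> U" "x \<epsilon> w" by auto
      then have "w \<epsilon> D" using U by (simp add: sub_def)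
      then obtain u where "?G u" "x \<epsilon> u" "u \<sqsubseteq> w" using w(2) D_iff by blast
      then show "\<exists>u. ?G u \<and> x \<epsilon> u \<and> u \<sqsubseteq> un U" using w(1) by (auto simp: sub_def)
    qed
  qed (rule DX)
  moreover have "s \<epsilon> D" if s: "cinter (\<lambda>u. u \<epsilon> D) s" for s
    unfolding D_iff
  proof (intro allI impI)
    fix x assume x: "x \<epsilon> s"
    obtain W where W: "\<And>i. i \<epsilon> om \<Longrightarrow> ap W i \<epsilon> D" "\<And>y. y \<epsilon> s \<longleftrightarrow> (\<forall>i. i \<epsilon> om \<longrightarrow> y \<epsilon> ap W i)"
      using s unfolding cinter_iff[OF dT] by blast
    show "\<exists>u. ?G u \<and> x \<epsilon> u \<and> u \<sqsubseteq> s"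
    proof (rule G_delta_nhd_Inter[OF stable T, of W x s])
      show "ap W i \<sqsubseteq> X" if "i \<epsilon> om" for i by (rule DX[OF W(1)[OF that]])
      show "\<exists>u. ?G u \<and> x \<epsilon> u \<and> u \<sqsubseteq> ap W i" if "i \<epsilon> om" for i
        using W(1)[OF that] x W(2) that unfolding D_iff by blast
    qed (rule W(2))
  qed
  ultimately show "\<exists>D. dtop T D \<and> pspace X D"
    unfolding dtop_def pspace_def by (intro exI[of _ D] conjI allI impI D) auto
qed

section \<open>The real numbers of a model\<close>

lemma mem_suc_suc: "n \<epsilon> om \<Longrightarrow> suc k \<epsilon> suc n \<Longrightarrow> k \<epsilon> n"
proof -
  assume n: "n \<epsilon> om" and "suc k \<epsilon> suc n"
  then have "suc k \<epsilon> n \<or> suc k = n" by simp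
  then show "k \<epsilon> n"
  proof
    assume "suc k \<epsilon> n"
    moreover have "k \<epsilon> suc k" by simp
    ultimately show ?thesis by (rule om_trans[OF n])
  next
    assume "suc k = n"
    then show ?thesis using suc_iff[of k k] by simp
  qed
qed

text \<open>\<open>G\<close> acts on all elements, not just on some fixed set, so the sequence is
  glued from finite approximations and collected by replacement in \<open>mkfun\<close>.\<close>

lemma om_recursion:
  assumes G: "dfnT (\<lambda>e. G (e 0))"
  obtains f where "ap f emp = a" "\<And>n. n \<epsilon> om \<Longrightarrow> ap f (suc n) = G (ap f n)"
proof -
  note [dfn] = dfnT_app1[OF G]
  \<comment> \<open>The equations for \<open>k\<close> in \<open>n\<close> fix the values at all
    arguments up to and including \<open>n\<close>; this is why agreement is claimed on
    \<open>suc n\<close>.\<close>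
  define approx where "approx n g \<longleftrightarrow> ap g emp = a \<and> (\<forall>k. k \<epsilon> n \<longrightarrow> ap g (suc k) = G (ap g k))" for n g
  have agree: "ap g k = ap g' k"
    if "n \<epsilon> om" "approx n g" "approx n g'" "k \<epsilon> suc n" for n k g g'
  proof -
    have "k \<epsilon> om" using om_mem[OF om_suc[OF that(1)] that(4)] .
    then have "k \<epsilon> suc n \<longrightarrow> ap g k = ap g' k"
    proof (induction rule: om_induct)
      case def
      show ?case by (intro dfn)
    next
      case 0
      show ?case using that by (simp add: approx_def)
    next
      case (suc k)
      show ?case
      proof
        assume "suc k \<epsilon> suc n"
        then have k: "k \<epsilon> n" by (rule mem_suc_suc[OF that(1)])
        then have "ap g k = ap g' k" using suc.IH by simp
        moreover have "ap g (suc k) = G (ap g k)" "ap g' (suc k) = G (ap g' k)"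
          using that(2,3) k unfolding approx_def by blast+
        ultimately show "ap g (suc k) = ap g' (suc k)" by simp
      qed
    qed
    then show ?thesis using that(4) by blast
  qed
  have ex: "\<exists>g. approx n g" if "n \<epsilon> om" for n
    using that
  proof (induction rule: om_induct)
    case def
    show ?case unfolding approx_def by (intro dfn)
  next
    case 0
    have d: "dfnT (\<lambda>e. a)" by (rule dfnT_const)
    show ?case
      by (rule exI[of _ "mkfun om (\<lambda>_. a)"]) (simp add: approx_def ap_mkfun[OF d])
  next
    case (suc n)
    then obtain g where g: "approx n g" by blast
    define H where "H k = (if k = suc n then G (ap g n) else ap g k)" for k
    have dH: "dfnT (\<lambda>e. H (e 0))" unfolding H_def by (intro dfn)
    have "H (suc k) = G (H k)" if "k \<epsilon> suc n" for k
    proof (cases "k = n")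
      case True
      have "n \<noteq> suc n" using not_mem_self[of n] suc_iff[of n n] by metis
      then show ?thesis using True by (simp add: H_def)
    next
      case False
      then have k: "k \<epsilon> n" using that by simp
      have "suc k \<noteq> suc n" using False by (simp add: suc_inject)
      moreover have "k \<noteq> suc n"
      proof
        assume "k = suc n"
        then have "n \<epsilon> n" using om_trans[OF suc.hyps k, of n] by simp
        then show False using not_mem_self by blast
      qed
      ultimately show ?thesis using g k by (simp add: H_def approx_def)
    qed
    moreover have "H emp = a" using g suc_not_emp[of n] by (simp add: H_def approx_def)
    moreover have "k \<epsilon> om" if "k \<epsilon> suc n" for k using om_mem[OF om_suc[OF suc.hyps] that] .
    ultimately have "approx (suc n) (mkfun om H)"
      unfolding approx_def by (simp add: ap_mkfun[OF dH])
    then show ?case by blast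
  qed
  \<comment> \<open>Approximations are arbitrary beyond their length, hence not unique. Their value
    at \<open>n\<close> is, and \<open>the1\<close> names that value rather than an
    approximation.\<close>
  define F where "F n = the1 (\<lambda>r. \<exists>g. approx n g \<and> r = ap g n)" for n
  have dF: "dfnT (\<lambda>e. F (e 0))" unfolding F_def approx_def by (intro dfn)
  have F: "F n = ap g n" if "n \<epsilon> om" "approx n g" for n g
    unfolding F_def
  proof (rule the1_equality)
    show "\<exists>g'. approx n g' \<and> ap g n = ap g' n" using that by blast
    show "z = ap g n" if "\<exists>g'. approx n g' \<and> z = ap g' n" for z
      using that agree[OF \<open>n \<epsilon> om\<close> _ \<open>approx n g\<close>, of _ n] by auto
  qed
  have "F emp = a"
    using ex[OF om_0] F[OF om_0] by (auto simp: approx_def)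
  moreover have "F (suc n) = G (F n)" if n: "n \<epsilon> om" for n
  proof -
    obtain g where g: "approx (suc n) g" using ex[OF om_suc[OF n]] by blast
    then have "approx n g" by (simp add: approx_def)
    moreover have "ap g (suc n) = G (ap g n)" using g by (simp add: approx_def)
    ultimately show ?thesis using F[OF om_suc[OF n] g] F[OF n] by simp
  qed
  ultimately show thesis
    using that[of "mkfun om F"] by (simp add: ap_mkfun[OF dF])
qed

end

section \<open>Arithmetic and order of a complete ordered field\<close>

locale zf_model_reals = zf_model E e0
  for E :: "'a \<Rightarrow> 'a \<Rightarrow> bool"  (infix "\<epsilon>" 50) and e0 +
  fixes R zero one add mul lt :: 'a
  assumes reals: "is_reals R zero one add mul lt"
begin

definition pls where "pls x y = ap add (pr x y)"
definition tms where "tms x y = ap mul (pr x y)"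
definition lss (infix "\<prec>" 50) where "x \<prec> y \<longleftrightarrow> pr x y \<epsilon> lt"
definition leq (infix "\<preceq>" 50) where "x \<preceq> y \<longleftrightarrow> x \<prec> y \<or> x = y"

lemma dfnT_pls [dfn]: "dfnT s \<Longrightarrow> dfnT t \<Longrightarrow> dfnT (\<lambda>e. pls (s e) (t e))"
  by (rule dfnT_app2) (unfold pls_def, intro dfn)

lemma dfnT_tms [dfn]: "dfnT s \<Longrightarrow> dfnT t \<Longrightarrow> dfnT (\<lambda>e. tms (s e) (t e))"
  by (rule dfnT_app2) (unfold tms_def, intro dfn)

lemma dfn_lss [dfn]: "dfnT s \<Longrightarrow> dfnT t \<Longrightarrow> dfn (\<lambda>e. s e \<prec> t e)"
  by (rule dfn_app2) (unfold lss_def, intro dfn)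

lemma dfn_leq [dfn]: "dfnT s \<Longrightarrow> dfnT t \<Longrightarrow> dfn (\<lambda>e. s e \<preceq> t e)"
  by (rule dfn_app2) (unfold leq_def, intro dfn)

lemma fnc_add: "fnc add (prd R R)" and fnc_mul: "fnc mul (prd R R)"
  using reals by (simp_all add: is_reals_def ofld_def fld_def acu_def maps_to_def)

lemma add_iff: "pr (pr x y) z \<epsilon> add \<longleftrightarrow> x \<epsilon> R \<and> y \<epsilon> R \<and> z = pls x y"
  unfolding pls_def fnc_pr_iff[OF fnc_add] by auto

lemma mul_iff: "pr (pr x y) z \<epsilon> mul \<longleftrightarrow> x \<epsilon> R \<and> y \<epsilon> R \<and> z = tms x y"
  unfolding tms_def fnc_pr_iff[OF fnc_mul] by auto

lemma pls_R [simp]: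
  assumes "x \<epsilon> R" "y \<epsilon> R"
  shows "pls x y \<epsilon> R"
proof -
  have "maps_to add (prd R R) R"
    using reals by (simp add: is_reals_def ofld_def fld_def acu_def)
  moreover have "pr (pr x y) (pls x y) \<epsilon> add" using assms by (simp add: add_iff)
  ultimately show ?thesis unfolding maps_to_def by iprover
qed

lemma tms_R [simp]:
  assumes "x \<epsilon> R" "y \<epsilon> R"
  shows "tms x y \<epsilon> R"
proof -
  have "maps_to mul (prd R R) R"
    using reals by (simp add: is_reals_def ofld_def fld_def acu_def)
  moreover have "pr (pr x y) (tms x y) \<epsilon> mul" using assms by (simp add: mul_iff)
  ultimately show ?thesis unfolding maps_to_def by iprover
qed

lemma acu_add: "acu R add zero" and acu_mul: "acu R mul one"
  using reals by (simp_all add: is_reals_def ofld_def fld_def)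

lemma zero_R [simp]: "zero \<epsilon> R" and one_R [simp]: "one \<epsilon> R"
  using acu_add acu_mul by (simp_all add: acu_def)

lemma pls_assoc:
  assumes "x \<epsilon> R" "y \<epsilon> R" "z \<epsilon> R"
  shows "pls (pls x y) z = pls x (pls y z)"
proof -
  have "pr (pr x (pls y z)) (pls (pls x y) z) \<epsilon> add"
    using acu_add[unfolded acu_def, THEN conjunct2, THEN conjunct2, THEN conjunct1, rule_format,
        OF assms, where u = "pls x y"] assms by (simp add: add_iff)
  then show ?thesis by (simp add: add_iff)
qed

lemma pls_comm: "x \<epsilon> R \<Longrightarrow> y \<epsilon> R \<Longrightarrow> pls x y = pls y x"
  using acu_add by (simp add: acu_def add_iff)

lemma pls_zero [simp]: "x \<epsilon> R \<Longrightarrow> pls x zero = x"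
proof -
  have "\<forall>x. x \<epsilon> R \<longrightarrow> x = pls x zero" using acu_add by (simp add: acu_def add_iff)
  then show "x \<epsilon> R \<Longrightarrow> ?thesis" by metis
qed

lemma zero_pls [simp]: "x \<epsilon> R \<Longrightarrow> pls zero x = x"
  using pls_comm[of zero x] by simp

lemma tms_one [simp]: "x \<epsilon> R \<Longrightarrow> tms x one = x"
proof -
  have "\<forall>x. x \<epsilon> R \<longrightarrow> x = tms x one" using acu_mul by (simp add: acu_def mul_iff)
  then show "x \<epsilon> R \<Longrightarrow> ?thesis" by metis
qed

lemma tms_comm: "x \<epsilon> R \<Longrightarrow> y \<epsilon> R \<Longrightarrow> tms x y = tms y x"
  using acu_mul by (simp add: acu_def mul_iff)

lemma distrib: "x \<epsilon> R \<Longrightarrow> y \<epsilon> R \<Longrightarrow> z \<epsilon> R \<Longrightarrow> tms x (pls y z) = pls (tms x y) (tms x z)"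
  using reals by (simp add: is_reals_def ofld_def fld_def add_iff mul_iff)

lemma ex_minus: "x \<epsilon> R \<Longrightarrow> \<exists>y. y \<epsilon> R \<and> pls x y = zero"
  using reals by (simp add: is_reals_def ofld_def fld_def add_iff mul_iff) metis

lemma ex_inverse: "x \<epsilon> R \<Longrightarrow> x \<noteq> zero \<Longrightarrow> \<exists>y. y \<epsilon> R \<and> tms x y = one"
  using reals by (simp add: is_reals_def ofld_def fld_def add_iff mul_iff) metis

lemma zero_neq_one: "zero \<noteq> one"
  using reals by (simp add: is_reals_def ofld_def fld_def)

lemma lss_irrefl: "x \<epsilon> R \<Longrightarrow> \<not> x \<prec> x"
  using reals by (simp add: is_reals_def ofld_def slo_def lss_def)

lemma lss_trans: "x \<prec> y \<Longrightarrow> y \<prec> z \<Longrightarrow> x \<epsilon> R \<Longrightarrow> y \<epsilon> R \<Longrightarrow> z \<epsilon> R \<Longrightarrow> x \<prec> z"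
  using reals unfolding is_reals_def ofld_def slo_def lss_def by blast

lemma lss_total: "x \<epsilon> R \<Longrightarrow> y \<epsilon> R \<Longrightarrow> x \<prec> y \<or> x = y \<or> y \<prec> x"
  using reals unfolding is_reals_def ofld_def slo_def lss_def by blast

lemma not_lss: "x \<epsilon> R \<Longrightarrow> y \<epsilon> R \<Longrightarrow> \<not> x \<prec> y \<longleftrightarrow> y \<preceq> x"
  using lss_irrefl lss_trans lss_total unfolding leq_def by metis

lemma leq_refl [simp]: "x \<preceq> x"
  by (simp add: leq_def)

lemma leq_lss_trans: "x \<preceq> y \<Longrightarrow> y \<prec> z \<Longrightarrow> x \<epsilon> R \<Longrightarrow> y \<epsilon> R \<Longrightarrow> z \<epsilon> R \<Longrightarrow> x \<prec> z"
  using lss_trans unfolding leq_def by metis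

lemma lss_leq_trans: "x \<prec> y \<Longrightarrow> y \<preceq> z \<Longrightarrow> x \<epsilon> R \<Longrightarrow> y \<epsilon> R \<Longrightarrow> z \<epsilon> R \<Longrightarrow> x \<prec> z"
  using lss_trans unfolding leq_def by metis

lemma leq_trans: "x \<preceq> y \<Longrightarrow> y \<preceq> z \<Longrightarrow> x \<epsilon> R \<Longrightarrow> y \<epsilon> R \<Longrightarrow> z \<epsilon> R \<Longrightarrow> x \<preceq> z"
  using lss_trans unfolding leq_def by metis

lemma leq_antisym: "x \<preceq> y \<Longrightarrow> y \<preceq> x \<Longrightarrow> x \<epsilon> R \<Longrightarrow> y \<epsilon> R \<Longrightarrow> x = y"
  using lss_trans lss_irrefl unfolding leq_def by metis

lemma pls_mono: "x \<prec> y \<Longrightarrow> x \<epsilon> R \<Longrightarrow> y \<epsilon> R \<Longrightarrow> z \<epsilon> R \<Longrightarrow> pls x z \<prec> pls y z"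
  using reals unfolding is_reals_def ofld_def lss_def add_iff by blast

lemma pls_mono_left: "x \<prec> y \<Longrightarrow> x \<epsilon> R \<Longrightarrow> y \<epsilon> R \<Longrightarrow> z \<epsilon> R \<Longrightarrow> pls z x \<prec> pls z y"
  using pls_mono[of x y z] pls_comm[of z x] pls_comm[of z y] by simp

lemma minus_unique:
  assumes "x \<epsilon> R" "y \<epsilon> R" "z \<epsilon> R" "pls x y = zero" "pls x z = zero"
  shows "y = z"
proof -
  have "y = pls y (pls x z)" using assms by simp
  also have "\<dots> = pls (pls x y) z" using assms pls_assoc[of y x z] pls_comm[of x y] by simp
  also have "\<dots> = z" using assms by simp
  finally show ?thesis .
qed

definition mns where "mns x = the1 (\<lambda>y. y \<epsilon> R \<and> pls x y = zero)"

lemma dfnT_mns [dfn]: "dfnT s \<Longrightarrow> dfnT (\<lambda>e. mns (s e))"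
  unfolding mns_def by (rule dfnT_app1[of "\<lambda>x. the1 (\<lambda>y. y \<epsilon> R \<and> pls x y = zero)"]) (intro dfn)

lemma mns:
  assumes x: "x \<epsilon> R"
  shows "mns x \<epsilon> R \<and> pls x (mns x) = zero"
proof -
  obtain y where y: "y \<epsilon> R \<and> pls x y = zero" using ex_minus[OF x] ..
  then have "\<exists>!y. y \<epsilon> R \<and> pls x y = zero"
    by (rule ex1I) (use y minus_unique[OF x] in simp)
  from the1I[OF this] show ?thesis unfolding mns_def .
qed

lemma mns_R [simp]: "x \<epsilon> R \<Longrightarrow> mns x \<epsilon> R" and pls_mns: "x \<epsilon> R \<Longrightarrow> pls x (mns x) = zero"
  using mns by auto

lemma mns_mns [simp]: "x \<epsilon> R \<Longrightarrow> mns (mns x) = x"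
  using minus_unique[of "mns x" "mns (mns x)" x] pls_mns[of "mns x"] pls_mns[of x]
    pls_comm[of x "mns x"] by simp

lemma mns_zero [simp]: "mns zero = zero"
  using minus_unique[of zero "mns zero" zero] pls_mns[of zero] by simp

lemma mns_mono:
  assumes "x \<prec> y" "x \<epsilon> R" "y \<epsilon> R"
  shows "mns y \<prec> mns x"
proof -
  have "pls x (pls (mns x) (mns y)) \<prec> pls y (pls (mns x) (mns y))"
    using assms by (intro pls_mono) simp_all
  moreover have "pls x (pls (mns x) (mns y)) = mns y"
    using assms pls_assoc[of x "mns x" "mns y"] pls_mns[of x] by simp
  moreover have "pls y (pls (mns x) (mns y)) = mns x"
    using assms pls_comm[of "mns x" "mns y"] pls_assoc[of y "mns y" "mns x"] pls_mns[of y] by simp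
  ultimately show ?thesis by simp
qed

lemma lss_mns_iff: "x \<epsilon> R \<Longrightarrow> y \<epsilon> R \<Longrightarrow> x \<prec> mns y \<longleftrightarrow> y \<prec> mns x"
  using mns_mono[of x "mns y"] mns_mono[of y "mns x"] by auto

lemma mns_lss_iff: "x \<epsilon> R \<Longrightarrow> y \<epsilon> R \<Longrightarrow> mns x \<prec> y \<longleftrightarrow> mns y \<prec> x"
  using mns_mono[of "mns x" y] mns_mono[of "mns y" x] by auto

text \<open>Whichever of \<open>one\<close> and \<open>mns one\<close> is positive serves, so the
  sign of \<open>one\<close> need not be settled.\<close>

lemma ex_pos: "\<exists>p. p \<epsilon> R \<and> zero \<prec> p"
proof (cases "zero \<prec> one")
  case False
  then have "one \<prec> zero" using lss_total[of zero one] zero_neq_one by simp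
  then show ?thesis using mns_mono[of one zero] by (intro exI[of _ "mns one"]) simp
qed (intro exI[of _ one], simp)

text \<open>Twice \<open>one\<close> is invertible since it is not \<open>zero\<close>: whatever the
  sign of \<open>one\<close>, adding it to itself moves further away from
  \<open>zero\<close>.\<close>

lemma ex_half_unit: "\<exists>t. t \<epsilon> R \<and> pls t t = one"
proof -
  have "pls one one \<noteq> zero"
  proof (cases "zero \<prec> one")
    case True
    then have "one \<prec> pls one one" using pls_mono[of zero one one] by simp
    then have "zero \<prec> pls one one" using True lss_trans[of zero one "pls one one"] by simp
    then show ?thesis using lss_irrefl[of zero] by auto
  next
    case False
    then have "one \<prec> zero" using lss_total[of zero one] zero_neq_one by simp
    then have "pls one one \<prec> one" using pls_mono[of one zero one] by simp
    then have "pls one one \<prec> zero" using \<open>one \<prec> zero\<close> lss_trans[of "pls one one" one zero] by simp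
    then show ?thesis using lss_irrefl[of zero] by auto
  qed
  then obtain t where t: "t \<epsilon> R" "tms (pls one one) t = one" using ex_inverse[of "pls one one"] by auto
  then have "pls t t = one"
    using distrib[of t one one] tms_comm[of t "pls one one"] by simp
  then show ?thesis using t by blast
qed

lemma half_pos:
  assumes h: "h \<epsilon> R" and "zero \<prec> pls h h"
  shows "zero \<prec> h"
proof (rule ccontr)
  assume "\<not> zero \<prec> h"
  then have "h = zero \<or> h \<prec> zero" using lss_total[OF h zero_R] by auto
  then have "pls h h \<preceq> zero"
  proof
    assume "h \<prec> zero"
    then have "pls h h \<prec> h" using pls_mono[of h zero h] h by simp
    then show ?thesis using \<open>h \<prec> zero\<close> lss_trans[of "pls h h" h zero] h by (simp add: leq_def)
  qed simp
  then show False using assms(2) not_lss[of zero "pls h h"] h by simp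
qed

lemma ex_half:
  assumes "x \<epsilon> R" "zero \<prec> x"
  shows "\<exists>h. h \<epsilon> R \<and> zero \<prec> h \<and> h \<prec> x"
proof -
  obtain t where t: "t \<epsilon> R" "pls t t = one" using ex_half_unit by blast
  define h where "h = tms x t"
  have h: "h \<epsilon> R" "pls h h = x"
    using assms t distrib[of x t t] by (simp_all add: h_def)
  have "zero \<prec> h" by (rule half_pos) (simp_all only: h assms)
  moreover from this have "h \<prec> pls h h" using pls_mono[of zero h h] h(1) by simp
  then have "h \<prec> x" by (simp only: h)
  ultimately show ?thesis using h by blast
qed

text \<open>Some \<open>h\<close> lies strictly between \<open>zero\<close> and the difference of
  \<open>b\<close> and \<open>a\<close>, and adding it to \<open>a\<close> stays below
  \<open>b\<close>.\<close>

lemma dense: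
  assumes "a \<prec> b" "a \<epsilon> R" "b \<epsilon> R"
  shows "\<exists>c. c \<epsilon> R \<and> a \<prec> c \<and> c \<prec> b"
proof -
  let ?d = "pls b (mns a)"
  have "zero \<prec> ?d" using pls_mono[OF assms, of "mns a"] assms pls_mns[of a] by simp
  then obtain h where h: "h \<epsilon> R" "zero \<prec> h" "h \<prec> ?d" using ex_half[of ?d] assms by auto
  have "a \<prec> pls a h" using pls_mono_left[of zero h a] h assms by simp
  moreover have "pls a h \<prec> pls a ?d" using pls_mono_left[of h ?d a] h assms by simp
  moreover have "pls a ?d = b"
    using assms pls_comm[of b "mns a"] pls_assoc[of a "mns a" b] pls_mns[of a] by simp
  ultimately show ?thesis using h assms by (intro exI[of _ "pls a h"]) simp
qed

lemma no_max: "a \<epsilon> R \<Longrightarrow> \<exists>b. b \<epsilon> R \<and> a \<prec> b"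
proof -
  obtain p where "p \<epsilon> R" "zero \<prec> p" using ex_pos by blast
  then show "a \<epsilon> R \<Longrightarrow> ?thesis" using pls_mono_left[of zero p a] by (intro exI[of _ "pls a p"]) simp
qed

lemma no_min: "a \<epsilon> R \<Longrightarrow> \<exists>b. b \<epsilon> R \<and> b \<prec> a"
  using no_max[of "mns a"] mns_lss_iff[of a] by (metis mns_R)

text \<open>Completeness speaks of sets, and separation turns a definable part of \<open>R\<close>
  into one. Unique existence is stated because it lets \<open>the1\<close> name the supremum
  definably, uniformly in parameters.\<close>

lemma lub:
  assumes A: "dfn (\<lambda>e. A (e 0))" "\<And>r. A r \<Longrightarrow> r \<epsilon> R" "A r0"
    and b: "b \<epsilon> R" "\<And>r. A r \<Longrightarrow> r \<preceq> b"
  shows "\<exists>!y. y \<epsilon> R \<and> (\<forall>r. A r \<longrightarrow> r \<preceq> y) \<and> (\<forall>c. c \<epsilon> R \<longrightarrow> (\<forall>r. A r \<longrightarrow> r \<preceq> c) \<longrightarrow> y \<preceq> c)"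
proof -
  obtain S where S: "\<And>r. r \<epsilon> S \<longleftrightarrow> A r"
    using isset_subset[OF A(1), of R] A(2) by (auto simp: isset_def)
  have ub: "ubound lt S c \<longleftrightarrow> (\<forall>r. A r \<longrightarrow> r \<preceq> c)" for c
    by (simp add: ubound_def S leq_def lss_def)
  have "S \<sqsubseteq> R" "inhab S" using A S by (auto simp: sub_def inhab_def)
  moreover have "\<exists>b. b \<epsilon> R \<and> ubound lt S b" using b by (auto simp: ub)
  moreover have "complete R lt" using reals by (simp add: is_reals_def)
  ultimately have "\<exists>y. y \<epsilon> R \<and> ubound lt S y \<and> (\<forall>c. c \<epsilon> R \<longrightarrow> ubound lt S c \<longrightarrow> pr y c \<epsilon> lt \<or> y = c)"
    unfolding complete_def by blast
  then obtain y where "y \<epsilon> R" "\<forall>r. A r \<longrightarrow> r \<preceq> y" "\<forall>c. c \<epsilon> R \<longrightarrow> (\<forall>r. A r \<longrightarrow> r \<preceq> c) \<longrightarrow> y \<preceq> c"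
    unfolding ub leq_def lss_def by blast
  then show ?thesis by (intro ex1I[of _ y]) (auto intro: leq_antisym)
qed

text \<open>Halving a positive element repeatedly needs only recursion, not an embedding of
  \<open>om\<close> into \<open>R\<close>. That the halves get arbitrarily small is the Archimedean
  property, derived from completeness.\<close>

lemma null_sequence:
  obtains eps where "\<And>n. n \<epsilon> om \<Longrightarrow> ap eps n \<epsilon> R \<and> zero \<prec> ap eps n"
    "\<And>m n. n \<epsilon> om \<Longrightarrow> m \<epsilon> n \<Longrightarrow> ap eps n \<prec> ap eps m"
    "\<And>b. b \<epsilon> R \<Longrightarrow> zero \<prec> b \<Longrightarrow> \<exists>n. n \<epsilon> om \<and> ap eps n \<prec> b"
proof -
  obtain p where p: "p \<epsilon> R" "zero \<prec> p" using ex_pos by blast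
  obtain t where t: "t \<epsilon> R" "pls t t = one" using ex_half_unit by blast
  have "dfnT (\<lambda>e. tms (e 0) t)" by (intro dfn)
  then obtain f where f0: "ap f emp = p" and fs: "\<And>n. n \<epsilon> om \<Longrightarrow> ap f (suc n) = tms (ap f n) t"
    using om_recursion[of "\<lambda>x. tms x t" p] by blast
  have f: "ap f n \<epsilon> R \<and> zero \<prec> ap f n" if "n \<epsilon> om" for n
    using that
  proof (induction rule: om_induct)
    case def
    show ?case by (intro dfn)
  next
    case 0
    show ?case using p f0 by simp
  next
    case (suc n)
    then have "pls (ap f (suc n)) (ap f (suc n)) = ap f n"
      using fs t distrib[of "ap f n" t t] by simp
    then show ?case using half_pos[of "ap f (suc n)"] suc fs t by simp
  qed
  have half: "pls (ap f (suc n)) (ap f (suc n)) = ap f n" if "n \<epsilon> om" for n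
    using f[OF that] fs[OF that] t distrib[of "ap f n" t t] by simp
  have step: "ap f (suc n) \<prec> ap f n" if "n \<epsilon> om" for n
    using half[OF that] f[OF om_suc[OF that]] pls_mono[of zero "ap f (suc n)" "ap f (suc n)"] by simp
  have mono: "\<forall>m. m \<epsilon> n \<longrightarrow> ap f n \<prec> ap f m" if "n \<epsilon> om" for n
    using that
  proof (induction rule: om_induct)
    case def
    show ?case by (intro dfn)
  next
    case 0
    show ?case by simp
  next
    case (suc n)
    show ?case
    proof (intro allI impI)
      fix m assume m: "m \<epsilon> suc n"
      then have "ap f n \<preceq> ap f m" using suc.IH by (auto simp: leq_def)
      then show "ap f (suc n) \<prec> ap f m"
        using lss_leq_trans[OF step[OF suc.hyps]] f[OF om_suc[OF suc.hyps]] f[OF suc.hyps]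
          f[OF om_mem[OF om_suc[OF suc.hyps] m]] by blast
    qed
  qed
  have "\<exists>n. n \<epsilon> om \<and> ap f n \<prec> b" if b: "b \<epsilon> R" "zero \<prec> b" for b
  proof (rule ccontr)
    assume no: "\<nexists>n. n \<epsilon> om \<and> ap f n \<prec> b"
    \<comment> \<open>If the terms stayed above \<open>b\<close>, their lower bounds would have a
      positive supremum \<open>L\<close>. Each term is twice the next one, and \<open>L\<close> lies
      below the next one, so twice \<open>L\<close> would be a lower bound as well, although it
      exceeds \<open>L\<close>.\<close>
    let ?A = "\<lambda>r. r \<epsilon> R \<and> (\<forall>n. n \<epsilon> om \<longrightarrow> r \<preceq> ap f n)"
    have "dfn (\<lambda>e. e 0 \<epsilon> R \<and> (\<forall>n. n \<epsilon> om \<longrightarrow> e 0 \<preceq> ap f n))" by (intro dfn)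
    moreover have Ab: "?A b"
    proof (intro conjI allI impI b)
      fix n assume n: "n \<epsilon> om"
      then have "\<not> ap f n \<prec> b" using no by blast
      then show "b \<preceq> ap f n" using not_lss[of "ap f n" b] f[OF n] b by blast
    qed
    moreover have "r \<preceq> ap f emp" if "?A r" for r using that om_0 by blast
    moreover have "ap f emp \<epsilon> R" using f[OF om_0] by simp
    ultimately have "\<exists>!y. y \<epsilon> R \<and> (\<forall>r. ?A r \<longrightarrow> r \<preceq> y) \<and> (\<forall>c. c \<epsilon> R \<longrightarrow> (\<forall>r. ?A r \<longrightarrow> r \<preceq> c) \<longrightarrow> y \<preceq> c)"
      by (intro lub[of ?A b "ap f emp"]) blast+
    then obtain L where L: "L \<epsilon> R" "\<And>r. ?A r \<Longrightarrow> r \<preceq> L"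
      "\<And>c. c \<epsilon> R \<Longrightarrow> (\<And>r. ?A r \<Longrightarrow> r \<preceq> c) \<Longrightarrow> L \<preceq> c" by (elim ex1E) blast
    have Lf: "L \<preceq> ap f n" if "n \<epsilon> om" for n using L(3)[of "ap f n"] f[OF that] that by blast
    have "zero \<prec> L" using lss_leq_trans[OF b(2) L(2)[OF Ab]] b L(1) by simp
    then have "L \<prec> pls L L" using pls_mono[of zero L L] L(1) by simp
    then have "\<not> pls L L \<preceq> L" using not_lss[of L "pls L L"] L(1) by simp
    then have "\<not> ?A (pls L L)" using L(2) by blast
    then obtain n where n: "n \<epsilon> om" "\<not> pls L L \<preceq> ap f n" using pls_R[OF L(1) L(1)] by blast
    have fn: "ap f (suc n) \<epsilon> R" using f[OF om_suc[OF n(1)]] by simp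
    have "pls L L \<preceq> ap f n"
      using Lf[OF om_suc[OF n(1)]] unfolding leq_def[of L]
    proof
      assume *: "L \<prec> ap f (suc n)"
      then have "pls L L \<prec> pls (ap f (suc n)) L" using pls_mono L(1) fn by simp
      moreover have "pls (ap f (suc n)) L \<prec> pls (ap f (suc n)) (ap f (suc n))"
        using * pls_mono_left L(1) fn by simp
      ultimately show ?thesis
        using lss_trans[of "pls L L" "pls (ap f (suc n)) L"] L(1) fn half[OF n(1)] f[OF n(1)]
        by (simp add: leq_def)
    next
      assume "L = ap f (suc n)"
      then show ?thesis using half[OF n(1)] by simp
    qed
    then show False using n(2) by blast
  qed
  then show thesis using that[of f] f mono by blast
qed

section \<open>Zero-sets\<close>

lemma contD:
  assumes g: "cont X T R lt g"
  shows "fnc g X" "\<And>x. x \<epsilon> X \<Longrightarrow> ap g x \<epsilon> R"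
proof -
  have m: "maps_to g X R" using g by (simp add: cont_def)
  then show fn: "fnc g X" by (simp add: maps_to_def)
  fix x assume "x \<epsilon> X"
  then have "pr x (ap g x) \<epsilon> g" by (simp add: fnc_pr_iff[OF fn])
  then show "ap g x \<epsilon> R" using m unfolding maps_to_def by iprover
qed

lemma cont_nhd:
  assumes g: "cont X T R lt g" and x: "x \<epsilon> X"
    and ab: "a \<epsilon> R" "b \<epsilon> R" "a \<prec> ap g x" "ap g x \<prec> b"
  shows "\<exists>u. u \<epsilon> T \<and> x \<epsilon> u \<and> (\<forall>y. y \<epsilon> u \<longrightarrow> y \<epsilon> X \<and> a \<prec> ap g y \<and> ap g y \<prec> b)"
proof -
  note fn = contD(1)[OF g]
  have "dfn (\<lambda>e. a \<prec> e 0 \<and> e 0 \<prec> b)" by (intro dfn)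
  then obtain V where V: "\<And>r. r \<epsilon> V \<longleftrightarrow> r \<epsilon> R \<and> a \<prec> r \<and> r \<prec> b"
    using isset_sep[of "\<lambda>r. a \<prec> r \<and> r \<prec> b" R] by (auto simp: isset_def)
  have "ropen R lt V"
    unfolding ropen_def sub_def V using ab(1,2) by (auto simp: lss_def)
  then obtain u where u: "u \<epsilon> T" "\<And>x. x \<epsilon> u \<longleftrightarrow> x \<epsilon> X \<and> (\<exists>y. y \<epsilon> V \<and> pr x y \<epsilon> g)"
    using g unfolding cont_def by blast
  have "y \<epsilon> u \<longleftrightarrow> y \<epsilon> X \<and> a \<prec> ap g y \<and> ap g y \<prec> b" for y
    unfolding u(2) V fnc_pr_iff[OF fn] using contD(2)[OF g, of y] by auto
  then show ?thesis using u(1) x ab by blast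
qed

lemma cont_nhd_above:
  assumes "cont X T R lt g" "x \<epsilon> X" "a \<epsilon> R" "a \<prec> ap g x"
  shows "\<exists>u. u \<epsilon> T \<and> x \<epsilon> u \<and> (\<forall>y. y \<epsilon> u \<longrightarrow> y \<epsilon> X \<and> a \<prec> ap g y)"
proof -
  obtain b where "b \<epsilon> R" "ap g x \<prec> b" using no_max[OF contD(2)[OF assms(1,2)]] by blast
  then show ?thesis using cont_nhd[OF assms(1-3) _ assms(4)] by blast
qed

lemma cont_nhd_below:
  assumes "cont X T R lt g" "x \<epsilon> X" "b \<epsilon> R" "ap g x \<prec> b"
  shows "\<exists>u. u \<epsilon> T \<and> x \<epsilon> u \<and> (\<forall>y. y \<epsilon> u \<longrightarrow> y \<epsilon> X \<and> ap g y \<prec> b)"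
proof -
  obtain a where "a \<epsilon> R" "a \<prec> ap g x" using no_min[OF contD(2)[OF assms(1,2)]] by blast
  then show ?thesis using cont_nhd[OF assms(1,2) _ assms(3) _ assms(4)] by blast
qed

text \<open>The converse of \<open>cont_nhd\<close>: open intervals around a value suffice, and the
  preimage of an open set is then open by \<open>open_nhds\<close>.\<close>

lemma contI:
  assumes T: "top_on X T" and fn: "fnc g X" and gR: "\<And>x. x \<epsilon> X \<Longrightarrow> ap g x \<epsilon> R"
    and nhd: "\<And>x a b. x \<epsilon> X \<Longrightarrow> a \<epsilon> R \<Longrightarrow> b \<epsilon> R \<Longrightarrow> a \<prec> ap g x \<Longrightarrow> ap g x \<prec> b \<Longrightarrow>
      \<exists>u. u \<epsilon> T \<and> x \<epsilon> u \<and> (\<forall>y. y \<epsilon> u \<longrightarrow> a \<prec> ap g y \<and> ap g y \<prec> b)"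
  shows "cont X T R lt g"
  unfolding cont_def maps_to_def fnc_pr_iff[OF fn]
proof (intro conjI allI impI fn)
  show "y \<epsilon> R" if "x \<epsilon> X \<and> y = ap g x" for x y using that gR by blast
next
  fix V assume V: "ropen R lt V"
  have "dfn (\<lambda>e. ap g (e 0) \<epsilon> V)" by (intro dfn)
  then obtain s where s: "\<And>x. x \<epsilon> s \<longleftrightarrow> x \<epsilon> X \<and> ap g x \<epsilon> V"
    using isset_sep[of "\<lambda>x. ap g x \<epsilon> V" X] by (auto simp: isset_def)
  have "s \<epsilon> T"
  proof (rule open_nhds[OF T])
    fix x assume "x \<epsilon> s"
    then have x: "x \<epsilon> X" "ap g x \<epsilon> V" using s by auto
    then obtain a b where ab: "a \<epsilon> R" "b \<epsilon> R" "a \<prec> ap g x" "ap g x \<prec> b"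
      "\<And>y. y \<epsilon> R \<Longrightarrow> a \<prec> y \<Longrightarrow> y \<prec> b \<Longrightarrow> y \<epsilon> V"
      using V unfolding ropen_def lss_def by blast
    obtain u where u: "u \<epsilon> T" "x \<epsilon> u" "\<And>y. y \<epsilon> u \<Longrightarrow> a \<prec> ap g y \<and> ap g y \<prec> b"
      using nhd[OF x(1) ab(1-4)] by blast
    have "u \<sqsubseteq> X" using T u(1) by (simp add: top_on_def)
    then have "u \<sqsubseteq> s" using u(3) ab(5) gR unfolding sub_def s by blast
    then show "\<exists>u. u \<epsilon> T \<and> x \<epsilon> u \<and> u \<sqsubseteq> s" using u by blast
  qed
  then show "\<exists>u. u \<epsilon> T \<and> (\<forall>x. x \<epsilon> u \<longleftrightarrow> x \<epsilon> X \<and> (\<exists>y. y \<epsilon> V \<and> x \<epsilon> X \<and> y = ap g x))"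
    using s by (intro exI[of _ s]) auto
qed

text \<open>The supremum described at the beginning; unlike the usual series it needs no infinite sums.\<close>

lemma Inter_zero_sets:
  assumes T: "top_on X T"
    and F: "\<And>n. n \<epsilon> om \<Longrightarrow> inhab (ap F n)" "\<And>n. n \<epsilon> om \<Longrightarrow> fin (ap F n)"
      "\<And>n g. n \<epsilon> om \<Longrightarrow> g \<epsilon> ap F n \<Longrightarrow> cont X T R lt g"
  obtains h where "cont X T R lt h"
    "\<And>x. x \<epsilon> X \<Longrightarrow> ap h x = zero \<longleftrightarrow> (\<forall>n. n \<epsilon> om \<longrightarrow> (\<forall>g. g \<epsilon> ap F n \<longrightarrow> ap g x = zero))"
proof -
  have TX: "u \<sqsubseteq> X" if "u \<epsilon> T" for u using T that by (simp add: top_on_def)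
  have gR: "ap g x \<epsilon> R" if "n \<epsilon> om" "g \<epsilon> ap F n" "x \<epsilon> X" for n g x
    by (rule contD(2)[OF F(3)[OF that(1,2)] that(3)])
  obtain eps where eps01: "\<And>n. n \<epsilon> om \<Longrightarrow> ap eps n \<epsilon> R \<and> zero \<prec> ap eps n"
    "\<And>m n. n \<epsilon> om \<Longrightarrow> m \<epsilon> n \<Longrightarrow> ap eps n \<prec> ap eps m"
    "\<And>b. b \<epsilon> R \<Longrightarrow> zero \<prec> b \<Longrightarrow> \<exists>n. n \<epsilon> om \<and> ap eps n \<prec> b"
    by (rule null_sequence, rule that)
  then have eps: "\<And>n. n \<epsilon> om \<Longrightarrow> ap eps n \<epsilon> R" "\<And>n. n \<epsilon> om \<Longrightarrow> zero \<prec> ap eps n"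
    "\<And>m n. n \<epsilon> om \<Longrightarrow> m \<epsilon> n \<Longrightarrow> ap eps n \<prec> ap eps m"
    "\<And>b. b \<epsilon> R \<Longrightarrow> zero \<prec> b \<Longrightarrow> \<exists>n. n \<epsilon> om \<and> ap eps n \<prec> b"
    by iprover+
  \<comment> \<open>Instead of the minima themselves, everything below one of them is collected:
    \<open>r\<close> lies below the minimum of \<open>ap eps n\<close> and the absolute value
    exactly if it lies below \<open>ap eps n\<close> and below \<open>ap g x\<close> or its
    negative. The supremum is unchanged, and neither minimum nor absolute value has to be
    defined.\<close>
  define A where "A x r \<longleftrightarrow> r \<epsilon> R \<and> (\<exists>n. n \<epsilon> om \<and> (\<exists>g. g \<epsilon> ap F n \<and> r \<preceq> ap eps n \<and>
    (r \<preceq> ap g x \<or> r \<preceq> mns (ap g x))))" for x r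
  define H where "H x = the1 (\<lambda>y. y \<epsilon> R \<and> (\<forall>r. A x r \<longrightarrow> r \<preceq> y) \<and>
    (\<forall>c. c \<epsilon> R \<longrightarrow> (\<forall>r. A x r \<longrightarrow> r \<preceq> c) \<longrightarrow> y \<preceq> c))" for x
  have dH: "dfnT (\<lambda>e. H (e 0))" unfolding H_def A_def by (intro dfn)
  have abs_cases: "zero \<preceq> y \<or> zero \<preceq> mns y" if "y \<epsilon> R" for y
    using lss_total[OF zero_R that] mns_mono[of y zero] that by (auto simp: leq_def)
  \<comment> \<open>One of \<open>ap g x\<close> and its negative is at least \<open>zero\<close>.
    This makes \<open>A x\<close> inhabited and its supremum nonnegative.\<close>
  have A0: "A x zero" if x: "x \<epsilon> X" for x
  proof -
    obtain g where g: "g \<epsilon> ap F emp" using F(1)[OF om_0] by (auto simp: inhab_def)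
    have "zero \<preceq> ap eps emp" using eps(2)[OF om_0] by (simp add: leq_def)
    then show ?thesis
      unfolding A_def using g abs_cases[OF gR[OF om_0 g x]] zero_R om_0 by blast
  qed
  have H: "H x \<epsilon> R" "\<And>r. A x r \<Longrightarrow> r \<preceq> H x"
    "\<And>c. c \<epsilon> R \<Longrightarrow> (\<And>r. A x r \<Longrightarrow> r \<preceq> c) \<Longrightarrow> H x \<preceq> c" if x: "x \<epsilon> X" for x
  proof -
    have "\<exists>!y. y \<epsilon> R \<and> (\<forall>r. A x r \<longrightarrow> r \<preceq> y) \<and> (\<forall>c. c \<epsilon> R \<longrightarrow> (\<forall>r. A x r \<longrightarrow> r \<preceq> c) \<longrightarrow> y \<preceq> c)"
    proof (rule lub)
      show "dfn (\<lambda>e. A x (e 0))" unfolding A_def by (intro dfn)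
      show "r \<epsilon> R" if "A x r" for r using that by (simp add: A_def)
      show "A x zero" by (rule A0[OF x])
      show "ap eps emp \<epsilon> R" by (rule eps(1)[OF om_0])
      show "r \<preceq> ap eps emp" if r: "A x r" for r
      proof -
        obtain n where n: "n \<epsilon> om" "r \<preceq> ap eps n" "r \<epsilon> R" using r by (auto simp: A_def)
        have "n = emp \<or> emp \<epsilon> n" using om_linear[OF om_0 n(1)] by auto
        then have "ap eps n \<preceq> ap eps emp" using eps(3)[OF n(1)] by (auto simp: leq_def)
        then show ?thesis using leq_trans n eps(1) om_0 by blast
      qed
    qed
    from the1I[OF this] have *: "H x \<epsilon> R \<and> (\<forall>r. A x r \<longrightarrow> r \<preceq> H x) \<and>
      (\<forall>c. c \<epsilon> R \<longrightarrow> (\<forall>r. A x r \<longrightarrow> r \<preceq> c) \<longrightarrow> H x \<preceq> c)" unfolding H_def .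
    show "H x \<epsilon> R" using * by iprover
    show "r \<preceq> H x" if "A x r" for r using * that by iprover
    show "H x \<preceq> c" if "c \<epsilon> R" "\<And>r. A x r \<Longrightarrow> r \<preceq> c" for c using * that by iprover
  qed
  have H_pos: "zero \<preceq> H x" if "x \<epsilon> X" for x by (rule H(2)[OF that A0[OF that]])
  have min: "\<exists>r. r \<epsilon> R \<and> r \<preceq> u \<and> r \<preceq> v \<and> a \<prec> r" if "u \<epsilon> R" "v \<epsilon> R" "a \<prec> u" "a \<prec> v" for a u v
    using that lss_total[OF that(1,2)] leq_refl[of u] leq_refl[of v] unfolding leq_def by metis
  \<comment> \<open>A supremum exceeds \<open>a\<close> exactly if some term does. This yields both
    the zero-set of \<open>H\<close>, with \<open>a\<close> equal to \<open>zero\<close>, and the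
    lower half of continuity.\<close>
  have lss_H: "a \<prec> H x \<longleftrightarrow> (\<exists>n. n \<epsilon> om \<and> (\<exists>g. g \<epsilon> ap F n \<and> a \<prec> ap eps n \<and>
    (a \<prec> ap g x \<or> a \<prec> mns (ap g x))))" if a: "a \<epsilon> R" and x: "x \<epsilon> X" for a x
  proof
    assume "a \<prec> H x"
    then have "\<not> H x \<preceq> a" using not_lss[OF a H(1)[OF x]] by simp
    then obtain r where r: "A x r" "\<not> r \<preceq> a" using H(3)[OF x a] by blast
    then have rR: "r \<epsilon> R" by (simp add: A_def)
    have ar: "a \<prec> r" using not_lss[OF a rR] r(2) by blast
    obtain n g where ng: "n \<epsilon> om" "g \<epsilon> ap F n" "r \<preceq> ap eps n" "r \<preceq> ap g x \<or> r \<preceq> mns (ap g x)"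
      using r(1) by (auto simp: A_def)
    have lift: "a \<prec> v" if "r \<preceq> v" "v \<epsilon> R" for v
      by (rule lss_leq_trans[OF ar that(1) a rR that(2)])
    have "a \<prec> ap g x \<or> a \<prec> mns (ap g x)"
      using ng(4) lift gR[OF ng(1,2) x] mns_R by blast
    then show "\<exists>n. n \<epsilon> om \<and> (\<exists>g. g \<epsilon> ap F n \<and> a \<prec> ap eps n \<and> (a \<prec> ap g x \<or> a \<prec> mns (ap g x)))"
      using ng lift eps(1) by blast
  next
    assume "\<exists>n. n \<epsilon> om \<and> (\<exists>g. g \<epsilon> ap F n \<and> a \<prec> ap eps n \<and> (a \<prec> ap g x \<or> a \<prec> mns (ap g x)))"
    then obtain n g v where ng: "n \<epsilon> om" "g \<epsilon> ap F n" "a \<prec> ap eps n" "a \<prec> v"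
      "v = ap g x \<or> v = mns (ap g x)" by blast
    have "v \<epsilon> R" using ng(5) gR[OF ng(1,2) x] by auto
    then obtain r where r: "r \<epsilon> R" "r \<preceq> ap eps n" "r \<preceq> v" "a \<prec> r"
      using min[OF eps(1)[OF ng(1)] _ ng(3,4)] by blast
    then have "A x r" unfolding A_def using ng by blast
    then show "a \<prec> H x" using lss_leq_trans[OF r(4) H(2)[OF x]] a r(1) H(1)[OF x] by blast
  qed
  have zero_iff: "H x = zero \<longleftrightarrow> (\<forall>n. n \<epsilon> om \<longrightarrow> (\<forall>g. g \<epsilon> ap F n \<longrightarrow> ap g x = zero))"
    if x: "x \<epsilon> X" for x
  proof -
    have "zero \<prec> y \<or> zero \<prec> mns y \<longleftrightarrow> y \<noteq> zero" if "y \<epsilon> R" for y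
    proof (cases "y = zero")
      case True
      then show ?thesis by (simp add: lss_irrefl)
    next
      case False
      then show ?thesis using lss_total[OF zero_R that] mns_mono[of y zero] that by auto
    qed
    then have "zero \<prec> H x \<longleftrightarrow> (\<exists>n. n \<epsilon> om \<and> (\<exists>g. g \<epsilon> ap F n \<and> ap g x \<noteq> zero))"
      unfolding lss_H[OF zero_R x] using eps(2) gR x by blast
    moreover have "H x = zero \<longleftrightarrow> \<not> zero \<prec> H x"
      using H_pos[OF x] lss_irrefl[OF zero_R] unfolding leq_def by auto
    ultimately show ?thesis by blast
  qed
  \<comment> \<open>A single pair \<open>n\<close>, \<open>g\<close> witnesses that the value
    exceeds \<open>a\<close>, and by continuity of that one \<open>g\<close> it does so on a whole
    neighbourhood.\<close>
  have above: "\<exists>u. u \<epsilon> T \<and> x \<epsilon> u \<and> (\<forall>y. y \<epsilon> u \<longrightarrow> a \<prec> H y)"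
    if x: "x \<epsilon> X" and a: "a \<epsilon> R" and ax: "a \<prec> H x" for a x
  proof -
    obtain n g where ng: "n \<epsilon> om" "g \<epsilon> ap F n" "a \<prec> ap eps n" "a \<prec> ap g x \<or> a \<prec> mns (ap g x)"
      using ax unfolding lss_H[OF a x] by blast
    note g = F(3)[OF ng(1,2)]
    have "\<exists>u. u \<epsilon> T \<and> x \<epsilon> u \<and> (\<forall>y. y \<epsilon> u \<longrightarrow> y \<epsilon> X \<and> (a \<prec> ap g y \<or> a \<prec> mns (ap g y)))"
      using ng(4)
    proof
      assume "a \<prec> ap g x"
      then show ?thesis using cont_nhd_above[OF g x a] by blast
    next
      assume "a \<prec> mns (ap g x)"
      then have "ap g x \<prec> mns a" using lss_mns_iff a gR[OF ng(1,2) x] by blast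
      then obtain u where "u \<epsilon> T" "x \<epsilon> u" "\<And>y. y \<epsilon> u \<Longrightarrow> y \<epsilon> X \<and> ap g y \<prec> mns a"
        using cont_nhd_below[OF g x mns_R[OF a]] by blast
      then show ?thesis using lss_mns_iff a gR[OF ng(1,2)] by blast
    qed
    then show ?thesis using lss_H[OF a] ng(1-3) by blast
  qed
  have below: "\<exists>u. u \<epsilon> T \<and> x \<epsilon> u \<and> (\<forall>y. y \<epsilon> u \<longrightarrow> H y \<prec> b)"
    if x: "x \<epsilon> X" and b: "b \<epsilon> R" and bx: "H x \<prec> b" for b x
  proof -
    \<comment> \<open>Terms below a bound force only a weak inequality for the supremum, so the
      bound \<open>c\<close> is placed strictly between \<open>H x\<close> and
      \<open>b\<close>.\<close>
    obtain c where c: "c \<epsilon> R" "H x \<prec> c" "c \<prec> b" using dense[OF bx H(1)[OF x] b] by blast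
    have "zero \<prec> c" by (rule leq_lss_trans[OF H_pos[OF x] c(2)]) (simp_all add: H(1)[OF x] c(1))
    then obtain N where N: "N \<epsilon> om" "ap eps N \<prec> c" using eps(4)[OF c(1)] by blast
    \<comment> \<open>From \<open>N\<close> on the factor \<open>ap eps n\<close> alone keeps the
      terms below \<open>c\<close>, so only the finitely many pairs with \<open>n\<close> in
      \<open>N\<close> constrain the neighbourhood. The first disjunct remains even there: if
      \<open>ap eps n\<close> is already below \<open>c\<close>, the value of \<open>g\<close> may
      be large.\<close>
    define \<phi> where "\<phi> n g y \<longleftrightarrow> ap eps n \<prec> c \<or> (ap g y \<prec> c \<and> mns c \<prec> ap g y)" for n g y
    have "traced (\<lambda>u. u \<epsilon> T) X (\<lambda>y. \<forall>n. n \<epsilon> N \<longrightarrow> (\<forall>g. g \<epsilon> ap F n \<longrightarrow> \<phi> n g y))"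
    proof (rule traced_fin_all)
      show "dfn (\<lambda>e. e 0 \<epsilon> T)" by (intro dfn)
      show XT: "X \<epsilon> T" and ic: "inter_closed (\<lambda>u. u \<epsilon> T)"
        using T by (simp_all add: top_on_def inter_closed_def)
      show "fin N" by (rule fin_om[OF N(1)])
      show "dfn (\<lambda>e. \<forall>g. g \<epsilon> ap F (e 0) \<longrightarrow> \<phi> (e 0) g (e (Suc 0)))" unfolding \<phi>_def by (intro dfn)
      fix n assume "n \<epsilon> N"
      then have n: "n \<epsilon> om" by (rule om_mem[OF N(1)])
      show "traced (\<lambda>u. u \<epsilon> T) X (\<lambda>y. \<forall>g. g \<epsilon> ap F n \<longrightarrow> \<phi> n g y)"
      proof (rule traced_fin_all)
        show "dfn (\<lambda>e. e 0 \<epsilon> T)" by (intro dfn)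
        show "fin (ap F n)" by (rule F(2)[OF n])
        show "dfn (\<lambda>e. \<phi> n (e 0) (e (Suc 0)))" unfolding \<phi>_def by (intro dfn)
        fix g assume g: "g \<epsilon> ap F n"
        have "dfn (\<lambda>e. \<phi> n g (e 0))" unfolding \<phi>_def by (intro dfn)
        then obtain s where s: "\<And>y. y \<epsilon> s \<longleftrightarrow> y \<epsilon> X \<and> \<phi> n g y"
          using isset_sep[of "\<phi> n g" X] by (auto simp: isset_def)
        have "s \<epsilon> T"
        proof (cases "ap eps n \<prec> c")
          case True
          then have "s = X" by (intro extensionality) (simp add: s \<phi>_def)
          then show ?thesis using XT by simp
        next
          case False
          show ?thesis
          proof (rule open_nhds[OF T])
            fix y assume "y \<epsilon> s"
            then have y: "y \<epsilon> X" "ap g y \<prec> c" "mns c \<prec> ap g y" using s False by (auto simp: \<phi>_def)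
            obtain u where "u \<epsilon> T" "y \<epsilon> u" "\<And>z. z \<epsilon> u \<Longrightarrow> z \<epsilon> X \<and> mns c \<prec> ap g z \<and> ap g z \<prec> c"
              using cont_nhd[OF F(3)[OF n g] y(1) mns_R[OF c(1)] c(1) y(3,2)] by blast
            then show "\<exists>u. u \<epsilon> T \<and> y \<epsilon> u \<and> u \<sqsubseteq> s" unfolding sub_def s \<phi>_def by blast
          qed
        qed
        then show "traced (\<lambda>u. u \<epsilon> T) X (\<phi> n g)" unfolding traced_def using s by blast
      qed (fact XT ic)+
    qed
    then obtain u where u: "u \<epsilon> T"
      "\<And>y. y \<epsilon> u \<longleftrightarrow> y \<epsilon> X \<and> (\<forall>n. n \<epsilon> N \<longrightarrow> (\<forall>g. g \<epsilon> ap F n \<longrightarrow> \<phi> n g y))"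
      unfolding traced_def by blast
    have Nom: "n \<epsilon> om" if "n \<epsilon> N" for n by (rule om_mem[OF N(1) that])
    have "x \<epsilon> u"
      unfolding u(2)
    proof (intro conjI allI impI x)
      fix n g assume n: "n \<epsilon> N" and g: "g \<epsilon> ap F n"
      have "\<not> A x c" using H(2)[OF x, of c] not_lss[OF H(1)[OF x] c(1)] c(2) by blast
      then have "ap eps n \<prec> c \<or> ap g x \<prec> c \<and> mns (ap g x) \<prec> c"
        unfolding A_def using c(1) Nom[OF n] g not_lss[OF eps(1)[OF Nom[OF n]] c(1)]
          not_lss[OF gR[OF Nom[OF n] g x] c(1)] not_lss[OF mns_R[OF gR[OF Nom[OF n] g x]] c(1)]
        by blast
      then show "\<phi> n g x" unfolding \<phi>_def using mns_lss_iff[OF gR[OF Nom[OF n] g x] c(1)] by blast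
    qed
    moreover have "H y \<prec> b" if "y \<epsilon> u" for y
    proof -
      have y: "y \<epsilon> X" "\<And>n g. n \<epsilon> N \<Longrightarrow> g \<epsilon> ap F n \<Longrightarrow> \<phi> n g y" using that u(2) by blast+
      have "H y \<preceq> c"
      proof (rule H(3)[OF y(1) c(1)])
        fix r assume "A y r"
        then obtain n g where r: "r \<epsilon> R" and n: "n \<epsilon> om" and g: "g \<epsilon> ap F n"
          and rn: "r \<preceq> ap eps n" "r \<preceq> ap g y \<or> r \<preceq> mns (ap g y)" by (auto simp: A_def)
        have eps_case: "r \<prec> c" if "ap eps n \<prec> c"
          by (rule leq_lss_trans[OF rn(1) that r eps(1)[OF n] c(1)])
        have "r \<prec> c"
        proof (cases "n \<epsilon> N")
          case False
          then have "n = N \<or> N \<epsilon> n" using om_linear[OF n N(1)] by blast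
          then have "ap eps n \<preceq> ap eps N" using eps(3)[OF n] by (auto simp: leq_def)
          then show ?thesis
            using eps_case leq_lss_trans[OF _ N(2) eps(1)[OF n] eps(1)[OF N(1)] c(1)] by blast
        next
          case True
          note gy = gR[OF n g y(1)]
          have "ap eps n \<prec> c \<or> ap g y \<prec> c \<and> mns (ap g y) \<prec> c"
            using y(2)[OF True g] mns_lss_iff[OF gy c(1)] by (auto simp: \<phi>_def)
          then show ?thesis
            using eps_case rn(2) leq_lss_trans[OF _ _ r gy c(1)] leq_lss_trans[OF _ _ r mns_R[OF gy] c(1)]
            by blast
        qed
        then show "r \<preceq> c" by (simp add: leq_def)
      qed
      then show ?thesis by (rule leq_lss_trans[OF _ c(3) H(1)[OF y(1)] c(1) b])
    qed
    ultimately show ?thesis using u(1) by blast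
  qed
  have ap: "ap (mkfun X H) x = H x" if "x \<epsilon> X" for x by (rule ap_mkfun[OF dH that])
  show thesis
  proof (rule that)
    show "cont X T R lt (mkfun X H)"
    proof (rule contI[OF T fnc_mkfun[OF dH]])
      show "ap (mkfun X H) x \<epsilon> R" if "x \<epsilon> X" for x using ap[OF that] H(1)[OF that] by simp
      fix x a b
      assume x: "x \<epsilon> X" and ab: "a \<epsilon> R" "b \<epsilon> R" "a \<prec> ap (mkfun X H) x" "ap (mkfun X H) x \<prec> b"
      obtain u where u: "u \<epsilon> T" "x \<epsilon> u" "\<And>y. y \<epsilon> u \<Longrightarrow> a \<prec> H y"
        using above[OF x ab(1)] ab(3) ap[OF x] by auto
      obtain v where v: "v \<epsilon> T" "x \<epsilon> v" "\<And>y. y \<epsilon> v \<Longrightarrow> H y \<prec> b"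
        using below[OF x ab(2)] ab(4) ap[OF x] by auto
      obtain w where w: "w \<epsilon> T" "\<And>y. y \<epsilon> w \<longleftrightarrow> y \<epsilon> u \<and> y \<epsilon> v"
        using T u(1) v(1) unfolding top_on_def by blast
      have "a \<prec> ap (mkfun X H) y \<and> ap (mkfun X H) y \<prec> b" if "y \<epsilon> w" for y
      proof -
        have "y \<epsilon> X" using TX[OF w(1)] that by (simp add: sub_def)
        then show ?thesis using ap u(3) v(3) w(2) that by simp
      qed
      then show "\<exists>u. u \<epsilon> T \<and> x \<epsilon> u \<and> (\<forall>y. y \<epsilon> u \<longrightarrow> a \<prec> ap (mkfun X H) y \<and> ap (mkfun X H) y \<prec> b)"
        using w u(2) v(2) by blast
    qed
    show "ap (mkfun X H) x = zero \<longleftrightarrow> (\<forall>n. n \<epsilon> om \<longrightarrow> (\<forall>g. g \<epsilon> ap F n \<longrightarrow> ap g x = zero))"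
      if "x \<epsilon> X" for x
      using zero_iff[OF that] ap[OF that] by simp
  qed
qed

lemma stable_zset:
  assumes CMC: model_CMC and T: "top_on X T"
  shows "stable (zset X T R zero lt)"
  unfolding stable_def
proof (intro allI impI, elim conjE)
  fix U assume U: "inhab U" "ctb U" "\<forall>u. u \<epsilon> U \<longrightarrow> zset X T R zero lt u"
  obtain f where f: "\<And>u. u \<epsilon> U \<longleftrightarrow> (\<exists>n. n \<epsilon> om \<and> u = ap f n)"
    by (rule ctbE[OF U(2,1)], rule that)
  \<comment> \<open>Continuous functions are sets of pairs over \<open>X\<close> and
    \<open>R\<close>, so the bound \<open>pow (prd X R)\<close> excludes none of them and makes the
    collection a set.\<close>
  define Y where "Y n = mk (\<lambda>g. g \<epsilon> pow (prd X R) \<and> cont X T R lt g \<and>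
    (\<forall>x. x \<epsilon> ap f n \<longleftrightarrow> x \<epsilon> X \<and> pr x zero \<epsilon> g))" for n
  have dY: "dfnT (\<lambda>e. Y (e 0))"
    unfolding Y_def cont_def ropen_def maps_to_def by (intro dfn)
  have Y: "g \<epsilon> Y n \<longleftrightarrow> g \<epsilon> pow (prd X R) \<and> cont X T R lt g \<and>
    (\<forall>x. x \<epsilon> ap f n \<longleftrightarrow> x \<epsilon> X \<and> pr x zero \<epsilon> g)" for g n
    unfolding Y_def cont_def ropen_def maps_to_def by (rule mk_iff, rule isset_sep) (intro dfn)
  have "inhab (Y n)" if n: "n \<epsilon> om" for n
  proof -
    have "ap f n \<epsilon> U" using f n by auto
    then obtain g where g: "cont X T R lt g" "\<forall>x. x \<epsilon> ap f n \<longleftrightarrow> x \<epsilon> X \<and> pr x zero \<epsilon> g"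
      using U(3) by (auto simp: zset_def)
    have "p \<epsilon> prd X R" if p: "p \<epsilon> g" for p
    proof -
      obtain x y where xy: "x \<epsilon> X" "p = pr x y" using contD(1)[OF g(1)] p by (auto simp: fnc_def)
      then have "y = ap g x" using p by (simp add: fnc_pr_iff[OF contD(1)[OF g(1)]])
      then show ?thesis using xy contD(2)[OF g(1)] by auto
    qed
    then have "g \<epsilon> Y n" unfolding Y pow_iff using g by blast
    then show ?thesis by (auto simp: inhab_def)
  qed
  from CMC_sequence[OF CMC dY this] obtain F
    where F: "\<And>n. n \<epsilon> om \<Longrightarrow> inhab (ap F n)" "\<And>n. n \<epsilon> om \<Longrightarrow> fin (ap F n)"
      "\<And>n g. n \<epsilon> om \<Longrightarrow> g \<epsilon> ap F n \<Longrightarrow> g \<epsilon> Y n"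
    unfolding sub_def by metis
  have Fc: "cont X T R lt g" if "n \<epsilon> om" "g \<epsilon> ap F n" for n g
    using F(3)[OF that] Y by blast
  obtain h where h: "cont X T R lt h"
    "\<And>x. x \<epsilon> X \<Longrightarrow> ap h x = zero \<longleftrightarrow> (\<forall>n. n \<epsilon> om \<longrightarrow> (\<forall>g. g \<epsilon> ap F n \<longrightarrow> ap g x = zero))"
    by (rule Inter_zero_sets[OF T F(1,2) Fc]) (assumption+, rule that)
  have "dfn (\<lambda>e. pr (e 0) zero \<epsilon> h)" by (intro dfn)
  then obtain s where s: "\<And>x. x \<epsilon> s \<longleftrightarrow> x \<epsilon> X \<and> pr x zero \<epsilon> h"
    using isset_sep[of "\<lambda>x. pr x zero \<epsilon> h" X] by (auto simp: isset_def)
  have "zset X T R zero lt s" unfolding zset_def using h(1) s by blast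
  moreover have "inter_of s U"
  proof -
    \<comment> \<open>All members of \<open>ap F n\<close> have the same zero-set, and there is at
      least one of them. Hence vanishing of all and vanishing of one are equivalent at each point of
      \<open>X\<close>.\<close>
    have fn: "x \<epsilon> ap f n \<longleftrightarrow> x \<epsilon> X \<and> (\<forall>g. g \<epsilon> ap F n \<longrightarrow> ap g x = zero)" if n: "n \<epsilon> om" for x n
    proof -
      have *: "x \<epsilon> ap f n \<longleftrightarrow> x \<epsilon> X \<and> ap g x = zero" if g: "g \<epsilon> ap F n" for g
      proof -
        have "x \<epsilon> ap f n \<longleftrightarrow> x \<epsilon> X \<and> pr x zero \<epsilon> g" using F(3)[OF n g] Y by blast
        then show ?thesis using fnc_pr_iff[OF contD(1)[OF Fc[OF n g]]] by auto
      qed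
      obtain g where "g \<epsilon> ap F n" using F(1)[OF n] by (auto simp: inhab_def)
      then show ?thesis using * by blast
    qed
    have "x \<epsilon> s \<longleftrightarrow> x \<epsilon> X \<and> (\<forall>n. n \<epsilon> om \<longrightarrow> (\<forall>g. g \<epsilon> ap F n \<longrightarrow> ap g x = zero))" for x
      unfolding s fnc_pr_iff[OF contD(1)[OF h(1)]] using h(2)[of x] by auto
    then have "x \<epsilon> s \<longleftrightarrow> (\<forall>n. n \<epsilon> om \<longrightarrow> x \<epsilon> ap f n)" for x
      using fn om_0 by blast
    moreover have "(\<forall>u. u \<epsilon> U \<longrightarrow> x \<epsilon> u) \<longleftrightarrow> (\<forall>n. n \<epsilon> om \<longrightarrow> x \<epsilon> ap f n)" for x
      using f by auto
    ultimately show ?thesis by (simp add: inter_of_def)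
  qed
  ultimately show "\<exists>s. inter_of s U \<and> zset X T R zero lt s" by blast
qed

end

context zf_model
begin

theorem model_CMC_imp_stable: "model_CMC \<Longrightarrow> model_stable"
  unfolding model_stable_def
proof (intro allI impI conjI)
  fix X T assume CMC: model_CMC and T: "top_on X T"
  show "stable (cinter (clop X T))" "stable (cinter (\<lambda>u. u \<epsilon> T))"
    by (rule stable_CO_G_delta[OF CMC T])+
  fix R zero one add mul lt assume "is_reals R zero one add mul lt"
  then interpret zf_model_reals E e0 R zero one add mul lt
    by unfold_locales
  show "stable (zset X T R zero lt)" by (rule stable_zset[OF CMC T])
qed

end

theorem theorem4p9:
  shows "(ZF \<turnstile> sentence (CMC \<^bold>\<longrightarrow> families_stable \<^bold>\<and> delta_is_P_space)) \<and>
         (ZF \<turnstile> sentence (families_stable \<^bold>\<longrightarrow> delta_is_P_space))"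
proof (intro conjI ZF_completeness)
  fix E :: "nat \<Rightarrow> nat \<Rightarrow> bool" and e
  assume "zf_sat (=) E e"
  then interpret zf_model E e by (rule zf_model.intro)
  show "sat (=) E e (sentence (CMC \<^bold>\<longrightarrow> families_stable \<^bold>\<and> delta_is_P_space))"
    \<comment> \<open>Claim (ii) is obtained from CMC through claim (i).\<close>
    using model_CMC_imp_stable model_stable_imp_pspace
    by (simp add: sat_sentence[of _ _ _ _ e] hold_simps holds)
  show "sat (=) E e (sentence (families_stable \<^bold>\<longrightarrow> delta_is_P_space))"
    using model_stable_imp_pspace by (simp add: sat_sentence[of _ _ _ _ e] hold_simps holds)
qed

end
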